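(* Let $u_0\in C^2(\mathbb{R}^n)$ be a $2$-convex function with $\sup_{x\in\mathbb{R}^n}|D^2u_0|^2\le c$ for some $c>0$, and suppose that $$\lim_{\mu\to\infty}\frac{u_0(\mu x)}{\mu^2}=U_0(x)$$ for some function $U_0:\mathbb{R}^n\to\mathbb{R}$. Let $u(x,t)$ be the unique solution in $C^0(\mathbb{R}^n\times[0,\infty))\cap C^\infty(\mathbb{R}^n\times(0,\infty))$ of $$\frac{\partial u}{\partial t}=\frac{1}{\sqrt{-1}}\log\frac{\det(I+\sqrt{-1}\,D^2u)}{\sqrt{\det(I+(D^2u)^2)}}\qquad(\ast)$$ with $u(x,0)=u_0(x)$ such that for every $t>0$ the function $u(\cdot,t)$ is $2$-convex, and for every $\ell\ge2$ there is a constant $c_\ell>0$ with $\sup_{x\in\mathbb{R}^n}|D^\ell u(x,t)|^2\le c_\ell t^{2-\ell}$ for all $t>0$. Then, as $\mu\to\infty$, the functions $(x,t)\mapsto u(\mu x,\mu^2t)/\mu^2$ converge in $C^\infty_{\mathrm{loc}}(\mathbb{R}^n\times(0,\infty))$ to a smooth self-expanding solution $U(x,t)$ of $(\ast)$. Moreover, as $t\to0$, $U(\cdot,t)$ converges to $U_0$ in $C^0_{\mathrm{loc}}(\mathbb{R}^n)$.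
   Context: $D$ denotes the spatial derivative in $x\in\mathbb{R}^n$ and $|D^\ell u|$ the Euclidean norm of the tensor of $\ell$-th spatial derivatives. If $\lambda_1,\dots,\lambda_n$ are the eigenvalues of $D^2u$, the right-hand side of the equation is $\sum_i\arctan\lambda_i$. A $C^2$ function $u:\mathbb{R}^n\to\mathbb{R}$ is $2$-convex if at every point the eigenvalues $\lambda_1,\dots,\lambda_n$ of $D^2u$ satisfy $\lambda_i+\lambda_j\ge0$ and $1+\lambda_i\lambda_j\ge0$ for all $i\ne j$. A solution $U:\mathbb{R}^n\times(0,\infty)\to\mathbb{R}$ of $(\ast)$ is self-expanding if $U(x,t)=t\,U(x/\sqrt t,1)$ for all $x\in\mathbb{R}^n$, $t>0$. Existence and uniqueness of the solution $u$ with the listed properties is a known result for such $u_0$. *)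

theory Defs
  imports "HOL-Analysis.Analysis" "HOL-Computational_Algebra.Fundamental_Theorem_Algebra"
begin

section \<open>Eigenvalues and the Lagrangian angle\<close>

definition charpoly :: "'a::comm_ring_1^'n^'n \<Rightarrow> 'a poly" where
  "charpoly A = det (\<chi> i j. (if i = j then [:0, 1:] else 0) - [:A $ i $ j:])"

text \<open>Real eigenvalues with algebraic multiplicity; there are \<open>CARD('n)\<close> of them if
  \<open>A\<close> is symmetric, see \<open>size_eigenvalues\<close> below.\<close>

definition eigenvalues :: "real^'n^'n \<Rightarrow> real multiset" where
  "eigenvalues A = proots (charpoly A)"

text \<open>The branch of \<open>(1/\<i>) log (det (I + \<i>A) / sqrt (det (I + A\<^sup>2)))\<close> given by the sum of the
  arctangents of the eigenvalues. (The principal branch would agree with it only modulo \<open>2\<pi>\<close>.)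
  The lemma \<open>exp_lagrangian_angle\<close> below shows that it is a branch of this logarithm.\<close>

definition lagrangian_angle :: "real^'n^'n \<Rightarrow> real" where
  "lagrangian_angle A = (\<Sum>r\<in>#eigenvalues A. arctan r)"

lemma poly_charpoly: "poly (charpoly A) z = det (mat z - A)"
proof -
  have *: "poly (of_int k) z = of_int k" for k :: int and z :: 'a
    by (simp add: of_int_poly)
  have "poly ((if i = j then [:0, 1:] else 0) - [:A $ i $ j:]) z = (mat z - A) $ i $ j" for i j
    by (simp add: mat_def)
  then show ?thesis
    unfolding charpoly_def det_def
    by (simp add: poly_sum poly_prod *)
qed

lemma charpoly_monic:
  fixes A :: "'a::idom^'n^'n"
  shows "degree (charpoly A) = CARD('n)" "lead_coeff (charpoly A) = 1"
proof -
  define B where "B = (\<chi> i j. (if i = j then [:0, 1:] else 0) - [:A $ i $ j:])"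
  have degB: "degree (B $ i $ j) = (if i = j then 1 else 0)" for i j
    by (simp add: B_def)
  have degP: "degree (\<Prod>i\<in>UNIV. B $ i $ p i) \<le> card {i. p i = i}" for p
  proof -
    have "degree (\<Prod>i\<in>UNIV. B $ i $ p i) \<le> (\<Sum>i\<in>UNIV. degree (B $ i $ p i))"
      by (rule degree_prod_sum_le[unfolded o_def]) simp
    also have "\<dots> = (\<Sum>i\<in>UNIV. if p i = i then 1 else 0)"
      by (intro sum.cong) (auto simp: degB)
    also have "\<dots> = card {i. p i = i}"
      by (simp add: sum.If_cases)
    finally show ?thesis .
  qed
  define T where "T = (\<lambda>p. of_int (sign p) * (\<Prod>i\<in>UNIV. B $ i $ p i))"
  have degT: "degree (T p) \<le> card {i. p i = i}" for p
  proof -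
    have "degree (T p) \<le> degree (of_int (sign p) :: 'a poly) + degree (\<Prod>i\<in>UNIV. B $ i $ p i)"
      unfolding T_def by (rule degree_mult_le)
    then show ?thesis using degP[of p] by (simp add: of_int_poly)
  qed
  have C: "charpoly A = (\<Sum>p\<in>{p. p permutes (UNIV::'n set)}. T p)"
    unfolding charpoly_def det_def T_def B_def by simp
  have dle: "degree (charpoly A) \<le> CARD('n)"
    unfolding C
  proof (rule degree_sum_le)
    fix p show "degree (T p) \<le> CARD('n)"
      using degT[of p] card_mono[of UNIV "{i. p i = i}"] by (meson finite le_trans subset_UNIV)
  qed (simp add: finite_permutations)
  have Bii: "B $ i $ i = [:- (A $ i $ i), 1:]" for i
    by (simp add: B_def)
  have Tid: "coeff (T id) CARD('n) = 1"
  proof -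
    have "degree (\<Prod>i\<in>UNIV. B $ i $ i) = CARD('n)"
      using degree_prod_eq_sum_degree[of UNIV "\<lambda>i. B $ i $ i"] by (simp add: Bii)
    moreover have "lead_coeff (\<Prod>i\<in>UNIV. B $ i $ i) = 1"
      by (simp add: lead_coeff_prod Bii)
    ultimately show ?thesis by (simp add: T_def sign_id)
  qed
  have Tp: "coeff (T p) CARD('n) = 0" if "p \<noteq> id" for p
  proof -
    have "{i. p i = i} \<subset> UNIV" using that by (auto simp: id_def fun_eq_iff)
    then have "card {i. p i = i} < CARD('n)" by (intro psubset_card_mono) auto
    with degT[of p] show ?thesis by (intro coeff_eq_0) simp
  qed
  have "coeff (charpoly A) CARD('n) = (\<Sum>p\<in>{p. p permutes (UNIV::'n set)}. coeff (T p) CARD('n))"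
    by (simp add: C coeff_sum)
  also have "\<dots> = (\<Sum>p\<in>{id}. coeff (T p) CARD('n))"
    by (rule sum.mono_neutral_right) (auto simp: finite_permutations permutes_id Tp)
  finally have c1: "coeff (charpoly A) CARD('n) = 1" using Tid by simp
  then have "CARD('n) \<le> degree (charpoly A)" by (intro le_degree) simp
  with dle show "degree (charpoly A) = CARD('n)" by simp
  with c1 show "lead_coeff (charpoly A) = 1" by simp
qed

definition cmat :: "real^'n^'n \<Rightarrow> complex^'n^'n" where
  "cmat A = (\<chi> i j. complex_of_real (A $ i $ j))"

lemma det_cmat: "det (cmat A) = complex_of_real (det A)"
  by (simp add: det_def cmat_def)

lemma of_real_map_poly_mult:
  "map_poly complex_of_real (p * q) = map_poly complex_of_real p * map_poly complex_of_real q"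
  by (rule poly_eqI) (simp add: coeff_map_poly coeff_mult)

lemma poly_of_real_map_poly:
  "poly (map_poly complex_of_real p) (complex_of_real x) = complex_of_real (poly p x)"
  by (induction p) (simp_all add: map_poly_pCons)

lemma charpoly_cmat:
  fixes A :: "real^'n^'n"
  shows "charpoly (cmat A) = map_poly complex_of_real (charpoly A)"
proof (rule poly_eqI_degree[where A = "(\<lambda>k. complex_of_real (real k)) ` {..CARD('n)}"])
  fix z assume "z \<in> (\<lambda>k. complex_of_real (real k)) ` {..CARD('n)}"
  then obtain x where z: "z = complex_of_real x" by blast
  have "mat z - cmat A = cmat (mat x - A)"
    by (simp add: z cmat_def mat_def vec_eq_iff)
  then have "poly (charpoly (cmat A)) z = complex_of_real (poly (charpoly A) x)"
    by (simp add: poly_charpoly det_cmat)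
  also have "\<dots> = poly (map_poly complex_of_real (charpoly A)) z"
    unfolding z by (simp add: poly_of_real_map_poly)
  finally show "poly (charpoly (cmat A)) z = poly (map_poly complex_of_real (charpoly A)) z" .
qed (simp_all add: card_image inj_on_def degree_map_poly charpoly_monic)

lemma charpoly_root_real:
  fixes A :: "real^'n^'n"
  assumes sym: "transpose A = A" and root: "poly (charpoly (cmat A)) z = 0"
  shows "z \<in> \<real>"
proof -
  have sym': "A $ i $ j = A $ j $ i" for i j
    using sym by (metis transpose_def vec_lambda_beta)
  have "det (mat z - cmat A) = 0" using root by (simp add: poly_charpoly)
  then have "\<not> invertible (mat z - cmat A)" by (simp add: invertible_det_nz)
  then have "\<not> (\<exists>B. B ** (mat z - cmat A) = mat 1)" by (simp add: invertible_left_inverse)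
  then obtain v where v: "(mat z - cmat A) *v v = 0" "v \<noteq> 0"
    unfolding matrix_left_invertible_ker by auto
  have ev: "(\<Sum>j\<in>UNIV. complex_of_real (A $ i $ j) * v $ j) = z * v $ i" for i
  proof -
    have "0 = ((mat z - cmat A) *v v) $ i" using v by simp
    also have "\<dots> = (\<Sum>j\<in>UNIV. (if i = j then z else 0) * v $ j)
        - (\<Sum>j\<in>UNIV. complex_of_real (A $ i $ j) * v $ j)"
      by (simp add: matrix_vector_mult_def mat_def cmat_def algebra_simps sum_subtractf)
    also have "(\<Sum>j\<in>UNIV. (if i = j then z else 0) * v $ j) = z * v $ i"
      by (simp add: if_distrib[of "\<lambda>a. a * _"] cong: if_cong)
    finally show ?thesis by simp
  qed
  define S where "S = (\<Sum>i\<in>UNIV. \<Sum>j\<in>UNIV. cnj (v $ i) * complex_of_real (A $ i $ j) * v $ j)"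
  define N where "N = (\<Sum>i\<in>UNIV. (cmod (v $ i))\<^sup>2)"
  have "S = (\<Sum>i\<in>UNIV. cnj (v $ i) * (z * v $ i))"
    unfolding S_def ev[symmetric] by (simp add: sum_distrib_left mult.assoc)
  also have "\<dots> = z * complex_of_real N"
    unfolding N_def by (simp add: sum_distrib_left complex_norm_square mult.assoc mult.commute mult.left_commute
        del: of_real_power)
  finally have S: "S = z * complex_of_real N" .
  have "cnj S = (\<Sum>i\<in>UNIV. \<Sum>j\<in>UNIV. v $ i * complex_of_real (A $ i $ j) * cnj (v $ j))"
    by (simp add: S_def)
  also have "\<dots> = (\<Sum>j\<in>UNIV. \<Sum>i\<in>UNIV. v $ i * complex_of_real (A $ i $ j) * cnj (v $ j))"
    by (rule sum.swap)
  also have "\<dots> = S"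
    unfolding S_def by (intro sum.cong refl) (metis sym' mult.commute mult.left_commute)
  finally have "cnj S = S" .
  then have "cnj z * complex_of_real N = z * complex_of_real N" by (simp add: S)
  moreover have "N \<noteq> 0"
  proof
    assume "N = 0"
    then have "v $ i = 0" for i
      unfolding N_def by (subst (asm) sum_nonneg_eq_0_iff) auto
    with v(2) show False by (simp add: vec_eq_iff)
  qed
  ultimately have "cnj z = z" by simp
  then show ?thesis by (simp add: Reals_cnj_iff)
qed

lemma real_poly_splits:
  fixes p :: "real poly"
  assumes "p \<noteq> 0" "\<And>z. poly (map_poly complex_of_real p) z = 0 \<Longrightarrow> z \<in> \<real>"
  shows "p = smult (lead_coeff p) (\<Prod>r\<in>#proots p. [:- r, 1:])"
  using assms
proof (induction "degree p" arbitrary: p rule: less_induct)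
  case less
  show ?case
  proof (cases "degree p = 0")
    case True
    then obtain c where "p = [:c:]" by (metis degree_eq_zeroE)
    then show ?thesis by simp
  next
    case False
    have "degree (map_poly complex_of_real p) > 0"
      using False by (simp add: degree_map_poly)
    then obtain z where z: "poly (map_poly complex_of_real p) z = 0"
      using alg_closed_imp_poly_has_root[of "map_poly complex_of_real p"] by auto
    then obtain x where x: "z = complex_of_real x" using less.prems(2) Reals_cases by metis
    have "poly p x = 0" using z unfolding x by (simp add: poly_of_real_map_poly)
    then obtain q where q: "p = [:- x, 1:] * q" by (meson poly_eq_0_iff_dvd dvdE)
    have q0: "q \<noteq> 0" using less.prems(1) q by auto
    have deg: "degree p = Suc (degree q)" unfolding q using q0 by (subst degree_mult_eq) auto
    have "map_poly complex_of_real p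
        = map_poly complex_of_real [:- x, 1:] * map_poly complex_of_real q"
      unfolding q by (rule of_real_map_poly_mult)
    then have "z \<in> \<real>" if "poly (map_poly complex_of_real q) z = 0" for z
      using that less.prems(2)[of z] by simp
    then have IH: "q = smult (lead_coeff q) (\<Prod>r\<in>#proots q. [:- r, 1:])"
      using less.hyps[of q] deg q0 by simp
    have lc: "lead_coeff p = lead_coeff q" unfolding q lead_coeff_mult by simp
    have "proots p = add_mset x (proots q)"
      unfolding q using q0 by (subst proots_mult) auto
    then have "smult (lead_coeff p) (\<Prod>r\<in>#proots p. [:- r, 1:])
      = [:- x, 1:] * smult (lead_coeff q) (\<Prod>r\<in>#proots q. [:- r, 1:])"
      by (simp add: lc del: mult_pCons_left)
    then show ?thesis using IH q by simp
  qed
qed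

lemma charpoly_eq_prod:
  fixes A :: "real^'n^'n"
  assumes "transpose A = A"
  shows "charpoly A = (\<Prod>r\<in>#eigenvalues A. [:- r, 1:])"
proof -
  have "charpoly A \<noteq> 0" using charpoly_monic(2)[of A] by auto
  then have "charpoly A = smult (lead_coeff (charpoly A)) (\<Prod>r\<in>#proots (charpoly A). [:- r, 1:])"
    using real_poly_splits[of "charpoly A"] charpoly_root_real[OF assms]
    by (metis charpoly_cmat)
  then show ?thesis unfolding charpoly_monic(2) eigenvalues_def by simp
qed

lemma size_eigenvalues:
  fixes A :: "real^'n^'n"
  assumes "transpose A = A"
  shows "size (eigenvalues A) = CARD('n)"
proof -
  have "degree (\<Prod>r\<in>#M. [:- r, 1:]) = size M" for M :: "real multiset"
  proof (induction M)
    case (add x M)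
    have "(\<Prod>r\<in>#M. [:- r, 1:]) \<noteq> 0" by (auto simp: prod_mset_zero_iff)
    then have "degree ([:- x, 1:] * (\<Prod>r\<in>#M. [:- r, 1:])) = Suc (size M)"
      by (subst degree_mult_eq) (auto simp: add.IH)
    then show ?case by (simp del: mult_pCons_left)
  qed simp
  then show ?thesis using charpoly_eq_prod[OF assms] charpoly_monic(1)[of A] by metis
qed

lemma det_scale: "det (\<chi> i j. c * B $ i $ j) = c ^ CARD('n) * det (B :: 'a::comm_ring_1^'n^'n)"
  by (simp add: det_def prod.distrib sum_distrib_left algebra_simps)

lemma prod_mset_gt0:
  fixes f :: "'a \<Rightarrow> real"
  assumes "\<And>x. f x > 0"
  shows "(\<Prod>x\<in>#M. f x) > 0"
  using assms by (induction M) auto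

lemma one_plus_ii_polar:
  "1 + \<i> * complex_of_real x = complex_of_real (sqrt (1 + x\<^sup>2)) * exp (\<i> * complex_of_real (arctan x))"
proof -
  have "sqrt (1 + x\<^sup>2) > 0" by (simp add: add_pos_nonneg)
  then show ?thesis
    by (simp add: complex_eq_iff Re_exp Im_exp cos_arctan sin_arctan)
qed

lemma det_I_plus_i:
  fixes A :: "real^'n^'n"
  assumes "transpose A = A"
  shows "det (mat 1 + (\<chi> i j. \<i> * complex_of_real (A $ i $ j)))
    = (\<Prod>r\<in>#eigenvalues A. 1 + \<i> * complex_of_real r)"
proof -
  have "(mat 1 + (\<chi> i j. \<i> * complex_of_real (A $ i $ j)))
      = (\<chi> i j. (- \<i>) * (mat \<i> - cmat A) $ i $ j)"
    by (simp add: vec_eq_iff mat_def cmat_def algebra_simps)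
  then have "det (mat 1 + (\<chi> i j. \<i> * complex_of_real (A $ i $ j)))
      = (- \<i>) ^ CARD('n) * poly (charpoly (cmat A)) \<i>"
    by (simp only: det_scale poly_charpoly)
  also have "poly (map_poly complex_of_real (\<Prod>r\<in>#M. [:- r, 1:])) \<i>
      = (\<Prod>r\<in>#M. \<i> - complex_of_real r)" for M
    by (induction M) (simp_all add: of_real_map_poly_mult map_poly_pCons del: mult_pCons_left)
  then have "poly (charpoly (cmat A)) \<i> = (\<Prod>r\<in>#eigenvalues A. \<i> - complex_of_real r)"
    using charpoly_eq_prod[OF assms] by (metis charpoly_cmat)
  also have "(- \<i>) ^ size M * (\<Prod>r\<in>#M. \<i> - complex_of_real r)
      = (\<Prod>r\<in>#M. 1 + \<i> * complex_of_real r)" for M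
  proof (induction M)
    case (add x M)
    have "(- \<i>) ^ size (add_mset x M) * (\<Prod>r\<in>#add_mset x M. \<i> - complex_of_real r)
      = (- \<i>) * (\<i> - complex_of_real x) * ((- \<i>) ^ size M * (\<Prod>r\<in>#M. \<i> - complex_of_real r))"
      by simp
    also have "\<dots> = (1 + \<i> * complex_of_real x) * (\<Prod>r\<in>#M. 1 + \<i> * complex_of_real r)"
      unfolding add.IH by (simp add: algebra_simps)
    finally show ?case by simp
  qed simp
  from this[of "eigenvalues A"] have "(- \<i>) ^ CARD('n) * (\<Prod>r\<in>#eigenvalues A. \<i> - complex_of_real r)
      = (\<Prod>r\<in>#eigenvalues A. 1 + \<i> * complex_of_real r)"
    by (simp add: size_eigenvalues[OF assms])
  finally show ?thesis .
qed

lemma exp_lagrangian_angle: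
  fixes A :: "real^'n^'n"
  assumes "transpose A = A"
  shows "exp (\<i> * complex_of_real (lagrangian_angle A))
    = det (mat 1 + (\<chi> i j. \<i> * complex_of_real (A $ i $ j)))
      / complex_of_real (sqrt (det (mat 1 + A ** A)))"
proof -
  define D where "D = det (mat 1 + (\<chi> i j. \<i> * complex_of_real (A $ i $ j)))"
  define R where "R = (\<Prod>r\<in>#eigenvalues A. sqrt (1 + r\<^sup>2))"
  have R: "R > 0" unfolding R_def
    by (rule prod_mset_gt0) (auto simp: add_pos_nonneg)
  have "(\<Prod>r\<in>#M. 1 + \<i> * complex_of_real r)
      = complex_of_real (\<Prod>r\<in>#M. sqrt (1 + r\<^sup>2))
        * exp (\<i> * complex_of_real (\<Sum>r\<in>#M. arctan r))" for M
    by (induction M) (simp_all add: one_plus_ii_polar exp_add algebra_simps)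
  then have D: "D = complex_of_real R * exp (\<i> * complex_of_real (lagrangian_angle A))"
    unfolding D_def R_def lagrangian_angle_def det_I_plus_i[OF assms] .
  have "cnj D = det (mat 1 + (\<chi> i j. - \<i> * complex_of_real (A $ i $ j)))"
  proof -
    have "cnj ((mat 1 + (\<chi> i j. \<i> * complex_of_real (A $ i $ j))) $ i $ j)
        = (mat 1 + (\<chi> i j. - \<i> * complex_of_real (A $ i $ j))) $ i $ j" for i j
      by (simp add: mat_def)
    then show ?thesis unfolding D_def det_def by (simp only: cnj_sum cnj_prod complex_cnj_mult complex_cnj_of_int)
  qed
  then have "D * cnj D = det ((mat 1 + (\<chi> i j. \<i> * complex_of_real (A $ i $ j)))
      ** (mat 1 + (\<chi> i j. - \<i> * complex_of_real (A $ i $ j))))"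
    by (simp add: D_def det_mul)
  also have "(mat 1 + (\<chi> i j. \<i> * complex_of_real (A $ i $ j)))
      ** (mat 1 + (\<chi> i j. - \<i> * complex_of_real (A $ i $ j))) = cmat (mat 1 + A ** A)"
  proof -
    have 1: "(mat 1 + X) ** (mat 1 + Y) = mat 1 + X + Y + X ** Y" for X Y :: "complex^'n^'n"
      by (simp add: vec_eq_iff matrix_matrix_mult_def mat_def algebra_simps sum.distrib
          if_distrib[of "\<lambda>a. a * _"] if_distrib[of "\<lambda>a. _ * a"] cong: if_cong)
    show ?thesis unfolding 1
      by (simp add: vec_eq_iff cmat_def matrix_matrix_mult_def mat_def sum_negf algebra_simps)
  qed
  finally have "complex_of_real ((cmod D)\<^sup>2) = complex_of_real (det (mat 1 + A ** A))"
    by (simp only: complex_norm_square det_cmat)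
  then have "(cmod D)\<^sup>2 = det (mat 1 + A ** A)" using of_real_eq_iff by blast
  moreover have "cmod D = R" using R by (simp add: D norm_mult)
  ultimately have "sqrt (det (mat 1 + A ** A)) = R" using R by (metis abs_of_pos real_sqrt_abs)
  then show ?thesis using R D unfolding D_def by simp
qed


section \<open>Spaces of differentiable functions and iterated derivatives\<close>

text \<open>\<open>C\<^sup>k\<close> on an open set \<open>S\<close>; only used for open \<open>S\<close>.\<close>

primrec Ck_on :: "nat \<Rightarrow> 'a::real_normed_vector set \<Rightarrow> ('a \<Rightarrow> real) \<Rightarrow> bool" where
  "Ck_on 0 S f \<longleftrightarrow> continuous_on S f"
| "Ck_on (Suc k) S f \<longleftrightarrow> (\<forall>x\<in>S. f differentiable (at x)) \<and>
     (\<forall>v. Ck_on k S (\<lambda>x. frechet_derivative f (at x) v))"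

definition smooth_on :: "'a::real_normed_vector set \<Rightarrow> ('a \<Rightarrow> real) \<Rightarrow> bool" where
  "smooth_on S f \<longleftrightarrow> (\<forall>k. Ck_on k S f)"

primrec iter_deriv ::
    "'a::real_normed_vector list \<Rightarrow> ('a \<Rightarrow> real) \<Rightarrow> 'a \<Rightarrow> real" where
  "iter_deriv [] f = f"
| "iter_deriv (v # vs) f = (\<lambda>x. frechet_derivative (iter_deriv vs f) (at x) v)"

text \<open>\<open>|D\<^sup>l f(x)|\<^sup>2\<close>: the sum of the squares of all components of the tensor of \<open>l\<close>-th derivatives.\<close>

definition deriv_norm_sq :: "nat \<Rightarrow> ('a::euclidean_space \<Rightarrow> real) \<Rightarrow> 'a \<Rightarrow> real" where
  "deriv_norm_sq l f x = (\<Sum>vs\<in>{vs. set vs \<subseteq> Basis \<and> length vs = l}. (iter_deriv vs f x)\<^sup>2)"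

definition hessian :: "(real^'n \<Rightarrow> real) \<Rightarrow> real^'n \<Rightarrow> real^'n^'n" where
  "hessian f x = (\<chi> i j. iter_deriv [axis i 1, axis j 1] f x)"

text \<open>Convergence of all derivatives, uniformly on compact subsets of the open set \<open>S\<close>.\<close>

definition converges_Cinf_loc ::
    "'a::euclidean_space set \<Rightarrow> ('i \<Rightarrow> 'a \<Rightarrow> real) \<Rightarrow> ('a \<Rightarrow> real) \<Rightarrow> 'i filter \<Rightarrow> bool" where
  "converges_Cinf_loc S f g F \<longleftrightarrow>
     (\<forall>K vs. compact K \<and> K \<subseteq> S \<and> set vs \<subseteq> Basis \<longrightarrow>
        uniform_limit K (\<lambda>i. iter_deriv vs (f i)) (iter_deriv vs g) F)"

definition converges_C0_loc ::
    "('i \<Rightarrow> 'a::euclidean_space \<Rightarrow> real) \<Rightarrow> ('a \<Rightarrow> real) \<Rightarrow> 'i filter \<Rightarrow> bool" where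
  "converges_C0_loc f g F \<longleftrightarrow> (\<forall>K. compact K \<longrightarrow> uniform_limit K f g F)"


section \<open>2-convex functions and the flow\<close>

text \<open>The condition \<open>{#a, b#} \<subseteq># eigenvalues _\<close> says that \<open>a = \<lambda>\<^sub>i\<close> and \<open>b = \<lambda>\<^sub>j\<close> for some \<open>i \<noteq> j\<close>.\<close>

definition two_convex :: "(real^'n \<Rightarrow> real) \<Rightarrow> bool" where
  "two_convex f \<longleftrightarrow> Ck_on 2 UNIV f \<and>
     (\<forall>x a b. {#a, b#} \<subseteq># eigenvalues (hessian f x) \<longrightarrow> a + b \<ge> 0 \<and> 1 + a * b \<ge> 0)"

text \<open>Space-time functions are defined on all of \<open>(real^'n) \<times> real\<close>; their values at times outside
  the relevant interval play no role.\<close>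

abbreviation spacetime :: "((real^'n) \<times> real) set" where
  "spacetime \<equiv> UNIV \<times> {0<..}"

definition solves_flow :: "((real^'n) \<times> real \<Rightarrow> real) \<Rightarrow> bool" where
  "solves_flow u \<longleftrightarrow> (\<forall>x. \<forall>t>0.
     ((\<lambda>s. u (x, s)) has_real_derivative lagrangian_angle (hessian (\<lambda>y. u (y, t)) x)) (at t))"

definition self_expanding :: "((real^'n) \<times> real \<Rightarrow> real) \<Rightarrow> bool" where
  "self_expanding U \<longleftrightarrow> (\<forall>x. \<forall>t>0. U (x, t) = t * U (x /\<^sub>R sqrt t, 1))"

end

theory Submission
  imports Defs
begin

text \<open>
  Put \<open>u\<^sub>\<mu> (x, t) = u (\<mu>x, \<mu>\<^sup>2t) / \<mu>\<^sup>2\<close>. Every \<open>u\<^sub>\<mu>\<close> solves the flow, the bounds on the spatial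
  derivatives are invariant under this rescaling, and the initial values \<open>u\<^sub>0 (\<mu>x) / \<mu>\<^sup>2\<close> converge
  to \<open>U\<^sub>0\<close>. The theorem holds because the whole family is Cauchy as \<open>\<mu> \<rightarrow> \<infinity>\<close>, with all its
  derivatives, uniformly on compact sets.

  The values are compared by a maximum principle. The Lagrangian angle \<open>\<theta>\<close> of a symmetric
  \<open>n \<times> n\<close> matrix is monotone, and \<open>A \<le> B + \<epsilon>I\<close> implies \<open>\<theta> A \<le> \<theta> B + n\<epsilon>\<close>
  (\<open>lagrangian_angle_le_shift\<close>). As \<open>\<bar>\<theta>\<bar> \<le> n\<pi>/2\<close>, solutions move with bounded speed, so that a
  quadratic barrier controls the difference of two solutions at infinity, and
  \<open>u - v \<le> a\<bar>x\<bar>\<^sup>2 + \<delta>\<close> at time \<open>0\<close> propagates to \<open>u - v \<le> 2a\<bar>x\<bar>\<^sup>2 + \<delta> + (4n + 1)at\<close>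
  (\<open>flow_comparison\<close>). The bound on \<open>D\<^sup>2u\<^sub>0\<close> makes the rescaled initial values equicontinuous, hence
  uniformly convergent on the unit sphere, and by homogeneity two of them with large
  parameters differ by at most \<open>\<epsilon>\<bar>x\<bar>\<^sup>2 + \<delta>\<close> on the whole space (\<open>rescaled_data_Cauchy\<close>).

  For the derivatives, \<open>\<theta>\<close> is the argument of \<open>P = det (I + \<i> D\<^sup>2u)\<close>, so a derivative of
  \<open>\<partial>\<^sub>t u = \<theta> (D\<^sup>2u)\<close> is \<open>Im (P'/P)\<close>, a polynomial in second and third derivatives of \<open>u\<close> divided by
  \<open>\<bar>P\<bar>\<^sup>2 \<ge> 1\<close>. Hence the spatial bounds imply local bounds, uniform in \<open>\<mu>\<close>, on all space-time derivatives
  of order at least two (\<open>flow_family_derivs_bounded\<close>). A first derivative is controlled by the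
  function and a second derivative (\<open>dir_deriv_interpolation\<close>), so the Cauchy property passes
  from the values to all derivatives, and \<open>smooth_limit\<close> produces the smooth limit \<open>U\<close>.

  The equation passes to the limit because \<open>\<theta>\<close> is Lipschitz. The limit is
  self-expanding because replacing \<open>\<mu>\<close> by \<open>\<mu>\<surd>t\<close> does not change it. Finally \<open>u\<^sub>\<mu>\<close> moves
  with speed at most \<open>n\<pi>/2\<close>, so that \<open>\<bar>U (x, t) - U\<^sub>0 x\<bar> \<le> n\<pi>t/2\<close>.
\<close>

section \<open>Monotonicity of the Lagrangian angle\<close>

definition I_plus_i :: "real^'n^'n \<Rightarrow> complex^'n^'n" where
  "I_plus_i A = mat 1 + (\<chi> i j. \<i> * complex_of_real (A $ i $ j))"

lemma transpose_eq_iff: "transpose A = A \<longleftrightarrow> (\<forall>i j. A $ i $ j = A $ j $ i)"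
  by (auto simp: transpose_def vec_eq_iff)

lemma cmod_prod_mset: "cmod (\<Prod>x\<in>#M. f x) = (\<Prod>x\<in>#M. cmod (f x))"
  by (induction M) (simp_all add: norm_mult)

lemma cmod_det_I_plus_i_ge_1:
  assumes "transpose A = A"
  shows "cmod (det (I_plus_i A)) \<ge> 1"
proof -
  have "(\<Prod>r\<in>#M. cmod (1 + \<i> * complex_of_real r)) \<ge> 1" for M
  proof (induction M)
    case (add r M)
    have "1 \<le> cmod (1 + \<i> * complex_of_real r)"
      by (simp add: cmod_def)
    then have "1 * 1 \<le> cmod (1 + \<i> * complex_of_real r) * (\<Prod>r\<in>#M. cmod (1 + \<i> * complex_of_real r))"
      using add by (intro mult_mono) auto
    then show ?case by simp
  qed simp
  then show ?thesis
    using det_I_plus_i[OF assms] by (simp add: I_plus_i_def cmod_prod_mset)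
qed

text \<open>The parameter \<open>s\<close> gives a path of nonzero numbers from \<open>1\<close> to \<open>det (I + \<i>A)\<close>. Along
  it each factor turns by \<open>arctan (s * r)\<close>, so that the total turning is the Lagrangian angle.\<close>

lemma det_I_plus_i_scaled:
  fixes A :: "real^'n^'n"
  assumes "transpose A = A"
  shows "det (I_plus_i (s *\<^sub>R A)) = (\<Prod>r\<in>#eigenvalues A. 1 + \<i> * complex_of_real (s * r))"
proof (cases "s = 0")
  case True
  have "I_plus_i (0 *\<^sub>R A) = mat 1" by (simp add: I_plus_i_def vec_eq_iff)
  then show ?thesis using True by (simp only: det_I) simp
next
  case False
  let ?c = "- \<i> * complex_of_real s" and ?z = "\<i> / complex_of_real s"
  have "I_plus_i (s *\<^sub>R A) = (\<chi> i j. ?c * (mat ?z - cmat A) $ i $ j)"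
    using False by (simp add: I_plus_i_def vec_eq_iff mat_def cmat_def algebra_simps)
  then have "det (I_plus_i (s *\<^sub>R A)) = ?c ^ CARD('n) * poly (charpoly (cmat A)) ?z"
    by (simp only: det_scale poly_charpoly)
  also have "poly (map_poly complex_of_real (\<Prod>r\<in>#M. [:- r, 1:])) ?z
      = (\<Prod>r\<in>#M. ?z - complex_of_real r)" for M
    by (induction M) (simp_all add: of_real_map_poly_mult map_poly_pCons del: mult_pCons_left)
  then have "poly (charpoly (cmat A)) ?z = (\<Prod>r\<in>#eigenvalues A. ?z - complex_of_real r)"
    using charpoly_eq_prod[OF assms] by (metis charpoly_cmat)
  also have "?c ^ size M * (\<Prod>r\<in>#M. ?z - complex_of_real r)
      = (\<Prod>r\<in>#M. 1 + \<i> * complex_of_real (s * r))" for M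
  proof (induction M)
    case (add x M)
    have "?c ^ size (add_mset x M) * (\<Prod>r\<in>#add_mset x M. ?z - complex_of_real r)
      = (?c * (?z - complex_of_real x)) * (?c ^ size M * (\<Prod>r\<in>#M. ?z - complex_of_real r))"
      by simp
    also have "?c * (?z - complex_of_real x) = 1 + \<i> * complex_of_real (s * x)"
      using False by (simp add: field_simps)
    finally show ?case unfolding add.IH by simp
  qed simp
  from this[of "eigenvalues A"]
  have "?c ^ CARD('n) * (\<Prod>r\<in>#eigenvalues A. ?z - complex_of_real r)
      = (\<Prod>r\<in>#eigenvalues A. 1 + \<i> * complex_of_real (s * r))"
    by (simp add: size_eigenvalues[OF assms])
  finally show ?thesis .
qed

text \<open>Two continuous arguments of the same nonvanishing path differ by a constant, since
  their difference takes values in a translate of \<open>2\<pi>\<int>\<close>. The increment of the argument can therefore be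
  read off any polar representation, even one with an unknown constant factor \<open>\<kappa>\<close>.\<close>

lemma continuous_phase_difference:
  fixes g :: "real \<Rightarrow> complex" and \<phi> \<rho> :: "real \<Rightarrow> real"
  assumes cont: "continuous_on {0..1} g" "continuous_on {0..1} \<phi>"
    and pos: "\<And>r. r \<in> {0..1} \<Longrightarrow> \<rho> r > 0"
    and eq: "\<And>r. r \<in> {0..1} \<Longrightarrow> exp (g r) = \<kappa> * complex_of_real (\<rho> r) * exp (\<i> * complex_of_real (\<phi> r))"
  shows "Im (g 1) - Im (g 0) = \<phi> 1 - \<phi> 0"
proof -
  define h where "h r = Im (g r) - \<phi> r" for r
  have \<kappa>: "\<kappa> \<noteq> 0" using eq[of 0] by force
  have e: "exp (\<i> * complex_of_real (h r)) = \<kappa> / complex_of_real (cmod \<kappa>)" if r: "r \<in> {0..1}" for r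
  proof -
    have "exp (Re (g r)) = cmod (exp (g r))" by simp
    also have "\<dots> = cmod \<kappa> * \<rho> r" unfolding eq[OF r] using pos[OF r] by (simp add: norm_mult)
    finally have R: "exp (Re (g r)) = cmod \<kappa> * \<rho> r" .
    have "exp (g r) = complex_of_real (exp (Re (g r))) * exp (\<i> * complex_of_real (Im (g r)))"
      by (metis complex_eq exp_add exp_of_real mult.commute)
    moreover have \<rho>0: "\<rho> r \<noteq> 0" using pos[OF r] by simp
    ultimately have "complex_of_real (cmod \<kappa> * \<rho> r) * exp (\<i> * complex_of_real (Im (g r)))
        = \<kappa> * complex_of_real (\<rho> r) * exp (\<i> * complex_of_real (\<phi> r))"
      using eq[OF r] R by simp
    then have "exp (\<i> * complex_of_real (Im (g r))) / exp (\<i> * complex_of_real (\<phi> r)) = \<kappa> / complex_of_real (cmod \<kappa>)"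
      using \<rho>0 \<kappa> by (auto simp: field_simps)
    then show ?thesis by (simp add: h_def exp_diff algebra_simps)
  qed
  have "h constant_on {0..1}"
  proof (rule continuous_discrete_range_constant)
    show "continuous_on {0..1} h"
      unfolding h_def by (intro continuous_intros cont)
    fix x :: real assume x: "x \<in> {0..1}"
    show "\<exists>e>0. \<forall>y. y \<in> {0..1} \<and> h y \<noteq> h x \<longrightarrow> e \<le> norm (h y - h x)"
    proof (intro exI[of _ "2 * pi"] conjI allI impI)
      fix y assume y: "y \<in> {0..1} \<and> h y \<noteq> h x"
      have "exp (\<i> * complex_of_real (h y)) = exp (\<i> * complex_of_real (h x))"
        using e x y by simp
      then obtain n :: int where "\<i> * complex_of_real (h y) = \<i> * complex_of_real (h x) + of_real (2 * n * pi) * \<i>"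
        unfolding exp_eq by blast
      then have n: "h y = h x + 2 * n * pi"
        by (auto simp: complex_eq_iff)
      then have "n \<noteq> 0" using y by auto
      then have "1 \<le> \<bar>real_of_int n\<bar>" by linarith
      then have "2 * pi * 1 \<le> 2 * pi * \<bar>real_of_int n\<bar>" by (intro mult_left_mono) auto
      then show "2 * pi \<le> norm (h y - h x)" by (simp add: n abs_mult)
    qed auto
  qed simp
  then have "h 1 = h 0" unfolding constant_on_def by auto
  then show ?thesis by (simp add: h_def)
qed

lemma prod_one_plus_i_polar:
  "(\<Prod>x\<in>#M. 1 + \<i> * complex_of_real (s * x))
    = complex_of_real (\<Prod>x\<in>#M. sqrt (1 + (s * x)\<^sup>2)) * exp (\<i> * complex_of_real (\<Sum>x\<in>#M. arctan (s * x)))"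
proof (induction M)
  case (add x M)
  have "(\<Prod>x\<in>#add_mset x M. 1 + \<i> * complex_of_real (s * x))
      = (1 + \<i> * complex_of_real (s * x)) * (\<Prod>x\<in>#M. 1 + \<i> * complex_of_real (s * x))"
    by simp
  also have "\<dots> = complex_of_real (\<Prod>x\<in>#add_mset x M. sqrt (1 + (s * x)\<^sup>2))
      * exp (\<i> * complex_of_real (\<Sum>x\<in>#add_mset x M. arctan (s * x)))"
    unfolding add.IH unfolding one_plus_ii_polar by (simp add: exp_add distrib_left mult_ac)
  finally show ?case .
qed simp

lemma prod_sqrt_pos: "(\<Prod>x\<in>#M. sqrt (1 + (s * x)\<^sup>2)) > (0::real)"
  by (induction M) (auto simp: add_pos_nonneg)

lemma det_I_plus_i_polar:
  fixes A :: "real^'n^'n"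
  assumes "transpose A = A"
  shows "det (I_plus_i A) = complex_of_real (cmod (det (I_plus_i A))) * exp (\<i> * complex_of_real (lagrangian_angle A))"
proof -
  define \<rho> where "\<rho> = (\<Prod>x\<in>#eigenvalues A. sqrt (1 + (1 * x)\<^sup>2))"
  have "det (I_plus_i A) = complex_of_real \<rho> * exp (\<i> * complex_of_real (lagrangian_angle A))"
    using det_I_plus_i_scaled[OF assms, of 1] prod_one_plus_i_polar[of 1 "eigenvalues A"]
    by (simp add: lagrangian_angle_def \<rho>_def)
  moreover from this have "cmod (det (I_plus_i A)) = \<rho>"
    using prod_sqrt_pos[of 1 "eigenvalues A"] by (simp add: \<rho>_def norm_mult)
  ultimately show ?thesis by simp
qed

text \<open>If \<open>v\<close> is in the kernel of \<open>I + \<i>(A + zH)\<close>, then the real part of the product of this equation with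
  \<open>v\<^sup>*\<close> reads \<open>\<bar>v\<bar>\<^sup>2 = Im z \<cdot> v\<^sup>*Hv\<close>, because \<open>v\<^sup>*Av\<close> and \<open>v\<^sup>*Hv\<close> are real.\<close>

lemma pencil_root_upper_half_plane:
  fixes A H :: "real^'n^'n"
  assumes symA: "transpose A = A" and symH: "transpose H = H"
    and psd: "\<And>v. 0 \<le> v \<bullet> (H *v v)"
    and root: "det (\<chi> i j. (if i = j then 1 else 0) + \<i> * (complex_of_real (A $ i $ j) + z * complex_of_real (H $ i $ j))) = 0"
      (is "det ?M = 0")
  shows "Im z > 0"
proof -
  have "\<not> (\<exists>B. B ** ?M = mat 1)"
    using root invertible_det_nz[of ?M] by (simp add: invertible_left_inverse)
  then obtain v where v: "?M *v v = 0" "v \<noteq> 0"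
    unfolding matrix_left_invertible_ker by auto
  define q where "q X = (\<Sum>i\<in>UNIV. \<Sum>j\<in>UNIV. cnj (v $ i) * complex_of_real (X $ i $ j) * v $ j)" for X :: "real^'n^'n"
  define N where "N = (\<Sum>i\<in>UNIV. (cmod (v $ i))\<^sup>2)"
  define a b where "a = (\<chi> i. Re (v $ i))" and "b = (\<chi> i. Im (v $ i))"
  have N: "N > 0"
  proof -
    from v obtain i where "v $ i \<noteq> 0" by (auto simp: vec_eq_iff)
    then show ?thesis unfolding N_def by (intro sum_pos2[of _ i]) auto
  qed
  have qre: "Re (q X) = a \<bullet> (X *v a) + b \<bullet> (X *v b)" for X
    by (simp add: q_def a_def b_def inner_vec_def matrix_vector_mult_def sum_distrib_left
        sum.distrib[symmetric] algebra_simps)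
  have qim: "Im (q X) = 0" if "transpose X = X" for X
  proof -
    have s: "X $ i $ j = X $ j $ i" for i j using that unfolding transpose_eq_iff by blast
    have "Im (q X) = (\<Sum>i\<in>UNIV. \<Sum>j\<in>UNIV. X $ i $ j * (a $ i * b $ j)) - (\<Sum>i\<in>UNIV. \<Sum>j\<in>UNIV. X $ i $ j * (b $ i * a $ j))"
      by (simp add: q_def a_def b_def sum_subtractf[symmetric] algebra_simps)
    also have "(\<Sum>i\<in>UNIV. \<Sum>j\<in>UNIV. X $ i $ j * (b $ i * a $ j)) = (\<Sum>j\<in>UNIV. \<Sum>i\<in>UNIV. X $ i $ j * (b $ i * a $ j))"
      by (rule sum.swap)
    also have "\<dots> = (\<Sum>i\<in>UNIV. \<Sum>j\<in>UNIV. X $ i $ j * (a $ i * b $ j))"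
      by (intro sum.cong refl) (metis s mult.commute)
    finally show ?thesis by simp
  qed
  have "0 = (\<Sum>i\<in>UNIV. cnj (v $ i) * (?M *v v) $ i)" using v by simp
  also have "\<dots> = (\<Sum>i\<in>UNIV. \<Sum>j\<in>UNIV. cnj (v $ i) * (if i = j then 1 else 0) * v $ j)
      + \<i> * q A + \<i> * z * q H"
    by (simp add: q_def matrix_vector_mult_def sum_distrib_left sum.distrib[symmetric] algebra_simps
        del: sum.delta sum.delta')
  also have "(\<Sum>i\<in>UNIV. \<Sum>j\<in>UNIV. cnj (v $ i) * (if i = j then 1 else 0) * v $ j) = complex_of_real N"
    by (simp add: N_def if_distrib[of "\<lambda>a. _ * a"] if_distrib[of "\<lambda>a. a * _"] complex_norm_square mult.commute
        del: of_real_power cong: if_cong)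
  finally have "Re (complex_of_real N + \<i> * q A + \<i> * z * q H) = 0" by simp
  then have *: "N = Im z * Re (q H)" using qim[OF symA] qim[OF symH] by simp
  have "Re (q H) \<ge> 0" using psd[of a] psd[of b] by (simp add: qre)
  then show ?thesis using * N by (metis mult_le_0_iff not_le)
qed

lemma pencil_factorization:
  fixes A H :: "real^'n^'n"
  assumes symA: "transpose A = A"
  obtains \<kappa> M where "\<And>z. det (\<chi> i j. (if i = j then 1 else 0) + \<i> * (complex_of_real (A $ i $ j) + z * complex_of_real (H $ i $ j)))
     = \<kappa> * (\<Prod>w\<in>#M. z - w)"
proof -
  define P where "P = det (\<chi> i j. [:(if i = j then 1 else 0) + \<i> * complex_of_real (A $ i $ j), \<i> * complex_of_real (H $ i $ j):])"
  have *: "poly (of_int k) z = of_int k" for k :: int and z :: complex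
    by (simp add: of_int_poly)
  have P: "poly P z = det (\<chi> i j. (if i = j then 1 else 0) + \<i> * (complex_of_real (A $ i $ j) + z * complex_of_real (H $ i $ j)))" for z
    unfolding P_def det_def by (simp add: poly_sum poly_prod * algebra_simps)
  have "(\<chi> i j. (if i = j then 1 else 0) + \<i> * (complex_of_real (A $ i $ j) + 0 * complex_of_real (H $ i $ j))) = I_plus_i A"
    by (simp add: I_plus_i_def vec_eq_iff mat_def)
  then have "poly P 0 = det (I_plus_i A)" unfolding P by (simp only:)
  then have "P \<noteq> 0" using cmod_det_I_plus_i_ge_1[OF symA] by auto
  then obtain M where M: "P = smult (lead_coeff P) (\<Prod>x\<in>#M. [:-x, 1:])"
    using alg_closed_imp_factorization by blast
  have "poly (\<Prod>x\<in>#M. [:-x, 1:]) z = (\<Prod>w\<in>#M. z - w)" for z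
    by (induction M) (simp_all del: mult_pCons_left)
  then have "poly P z = lead_coeff P * (\<Prod>w\<in>#M. z - w)" for z
    by (subst M) simp
  then show thesis using that P by metis
qed

text \<open>For \<open>w = x + \<i>y\<close> with \<open>y > 0\<close>, this is \<open>r - w = - \<i>y (1 + \<i>(r - x)/y)\<close> in polar form. The phase
  increases with \<open>r\<close>.\<close>

lemma upper_half_plane_phase:
  assumes "Im w > 0"
  shows "complex_of_real r - w = - \<i> * complex_of_real (Im w * sqrt (1 + ((r - Re w) / Im w)\<^sup>2))
     * exp (\<i> * complex_of_real (arctan ((r - Re w) / Im w)))"
proof -
  have "complex_of_real r - w = - \<i> * complex_of_real (Im w) * (1 + \<i> * complex_of_real ((r - Re w) / Im w))"
    using assms by (simp add: complex_eq_iff)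
  then show ?thesis unfolding one_plus_ii_polar by simp
qed

text \<open>Lift \<open>log det (I + \<i>s(A + rH))\<close> continuously to the unit square in \<open>(r, s)\<close>. The increments of its imaginary
  part along the sides \<open>r = 0\<close> and \<open>r = 1\<close> are the two angles, and there is none along \<open>s = 0\<close>.
  Along \<open>s = 1\<close> the determinant is a polynomial in \<open>r\<close> with all its roots in the upper half plane,
  so each linear factor contributes a nonnegative increment.\<close>

lemma lagrangian_angle_mono_add:
  fixes A H :: "real^'n^'n"
  assumes symA: "transpose A = A" and symH: "transpose H = H"
    and psd: "\<And>v. 0 \<le> v \<bullet> (H *v v)"
  shows "lagrangian_angle A \<le> lagrangian_angle (A + H)"
proof -
  define S where "S = {0..1::real} \<times> {0..1::real}"
  define G where "G = (\<lambda>(r,s). det (I_plus_i (s *\<^sub>R (A + r *\<^sub>R H))))"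
  have sym: "transpose (s *\<^sub>R (A + r *\<^sub>R H)) = s *\<^sub>R (A + r *\<^sub>R H)" for r s
    using symA symH unfolding transpose_eq_iff by simp
  have G0: "G p \<noteq> 0" for p
    using cmod_det_I_plus_i_ge_1[OF sym, of "snd p" "fst p"] by (auto simp: G_def split_def)
  have "continuous_on S G"
    unfolding G_def I_plus_i_def det_def split_def by (simp add: mat_def) (intro continuous_intros)
  moreover have "contractible S" unfolding S_def
    by (intro convex_imp_contractible convex_Times) auto
  ultimately obtain g where g: "continuous_on S g" "\<And>p. p \<in> S \<Longrightarrow> G p = exp (g p)"
    using continuous_logarithm_on_contractible[of S G] G0 by blast
  \<comment> \<open>The increments along the vertical sides are the angles.\<close>
  have vert: "Im (g (r, 1)) - Im (g (r, 0)) = lagrangian_angle (A + r *\<^sub>R H)" if r: "r \<in> {0..1}" for r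
  proof -
    let ?E = "eigenvalues (A + r *\<^sub>R H)"
    have "Im (g (r, 1)) - Im (g (r, 0)) = (\<Sum>x\<in>#?E. arctan (1 * x)) - (\<Sum>x\<in>#?E. arctan (0 * x))"
    proof (rule continuous_phase_difference)
      show "continuous_on {0..1} (\<lambda>s. g (r, s))"
        by (rule continuous_on_compose2[OF g(1)]) (use r in \<open>auto intro!: continuous_intros simp: S_def\<close>)
      show "continuous_on {0..1} (\<lambda>s. \<Sum>x\<in>#M. arctan (s * x))" for M
        by (induction M) (auto intro!: continuous_intros)
      show "(\<Prod>x\<in>#M. sqrt (1 + (s*x)\<^sup>2)) > 0" for M s
        by (rule prod_sqrt_pos)
      fix s :: real assume "s \<in> {0..1}"
      then have "exp (g (r, s)) = G (r, s)" using g(2) r by (simp add: S_def)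
      also have "\<dots> = (\<Prod>x\<in>#?E. 1 + \<i> * complex_of_real (s * x))"
        unfolding G_def using det_I_plus_i_scaled[of "A + r *\<^sub>R H"] sym[of 1 r] by simp
      finally show "exp (g (r, s)) = 1 * complex_of_real (\<Prod>x\<in>#?E. sqrt (1 + (s*x)\<^sup>2)) * exp (\<i> * complex_of_real (\<Sum>x\<in>#?E. arctan (s * x)))"
        unfolding prod_one_plus_i_polar by simp
    qed
    then show ?thesis by (simp add: lagrangian_angle_def)
  qed
  have bottom: "Im (g (1, 0)) - Im (g (0, 0)) = 0 - 0"
  proof (rule continuous_phase_difference)
    show "continuous_on {0..1} (\<lambda>r. g (r, 0))"
      by (rule continuous_on_compose2[OF g(1)]) (auto intro!: continuous_intros simp: S_def)
    fix r :: real assume "r \<in> {0..1}"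
    then have "exp (g (r, 0)) = G (r, 0)" using g(2) by (simp add: S_def)
    also have "I_plus_i (0 :: real^'n^'n) = mat 1" by (simp add: I_plus_i_def vec_eq_iff)
    then have "G (r, 0) = 1" by (simp add: G_def)
    finally show "exp (g (r, 0)) = 1 * complex_of_real 1 * exp (\<i> * complex_of_real 0)" by simp
  qed auto
  obtain \<kappa> M where fact: "\<And>z. det (\<chi> i j. (if i = j then 1 else 0) + \<i> * (complex_of_real (A $ i $ j) + z * complex_of_real (H $ i $ j)))
     = \<kappa> * (\<Prod>w\<in>#M. z - w)"
    using pencil_factorization[OF symA] by blast
  have upper: "Im w > 0" if "w \<in># M" for w
  proof (rule pencil_root_upper_half_plane[OF symA symH psd])
    show "det (\<chi> i j. (if i = j then 1 else 0) + \<i> * (complex_of_real (A $ i $ j) + w * complex_of_real (H $ i $ j))) = 0"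
      unfolding fact using that by (auto simp: prod_mset_zero_iff)
  qed
  define \<phi> where "\<phi> r = (\<Sum>w\<in>#M. arctan ((r - Re w) / Im w))" for r
  have top: "Im (g (1, 1)) - Im (g (0, 1)) = \<phi> 1 - \<phi> 0"
  proof (rule continuous_phase_difference)
    define \<rho> where "\<rho> r = (\<Prod>w\<in>#M. Im w * sqrt (1 + ((r - Re w) / Im w)\<^sup>2))" for r
    show "continuous_on {0..1} (\<lambda>r. g (r, 1))"
      by (rule continuous_on_compose2[OF g(1)]) (auto intro!: continuous_intros simp: S_def)
    have "continuous_on {0..1} (\<lambda>r. \<Sum>w\<in>#M. arctan ((r - Re w) / Im w))"
      using upper by (induction M) (auto intro!: continuous_intros, metis less_irrefl)
    then show "continuous_on {0..1} \<phi>" unfolding \<phi>_def .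
    show "\<rho> r > 0" for r
      using upper unfolding \<rho>_def by (induction M) (auto simp: add_pos_nonneg)
    fix r :: real assume "r \<in> {0..1}"
    then have "exp (g (r, 1)) = G (r, 1)" using g(2) by (simp add: S_def)
    also have "I_plus_i (A + r *\<^sub>R H) = (\<chi> i j. (if i = j then 1 else 0) + \<i> * (complex_of_real (A $ i $ j) + complex_of_real r * complex_of_real (H $ i $ j)))"
      by (simp add: I_plus_i_def vec_eq_iff mat_def)
    then have "G (r, 1) = \<kappa> * (\<Prod>w\<in>#M. complex_of_real r - w)"
      unfolding G_def using fact[of "complex_of_real r"] by simp
    also have "(\<Prod>w\<in>#M. complex_of_real r - w) = (- \<i>) ^ size M * complex_of_real (\<rho> r) * exp (\<i> * complex_of_real (\<phi> r))"
      using upper unfolding \<rho>_def \<phi>_def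
    proof (induction M)
      case (add w M)
      from add.prems have w: "Im w > 0" and "\<And>x. x \<in># M \<Longrightarrow> Im x > 0" by auto
      then have IH: "(\<Prod>w\<in>#M. complex_of_real r - w) = (- \<i>) ^ size M
          * complex_of_real (\<Prod>w\<in>#M. Im w * sqrt (1 + ((r - Re w) / Im w)\<^sup>2))
          * exp (\<i> * complex_of_real (\<Sum>w\<in>#M. arctan ((r - Re w) / Im w)))"
        using add.IH by blast
      have "(\<Prod>w\<in>#add_mset w M. complex_of_real r - w) = (complex_of_real r - w) * (\<Prod>w\<in>#M. complex_of_real r - w)"
        by simp
      also have "\<dots> = (- \<i>) ^ size (add_mset w M)
          * complex_of_real (\<Prod>w\<in>#add_mset w M. Im w * sqrt (1 + ((r - Re w) / Im w)\<^sup>2))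
          * exp (\<i> * complex_of_real (\<Sum>w\<in>#add_mset w M. arctan ((r - Re w) / Im w)))"
        unfolding IH upper_half_plane_phase[OF w, of r]
        by (simp add: exp_add distrib_left mult_ac)
      finally show ?case .
    qed simp
    finally show "exp (g (r, 1)) = (\<kappa> * (- \<i>) ^ size M) * complex_of_real (\<rho> r) * exp (\<i> * complex_of_real (\<phi> r))"
      by simp
  qed
  have "\<phi> 0 \<le> \<phi> 1"
    using upper unfolding \<phi>_def
  proof (induction M)
    case (add w M)
    have "arctan ((0 - Re w) / Im w) \<le> arctan ((1 - Re w) / Im w)"
      using add.prems by (intro arctan_monotone' divide_right_mono) (auto intro: less_imp_le)
    then show ?case using add by (auto intro: add_mono)
  qed simp
  with top bottom vert[of 0] vert[of 1] show ?thesis by simp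
qed

text \<open>The eigenvalues of \<open>B + \<epsilon>I\<close> are those of \<open>B\<close> shifted by \<open>\<epsilon>\<close>, and \<open>arctan\<close> has slope at most one.\<close>

lemma lagrangian_angle_shift:
  fixes B :: "real^'n^'n" and \<epsilon> :: real
  assumes sym: "transpose B = B" and "\<epsilon> \<ge> 0"
  shows "lagrangian_angle (B + mat \<epsilon>) \<le> lagrangian_angle B + CARD('n) * \<epsilon>"
proof -
  have "charpoly (B + mat \<epsilon>) = (\<Prod>r\<in>#eigenvalues B. [:- (r + \<epsilon>), 1:])"
  proof (rule poly_eq_poly_eq_iff[THEN iffD1], rule ext)
    fix x
    have "poly (charpoly (B + mat \<epsilon>)) x = det (mat x - (B + mat \<epsilon>))" by (rule poly_charpoly)
    also have "mat x - (B + mat \<epsilon>) = mat (x - \<epsilon>) - B" by (simp add: vec_eq_iff mat_def)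
    also have "det \<dots> = poly (charpoly B) (x - \<epsilon>)" by (rule poly_charpoly[symmetric])
    also have "\<dots> = poly (\<Prod>r\<in>#eigenvalues B. [:- r, 1:]) (x - \<epsilon>)"
      using charpoly_eq_prod[OF sym] by simp
    also have "poly (\<Prod>r\<in>#M. [:- r, 1:]) (x - \<epsilon>) = poly (\<Prod>r\<in>#M. [:- (r + \<epsilon>), 1:]) x" for M
      by (induction M) (simp_all del: mult_pCons_left add: algebra_simps)
    finally show "poly (charpoly (B + mat \<epsilon>)) x = poly (\<Prod>r\<in>#eigenvalues B. [:- (r + \<epsilon>), 1:]) x" .
  qed
  moreover have "proots (\<Prod>r\<in>#M. [:- (r + \<epsilon>), 1:]) = image_mset (\<lambda>r. r + \<epsilon>) M" for M
  proof (induction M)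
    case (add x M)
    have "(\<Prod>r\<in>#M. [:- (r + \<epsilon>), 1:]) \<noteq> 0" by (auto simp: prod_mset_zero_iff)
    then have "proots ([:- (x + \<epsilon>), 1:] * (\<Prod>r\<in>#M. [:- (r + \<epsilon>), 1:])) = add_mset (x + \<epsilon>) (image_mset (\<lambda>r. r + \<epsilon>) M)"
      by (subst proots_mult) (auto simp: add.IH[simplified] add.commute)
    then show ?case by (simp del: mult_pCons_left)
  qed simp
  ultimately have E: "eigenvalues (B + mat \<epsilon>) = image_mset (\<lambda>r. r + \<epsilon>) (eigenvalues B)"
    unfolding eigenvalues_def[of "B + mat \<epsilon>"] by simp
  have lip: "arctan (r + \<epsilon>) \<le> arctan r + \<epsilon>" for r
  proof (cases "\<epsilon> = 0")
    case False
    then have "\<epsilon> > 0" using assms by simp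
    then obtain z where "arctan (r + \<epsilon>) - arctan r = \<epsilon> * inverse (1 + z\<^sup>2)"
      using MVT2[of r "r + \<epsilon>" arctan "\<lambda>z. inverse (1 + z\<^sup>2)"] DERIV_arctan by auto
    moreover have "inverse (1 + z\<^sup>2) \<le> 1" by (simp add: inverse_le_1_iff)
    ultimately show ?thesis using \<open>\<epsilon> > 0\<close> mult_left_mono[of "inverse (1 + z\<^sup>2)" 1 \<epsilon>] by linarith
  qed simp
  have "(\<Sum>r\<in>#M. arctan (r + \<epsilon>)) \<le> (\<Sum>r\<in>#M. arctan r) + size M * \<epsilon>" for M
  proof (induction M)
    case (add x M) then show ?case using lip[of x] by (simp add: algebra_simps)
  qed simp
  from this[of "eigenvalues B"] show ?thesis
    unfolding lagrangian_angle_def E by (simp add: size_eigenvalues[OF sym] multiset.map_comp o_def)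
qed

lemma lagrangian_angle_le_shift:
  fixes A B :: "real^'n^'n" and \<epsilon> :: real
  assumes symA: "transpose A = A" and symB: "transpose B = B" and "\<epsilon> \<ge> 0"
    and le: "\<And>v. v \<bullet> (A *v v) \<le> v \<bullet> (B *v v) + \<epsilon> * (v \<bullet> v)"
  shows "lagrangian_angle A \<le> lagrangian_angle B + CARD('n) * \<epsilon>"
proof -
  define H where "H = B + mat \<epsilon> - A"
  have sc: "mat \<epsilon> *v v = \<epsilon> *\<^sub>R v" for v :: "real^'n"
    by (simp add: vec_eq_iff matrix_vector_mult_def mat_def if_distrib[of "\<lambda>a. a * _"] cong: if_cong)
  have "transpose H = H"
    using symA symB unfolding transpose_eq_iff H_def by (auto simp: mat_def)
  moreover have "0 \<le> v \<bullet> (H *v v)" for v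
    using le[of v] by (simp add: H_def matrix_vector_mult_diff_rdistrib matrix_vector_mult_add_rdistrib
        inner_diff_right inner_add_right sc)
  ultimately have "lagrangian_angle A \<le> lagrangian_angle (A + H)"
    by (intro lagrangian_angle_mono_add symA)
  also have "A + H = B + mat \<epsilon>" by (simp add: H_def)
  also have "lagrangian_angle \<dots> \<le> lagrangian_angle B + CARD('n) * \<epsilon>"
    by (rule lagrangian_angle_shift[OF symB \<open>\<epsilon> \<ge> 0\<close>])
  finally show ?thesis .
qed

lemma lagrangian_angle_bound:
  fixes A :: "real^'n^'n"
  assumes "transpose A = A"
  shows "\<bar>lagrangian_angle A\<bar> \<le> CARD('n) * pi / 2"
proof -
  have "\<bar>\<Sum>r\<in>#M. arctan r\<bar> \<le> size M * pi / 2" for M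
  proof (induction M)
    case (add x M)
    have "\<bar>arctan x\<bar> \<le> pi / 2" using arctan_bounded[of x] unfolding abs_le_iff by linarith
    then show ?case using add by (simp add: algebra_simps add_divide_distrib)
  qed simp
  then show ?thesis unfolding lagrangian_angle_def using size_eigenvalues[OF assms] by metis
qed

lemma quadratic_form_bound:
  fixes A :: "real^'n^'n" and \<delta> :: real
  assumes "\<And>i j. \<bar>A $ i $ j\<bar> \<le> \<delta>"
  shows "\<bar>v \<bullet> (A *v v)\<bar> \<le> CARD('n)\<^sup>2 * \<delta> * (v \<bullet> v)"
proof -
  have "\<bar>v \<bullet> (A *v v)\<bar> = \<bar>\<Sum>i\<in>UNIV. \<Sum>j\<in>UNIV. A $ i $ j * (v $ i * v $ j)\<bar>"
    by (simp add: inner_vec_def matrix_vector_mult_def sum_distrib_left algebra_simps)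
  also have "\<dots> \<le> (\<Sum>i\<in>(UNIV::'n set). \<Sum>j\<in>(UNIV::'n set). \<delta> * (v \<bullet> v))"
  proof (intro order.trans[OF sum_abs] sum_mono)
    fix i j
    have "\<bar>v $ i * v $ j\<bar> \<le> norm v * norm v"
      unfolding abs_mult by (intro mult_mono component_le_norm_cart) auto
    also have "\<dots> = v \<bullet> v" by (metis dot_square_norm power2_eq_square)
    finally have *: "\<bar>v $ i * v $ j\<bar> \<le> v \<bullet> v" .
    show "\<bar>A $ i $ j * (v $ i * v $ j)\<bar> \<le> \<delta> * (v \<bullet> v)"
      unfolding abs_mult[of "A $ i $ j"] using assms * order.trans[OF abs_ge_zero assms]
      by (intro mult_mono) auto
  qed
  also have "\<dots> = CARD('n)\<^sup>2 * \<delta> * (v \<bullet> v)" by (simp add: power2_eq_square)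
  finally show ?thesis .
qed

lemma lagrangian_angle_Lipschitz:
  fixes A B :: "real^'n^'n" and \<delta> :: real
  assumes "transpose A = A" "transpose B = B" "\<And>i j. \<bar>A $ i $ j - B $ i $ j\<bar> \<le> \<delta>"
  shows "\<bar>lagrangian_angle A - lagrangian_angle B\<bar> \<le> CARD('n) ^ 3 * \<delta>"
proof -
  have d: "\<delta> \<ge> 0" using order.trans[OF abs_ge_zero assms(3)] .
  have q: "\<bar>v \<bullet> (A *v v) - v \<bullet> (B *v v)\<bar> \<le> CARD('n)\<^sup>2 * \<delta> * (v \<bullet> v)" for v
    using quadratic_form_bound[of "A - B" \<delta> v] assms(3)
    by (simp add: matrix_vector_mult_diff_rdistrib inner_diff_right)
  have "lagrangian_angle A \<le> lagrangian_angle B + CARD('n) * (CARD('n)\<^sup>2 * \<delta>)"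
    by (rule lagrangian_angle_le_shift[OF assms(1,2)]) (use d in simp, smt (verit) q)
  moreover have "lagrangian_angle B \<le> lagrangian_angle A + CARD('n) * (CARD('n)\<^sup>2 * \<delta>)"
    by (rule lagrangian_angle_le_shift[OF assms(2,1)]) (use d in simp, smt (verit) q)
  ultimately show ?thesis by (simp add: power2_eq_square power3_eq_cube algebra_simps abs_le_iff)
qed

section \<open>Calculus of iterated derivatives\<close>

abbreviation dir_deriv :: "'a::real_normed_vector \<Rightarrow> ('a \<Rightarrow> real) \<Rightarrow> 'a \<Rightarrow> real" where
  "dir_deriv v f \<equiv> \<lambda>x. frechet_derivative f (at x) v"

lemma frechet_derivative_cong_open:
  assumes "open S" "x \<in> S" "\<And>y. y \<in> S \<Longrightarrow> f y = g y"
  shows "frechet_derivative f (at x) = frechet_derivative g (at x)"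
proof -
  have "(f has_derivative f') (at x) \<longleftrightarrow> (g has_derivative f') (at x)" for f'
    using has_derivative_transform_within_open[OF _ assms(1,2)] assms(3) by metis
  then show ?thesis unfolding frechet_derivative_def by simp
qed

lemma dir_deriv_cong:
  assumes "open S" "x \<in> S" "\<And>y. y \<in> S \<Longrightarrow> f y = g y"
  shows "dir_deriv v f x = dir_deriv v g x"
  using frechet_derivative_cong_open[OF assms] by simp

lemma iter_deriv_cong:
  assumes "open S" "\<And>y. y \<in> S \<Longrightarrow> f y = g y" "x \<in> S"
  shows "iter_deriv vs f x = iter_deriv vs g x"
  using assms(3)
proof (induction vs arbitrary: x)
  case (Cons v vs)
  then show ?case
    using frechet_derivative_cong_open[OF assms(1), of x "iter_deriv vs f" "iter_deriv vs g"] by simp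
qed (simp add: assms)

lemma iter_deriv_append: "iter_deriv (vs @ ws) f = iter_deriv vs (iter_deriv ws f)"
  by (induction vs) simp_all

lemma Ck_on_cong:
  assumes "open S" "\<And>y. y \<in> S \<Longrightarrow> f y = g y" "Ck_on k S f"
  shows "Ck_on k S g"
  using assms(2,3)
proof (induction k arbitrary: f g)
  case 0
  then show ?case using continuous_on_cong[of S S f g] by simp
next
  case (Suc k)
  have d: "g differentiable (at x)" if "x \<in> S" for x
  proof -
    have "f differentiable (at x)" using Suc.prems(2) that by simp
    then obtain f' where "(f has_derivative f') (at x)" by (auto simp: differentiable_def)
    then have "(g has_derivative f') (at x)"
      using has_derivative_transform_within_open[OF _ assms(1) that] Suc.prems(1) by metis
    then show ?thesis by (auto simp: differentiable_def)
  qed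
  have "Ck_on k S (dir_deriv v g)" for v
  proof (rule Suc.IH)
    show "Ck_on k S (dir_deriv v f)" using Suc.prems(2) by simp
    fix y assume "y \<in> S"
    then show "dir_deriv v f y = dir_deriv v g y"
      using frechet_derivative_cong_open[OF assms(1)] Suc.prems(1) by metis
  qed
  with d show ?case by simp
qed

lemma Ck_on_Suc_imp: "Ck_on (Suc k) S f \<Longrightarrow> Ck_on k S f"
proof (induction k arbitrary: f)
  case 0
  then show ?case
    by (auto intro!: continuous_at_imp_continuous_on differentiable_imp_continuous_within)
next
  case (Suc k)
  then show ?case by (metis Ck_on.simps(2))
qed

lemma smooth_on_differentiable: "smooth_on S f \<Longrightarrow> x \<in> S \<Longrightarrow> f differentiable (at x)"
  unfolding smooth_on_def by (metis Ck_on.simps(2))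

lemma smooth_on_dir_deriv: "smooth_on S f \<Longrightarrow> smooth_on S (dir_deriv v f)"
  unfolding smooth_on_def by (metis Ck_on.simps(2))

lemma smooth_on_iter_deriv: "smooth_on S f \<Longrightarrow> smooth_on S (iter_deriv vs f)"
  by (induction vs) (auto intro: smooth_on_dir_deriv)

lemma smooth_on_cong: "open S \<Longrightarrow> (\<And>y. y \<in> S \<Longrightarrow> f y = g y) \<Longrightarrow> smooth_on S f \<Longrightarrow> smooth_on S g"
  unfolding smooth_on_def using Ck_on_cong by metis

lemma dir_deriv_eqI: "(f has_derivative f') (at x) \<Longrightarrow> dir_deriv v f x = f' v"
  using frechet_derivative_at by metis

lemma dir_deriv_add:
  assumes "f differentiable (at x)" "g differentiable (at x)"
  shows "dir_deriv v (\<lambda>x. f x + g x) x = dir_deriv v f x + dir_deriv v g x"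
  using assms unfolding frechet_derivative_works
  by (intro dir_deriv_eqI) (rule has_derivative_add)

lemma dir_deriv_mult:
  fixes f g :: "'a::real_normed_vector \<Rightarrow> real"
  assumes "f differentiable (at x)" "g differentiable (at x)"
  shows "dir_deriv v (\<lambda>x. f x * g x) x = f x * dir_deriv v g x + dir_deriv v f x * g x"
  using assms unfolding frechet_derivative_works
  by (intro dir_deriv_eqI) (rule has_derivative_mult)

lemma dir_deriv_inverse:
  fixes f :: "'a::real_normed_vector \<Rightarrow> real"
  assumes "f differentiable (at x)" "f x \<noteq> 0"
  shows "dir_deriv v (\<lambda>x. inverse (f x)) x = (- 1) * (dir_deriv v f x * (inverse (f x) * inverse (f x)))"
proof -
  have "((\<lambda>x. inverse (f x)) has_derivative (\<lambda>h. - (inverse (f x) * frechet_derivative f (at x) h * inverse (f x)))) (at x)"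
    using assms unfolding frechet_derivative_works by (intro Deriv.has_derivative_inverse) auto
  from dir_deriv_eqI[OF this] show ?thesis by (simp add: mult_ac)
qed

lemma dir_deriv_const [simp]: "dir_deriv v (\<lambda>x. c) x = 0"
  by (simp add: frechet_derivative_const)

lemma Ck_on_const: "Ck_on k S (\<lambda>x. c)"
  by (induction k arbitrary: c) simp_all

lemma Ck_on_add: "open S \<Longrightarrow> Ck_on k S f \<Longrightarrow> Ck_on k S g \<Longrightarrow> Ck_on k S (\<lambda>x. f x + g x)"
proof (induction k arbitrary: f g)
  case 0
  then show ?case by (simp add: continuous_on_add)
next
  case (Suc k)
  have "Ck_on k S (dir_deriv v (\<lambda>x. f x + g x))" for v
    by (rule Ck_on_cong[OF Suc.prems(1), of "\<lambda>x. dir_deriv v f x + dir_deriv v g x"])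
      (use Suc in \<open>auto simp: dir_deriv_add\<close>)
  then show ?case using Suc.prems by auto
qed

lemma Ck_on_mult: "open S \<Longrightarrow> Ck_on k S f \<Longrightarrow> Ck_on k S g \<Longrightarrow> Ck_on k S (\<lambda>x. f x * g x)"
proof (induction k arbitrary: f g)
  case 0
  then show ?case by (simp add: continuous_on_mult)
next
  case (Suc k)
  have "Ck_on k S (dir_deriv v (\<lambda>x. f x * g x))" for v
  proof (rule Ck_on_cong[OF Suc.prems(1), of "\<lambda>x. f x * dir_deriv v g x + dir_deriv v f x * g x"])
    show "Ck_on k S (\<lambda>x. f x * dir_deriv v g x + dir_deriv v f x * g x)"
      using Suc.prems Ck_on_Suc_imp by (intro Ck_on_add Suc.IH) (auto simp del: Ck_on.simps(1))
  qed (use Suc.prems in \<open>auto simp: dir_deriv_mult\<close>)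
  then show ?case using Suc.prems by auto
qed

lemma Ck_on_inverse:
  "open S \<Longrightarrow> (\<And>x. x \<in> S \<Longrightarrow> f x \<noteq> 0) \<Longrightarrow> Ck_on k S f \<Longrightarrow> Ck_on k S (\<lambda>x. inverse (f x))"
proof (induction k)
  case 0
  then show ?case by (auto intro!: continuous_on_inverse)
next
  case (Suc k)
  have "Ck_on k S (dir_deriv v (\<lambda>x. inverse (f x)))" for v
  proof (rule Ck_on_cong[OF Suc.prems(1), of "\<lambda>x. (- 1) * (dir_deriv v f x * (inverse (f x) * inverse (f x)))"])
    have "Ck_on k S (\<lambda>x. inverse (f x))"
      using Suc.prems Ck_on_Suc_imp by (intro Suc.IH) auto
    then show "Ck_on k S (\<lambda>x. (- 1) * (dir_deriv v f x * (inverse (f x) * inverse (f x))))"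
      using Suc.prems by (intro Ck_on_mult Ck_on_const) auto
  qed (use Suc.prems in \<open>simp add: dir_deriv_inverse\<close>)
  moreover have "(\<lambda>x. inverse (f x)) differentiable (at x)" if "x \<in> S" for x
    using Suc.prems that by (intro differentiable_inverse) auto
  ultimately show ?case by simp
qed

lemma Ck_on_sum:
  assumes "open S" "finite J" "\<And>j. j \<in> J \<Longrightarrow> Ck_on k S (f j)"
  shows "Ck_on k S (\<lambda>x. \<Sum>j\<in>J. f j x)"
  using assms(2,3) by (induction J) (auto intro: Ck_on_add assms(1) Ck_on_const simp del: Ck_on.simps)

lemma smooth_on_const: "smooth_on S (\<lambda>x. c)"
  by (simp add: smooth_on_def Ck_on_const)

lemma smooth_on_add: "open S \<Longrightarrow> smooth_on S f \<Longrightarrow> smooth_on S g \<Longrightarrow> smooth_on S (\<lambda>x. f x + g x)"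
  by (simp add: smooth_on_def Ck_on_add)

lemma smooth_on_mult: "open S \<Longrightarrow> smooth_on S f \<Longrightarrow> smooth_on S g \<Longrightarrow> smooth_on S (\<lambda>x. f x * g x)"
  by (simp add: smooth_on_def Ck_on_mult)

lemma smooth_on_inverse:
  "open S \<Longrightarrow> (\<And>x. x \<in> S \<Longrightarrow> f x \<noteq> 0) \<Longrightarrow> smooth_on S f \<Longrightarrow> smooth_on S (\<lambda>x. inverse (f x))"
  by (simp add: smooth_on_def Ck_on_inverse)

lemma smooth_on_diff:
  assumes "open S" "smooth_on S f" "smooth_on S g"
  shows "smooth_on S (\<lambda>x. f x - g x)"
  using smooth_on_add[OF assms(1,2) smooth_on_mult[OF assms(1) smooth_on_const[of S "-1"] assms(3)]] by simp

lemma dir_deriv_diff: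
  assumes "f differentiable (at x)" "g differentiable (at x)"
  shows "dir_deriv v (\<lambda>x. f x - g x) x = dir_deriv v f x - dir_deriv v g x"
  using assms unfolding frechet_derivative_works
  by (intro dir_deriv_eqI) (rule has_derivative_diff)

lemma dir_deriv_sum_Basis:
  fixes f :: "'a::euclidean_space \<Rightarrow> real"
  assumes "f differentiable (at x)"
  shows "dir_deriv v f x = (\<Sum>b\<in>Basis. (v \<bullet> b) * dir_deriv b f x)"
proof -
  interpret linear "frechet_derivative f (at x)"
    using assms by (rule linear_frechet_derivative)
  have "dir_deriv v f x = frechet_derivative f (at x) (\<Sum>b\<in>Basis. (v \<bullet> b) *\<^sub>R b)"
    by (simp add: euclidean_representation)
  then show ?thesis by (simp add: sum scale)
qed

lemma dir_deriv_affine: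
  assumes "bounded_linear L" "f differentiable (at (a + L x))"
  shows "(\<lambda>x. f (a + L x)) differentiable (at x)"
    "dir_deriv v (\<lambda>x. f (a + L x)) x = dir_deriv (L v) f (a + L x)"
proof -
  have "((\<lambda>x. a + L x) has_derivative L) (at x)"
    using bounded_linear_imp_has_derivative[OF assms(1), of "at x"]
      has_derivative_add[OF has_derivative_const[of a]] by fastforce
  moreover have "(f has_derivative frechet_derivative f (at (a + L x))) (at (a + L x))"
    using assms(2) by (simp add: frechet_derivative_works)
  ultimately have "((\<lambda>x. f (a + L x)) has_derivative (\<lambda>v. frechet_derivative f (at (a + L x)) (L v))) (at x)"
    by (rule has_derivative_compose)
  then show "(\<lambda>x. f (a + L x)) differentiable (at x)"
    "dir_deriv v (\<lambda>x. f (a + L x)) x = dir_deriv (L v) f (a + L x)"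
    using dir_deriv_eqI by (auto simp: differentiable_def)
qed

lemma Ck_on_affine:
  assumes "open T" "bounded_linear L" "\<And>x. x \<in> T \<Longrightarrow> a + L x \<in> S" "Ck_on k S f"
  shows "Ck_on k T (\<lambda>x. f (a + L x))"
  using assms(4)
proof (induction k arbitrary: f)
  case 0
  have "continuous_on T (\<lambda>x. a + L x)"
    using assms(2) by (intro continuous_intros linear_continuous_on)
  then show ?case using 0 assms(3) by (auto intro: continuous_on_compose2[of S f T "\<lambda>x. a + L x"])
next
  case (Suc k)
  have "Ck_on k T (dir_deriv v (\<lambda>x. f (a + L x)))" for v
  proof (rule Ck_on_cong[OF assms(1)])
    show "Ck_on k T (\<lambda>x. dir_deriv (L v) f (a + L x))"
      using Suc by auto
    show "dir_deriv (L v) f (a + L y) = dir_deriv v (\<lambda>x. f (a + L x)) y" if "y \<in> T" for y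
      using dir_deriv_affine(2)[OF assms(2), of f a y v] Suc.prems assms(3)[OF that] by simp
  qed
  then show ?case using Suc.prems assms(2,3) by (auto intro: dir_deriv_affine(1))
qed

lemma smooth_on_affine:
  "open T \<Longrightarrow> bounded_linear L \<Longrightarrow> (\<And>x. x \<in> T \<Longrightarrow> a + L x \<in> S) \<Longrightarrow> smooth_on S f \<Longrightarrow> smooth_on T (\<lambda>x. f (a + L x))"
  unfolding smooth_on_def using Ck_on_affine by blast

lemma iter_deriv_affine:
  assumes "open T" "bounded_linear L" "\<And>x. x \<in> T \<Longrightarrow> a + L x \<in> S" "smooth_on S f" "x \<in> T"
  shows "iter_deriv vs (\<lambda>x. f (a + L x)) x = iter_deriv (map L vs) f (a + L x)"
  using assms(5)
proof (induction vs arbitrary: x)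
  case (Cons v vs)
  have "iter_deriv (v # vs) (\<lambda>x. f (a + L x)) x = dir_deriv v (\<lambda>x. iter_deriv (map L vs) f (a + L x)) x"
    unfolding iter_deriv.simps list.map by (rule dir_deriv_cong[OF assms(1) Cons.prems Cons.IH])
  also have "\<dots> = dir_deriv (L v) (iter_deriv (map L vs) f) (a + L x)"
    using assms Cons.prems by (intro dir_deriv_affine(2)) (auto intro: smooth_on_differentiable smooth_on_iter_deriv)
  finally show ?case by simp
qed simp

lemma dir_deriv_cmult:
  fixes f :: "'a::real_normed_vector \<Rightarrow> real"
  assumes "f differentiable (at x)"
  shows "dir_deriv v (\<lambda>x. c * f x) x = c * dir_deriv v f x"
  using dir_deriv_mult[of "\<lambda>x. c" x f v] assms by simp

lemma iter_deriv_cmult: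
  assumes "open S" "smooth_on S f" "x \<in> S"
  shows "iter_deriv vs (\<lambda>x. c * f x) x = c * iter_deriv vs f x"
  using assms(3)
proof (induction vs arbitrary: x)
  case (Cons v vs)
  have "iter_deriv (v # vs) (\<lambda>x. c * f x) x = dir_deriv v (\<lambda>x. c * iter_deriv vs f x) x"
    unfolding iter_deriv.simps list.map by (rule dir_deriv_cong[OF assms(1) Cons.prems Cons.IH])
  also have "\<dots> = c * dir_deriv v (iter_deriv vs f) x"
    using assms Cons.prems by (intro dir_deriv_cmult) (auto intro: smooth_on_differentiable smooth_on_iter_deriv)
  finally show ?case by simp
qed simp

lemma iter_deriv_scaled_directions:
  assumes "open S" "smooth_on S f" "x \<in> S"
  shows "iter_deriv (map ((*\<^sub>R) c) vs) f x = c ^ length vs * iter_deriv vs f x"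
  using assms(3)
proof (induction vs arbitrary: x)
  case (Cons v vs)
  have df: "iter_deriv vs f differentiable (at x)"
    using assms Cons.prems by (auto intro: smooth_on_differentiable smooth_on_iter_deriv)
  interpret linear "frechet_derivative (iter_deriv vs f) (at x)"
    using df by (rule linear_frechet_derivative)
  have "iter_deriv (map ((*\<^sub>R) c) (v # vs)) f x = dir_deriv (c *\<^sub>R v) (\<lambda>x. c ^ length vs * iter_deriv vs f x) x"
    unfolding iter_deriv.simps list.map by (rule dir_deriv_cong[OF assms(1) Cons.prems Cons.IH])
  also have "\<dots> = c ^ length vs * dir_deriv (c *\<^sub>R v) (iter_deriv vs f) x"
    by (rule dir_deriv_cmult[OF df])
  finally show ?case by (simp add: scale)
qed simp

section \<open>Symmetry of second derivatives\<close>

lemma has_real_derivative_line: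
  fixes f :: "'a::real_normed_vector \<Rightarrow> real"
  assumes "f differentiable (at (p + s *\<^sub>R v))"
  shows "((\<lambda>s. f (p + s *\<^sub>R v)) has_real_derivative dir_deriv v f (p + s *\<^sub>R v)) (at s)"
proof -
  have "bounded_linear (\<lambda>s. s *\<^sub>R v)" by (rule bounded_linear_scaleR_left)
  note D = dir_deriv_affine[OF this assms]
  have "((\<lambda>s. f (p + s *\<^sub>R v)) has_derivative frechet_derivative (\<lambda>s. f (p + s *\<^sub>R v)) (at s)) (at s)"
    using D(1) by (simp only: frechet_derivative_works)
  moreover have "frechet_derivative (\<lambda>s. f (p + s *\<^sub>R v)) (at s) = (*) (dir_deriv v f (p + s *\<^sub>R v))"
    by (rule ext) (simp only: D(2) linear_scale[OF linear_frechet_derivative[OF assms]] real_scaleR_def mult.commute)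
  ultimately show ?thesis unfolding has_field_derivative_def by simp
qed

text \<open>The mean value theorem in direction \<open>v\<close>, then in direction \<open>w\<close>. The left-hand side is symmetric in
  \<open>v\<close> and \<open>w\<close>, which forces the mixed derivatives to agree in the limit \<open>h \<rightarrow> 0\<close>.\<close>

lemma second_difference:
  fixes f :: "'a::real_normed_vector \<Rightarrow> real"
  assumes "Ck_on 2 S f" "h > 0" and sub: "\<And>s t. s \<in> {0..h} \<Longrightarrow> t \<in> {0..h} \<Longrightarrow> x + s *\<^sub>R v + t *\<^sub>R w \<in> S"
  shows "\<exists>s\<in>{0..h}. \<exists>t\<in>{0..h}. f (x + h *\<^sub>R v + h *\<^sub>R w) - f (x + h *\<^sub>R v) - f (x + h *\<^sub>R w) + f x
    = h\<^sup>2 * dir_deriv w (dir_deriv v f) (x + s *\<^sub>R v + t *\<^sub>R w)"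
proof -
  have df: "f differentiable (at y)" "dir_deriv u f differentiable (at y)" if "y \<in> S" for y u
    using assms(1) that by (auto simp: numeral_2_eq_2)
  have d1: "((\<lambda>s. f (x + c + s *\<^sub>R v)) has_real_derivative dir_deriv v f (x + s *\<^sub>R v + c)) (at s)"
    if "x + s *\<^sub>R v + c \<in> S" for s c
    using has_real_derivative_line[of f "x + c" s v] df(1)[OF that] by (simp add: add_ac)
  have "\<exists>s. 0 < s \<and> s < h \<and> (f (x + h *\<^sub>R w + h *\<^sub>R v) - f (x + 0 + h *\<^sub>R v)) - (f (x + h *\<^sub>R w + 0 *\<^sub>R v) - f (x + 0 + 0 *\<^sub>R v))
     = (h - 0) * (dir_deriv v f (x + s *\<^sub>R v + h *\<^sub>R w) - dir_deriv v f (x + s *\<^sub>R v + 0))"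
    by (rule MVT2[OF \<open>h > 0\<close>]) (rule DERIV_diff[OF d1 d1]; use sub[of _ h] sub[of _ 0] \<open>h > 0\<close> in auto)
  then obtain s where s: "0 < s" "s < h" and 1: "f (x + h *\<^sub>R v + h *\<^sub>R w) - f (x + h *\<^sub>R v) - f (x + h *\<^sub>R w) + f x
    = h * (dir_deriv v f (x + s *\<^sub>R v + h *\<^sub>R w) - dir_deriv v f (x + s *\<^sub>R v))"
    by (auto simp: algebra_simps)
  have "\<exists>t. 0 < t \<and> t < h \<and> dir_deriv v f (x + s *\<^sub>R v + h *\<^sub>R w) - dir_deriv v f (x + s *\<^sub>R v + 0 *\<^sub>R w)
     = (h - 0) * dir_deriv w (dir_deriv v f) (x + s *\<^sub>R v + t *\<^sub>R w)"
    by (rule MVT2[OF \<open>h > 0\<close>]) (rule has_real_derivative_line, rule df(2), use sub s in auto)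
  then obtain t where "0 < t" "t < h" "dir_deriv v f (x + s *\<^sub>R v + h *\<^sub>R w) - dir_deriv v f (x + s *\<^sub>R v)
     = h * dir_deriv w (dir_deriv v f) (x + s *\<^sub>R v + t *\<^sub>R w)"
    by auto
  with 1 s show ?thesis
    by (intro bexI[of _ s] bexI[of _ t]) (auto simp: power2_eq_square)
qed

lemma dir_deriv_commute:
  fixes f :: "'a::real_normed_vector \<Rightarrow> real"
  assumes "open S" "Ck_on 2 S f" "x \<in> S"
  shows "dir_deriv v (dir_deriv w f) x = dir_deriv w (dir_deriv v f) x"
proof (rule ccontr)
  assume ne: "\<not> ?thesis"
  define e where "e = \<bar>dir_deriv v (dir_deriv w f) x - dir_deriv w (dir_deriv v f) x\<bar> / 2"
  have e: "e > 0" using ne by (simp add: e_def)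
  have cont: "isCont (dir_deriv a (dir_deriv b f)) x" for a b
    using assms by (simp add: numeral_2_eq_2 continuous_on_eq_continuous_at)
  have close: "\<exists>d>0. \<forall>y. dist y x < d \<longrightarrow> \<bar>dir_deriv a (dir_deriv b f) y - dir_deriv a (dir_deriv b f) x\<bar> < e" for a b
    using cont[where a=a and b=b] e unfolding continuous_at_eps_delta dist_real_def by auto
  obtain d1 where d1: "d1 > 0" "\<And>y. dist y x < d1 \<Longrightarrow> \<bar>dir_deriv v (dir_deriv w f) y - dir_deriv v (dir_deriv w f) x\<bar> < e"
    using close[where a=v and b=w] by auto
  obtain d2 where d2: "d2 > 0" "\<And>y. dist y x < d2 \<Longrightarrow> \<bar>dir_deriv w (dir_deriv v f) y - dir_deriv w (dir_deriv v f) x\<bar> < e"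
    using close[where a=w and b=v] by auto
  obtain d3 where d3: "d3 > 0" "ball x d3 \<subseteq> S" using assms openE by blast
  define d where "d = min d1 (min d2 d3)"
  define h where "h = d / (2 * (norm v + norm w + 1))"
  have d: "d > 0" using d1 d2 d3 by (simp add: d_def)
  have h: "h > 0" using d by (simp add: h_def add_nonneg_pos)
  have near: "dist (x + s *\<^sub>R v + t *\<^sub>R w) x < d" if "s \<in> {0..h}" "t \<in> {0..h}" for s t
  proof -
    have "dist (x + s *\<^sub>R v + t *\<^sub>R w) x = norm (s *\<^sub>R v + t *\<^sub>R w)" by (simp add: dist_norm)
    also have "\<dots> \<le> s * norm v + t * norm w"
      using that by (intro order.trans[OF norm_triangle_ineq]) simp
    also have "\<dots> \<le> h * norm v + h * norm w"
      using that by (intro add_mono mult_right_mono) auto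
    also have "\<dots> = d * ((norm v + norm w) / (2 * (norm v + norm w + 1)))"
      by (simp add: h_def add_divide_distrib distrib_left distrib_right)
    also have "\<dots> < d * 1"
      using d by (intro mult_strict_left_mono) (auto simp: divide_less_eq add_nonneg_pos)
    finally show ?thesis by simp
  qed
  have sub: "x + s *\<^sub>R v + t *\<^sub>R w \<in> S" if "s \<in> {0..h}" "t \<in> {0..h}" for s t
    using near[OF that] d3 by (auto simp: d_def dist_commute)
  have sub': "x + s *\<^sub>R w + t *\<^sub>R v \<in> S" if "s \<in> {0..h}" "t \<in> {0..h}" for s t
    using sub[OF that(2,1)] by (simp add: add_ac)
  obtain s t where st: "s \<in> {0..h}" "t \<in> {0..h}" and
    1: "f (x + h *\<^sub>R v + h *\<^sub>R w) - f (x + h *\<^sub>R v) - f (x + h *\<^sub>R w) + f x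
    = h\<^sup>2 * dir_deriv w (dir_deriv v f) (x + s *\<^sub>R v + t *\<^sub>R w)"
    using second_difference[OF assms(2) h sub] by blast
  obtain s' t' where st': "s' \<in> {0..h}" "t' \<in> {0..h}" and
    2: "f (x + h *\<^sub>R w + h *\<^sub>R v) - f (x + h *\<^sub>R w) - f (x + h *\<^sub>R v) + f x
    = h\<^sup>2 * dir_deriv v (dir_deriv w f) (x + s' *\<^sub>R w + t' *\<^sub>R v)"
    using second_difference[OF assms(2) h sub'] by blast
  have "h\<^sup>2 * dir_deriv w (dir_deriv v f) (x + s *\<^sub>R v + t *\<^sub>R w) = h\<^sup>2 * dir_deriv v (dir_deriv w f) (x + s' *\<^sub>R w + t' *\<^sub>R v)"
    unfolding 1[symmetric] 2[symmetric] by (simp add: add_ac)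
  then have eq: "dir_deriv w (dir_deriv v f) (x + s *\<^sub>R v + t *\<^sub>R w) = dir_deriv v (dir_deriv w f) (x + t' *\<^sub>R v + s' *\<^sub>R w)"
    using h by (simp add: add_ac)
  have "\<bar>dir_deriv w (dir_deriv v f) (x + s *\<^sub>R v + t *\<^sub>R w) - dir_deriv w (dir_deriv v f) x\<bar> < e"
    using near[OF st] by (intro d2) (simp add: d_def)
  moreover have "\<bar>dir_deriv v (dir_deriv w f) (x + t' *\<^sub>R v + s' *\<^sub>R w) - dir_deriv v (dir_deriv w f) x\<bar> < e"
    using near[OF st'(2,1)] by (intro d1) (simp add: d_def)
  ultimately show False using eq unfolding e_def by (auto simp: abs_if split: if_splits)
qed

lemma smooth_on_Ck: "smooth_on S f \<Longrightarrow> Ck_on k S f"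
  by (simp add: smooth_on_def)

lemma dir_deriv_iter_deriv_commute:
  assumes "open S" "smooth_on S f" "x \<in> S"
  shows "dir_deriv v (iter_deriv vs f) x = iter_deriv vs (dir_deriv v f) x"
  using assms(3)
proof (induction vs arbitrary: x)
  case (Cons w vs)
  have "dir_deriv v (iter_deriv (w # vs) f) x = dir_deriv w (dir_deriv v (iter_deriv vs f)) x"
    using dir_deriv_commute[OF assms(1) smooth_on_Ck[OF smooth_on_iter_deriv[OF assms(2)]] Cons.prems] by simp
  also have "\<dots> = dir_deriv w (iter_deriv vs (dir_deriv v f)) x"
    by (rule dir_deriv_cong[OF assms(1) Cons.prems Cons.IH])
  finally show ?case by simp
qed simp

section \<open>Families with locally bounded derivatives\<close>

definition loc_bounded :: "'i set \<Rightarrow> 'a::topological_space set \<Rightarrow> ('i \<Rightarrow> 'a \<Rightarrow> real) \<Rightarrow> bool" where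
  "loc_bounded I S f \<longleftrightarrow> (\<forall>K. compact K \<and> K \<subseteq> S \<longrightarrow> (\<exists>C. \<forall>i\<in>I. \<forall>x\<in>K. \<bar>f i x\<bar> \<le> C))"

lemma loc_bounded_cong:
  assumes "\<And>i x. i \<in> I \<Longrightarrow> x \<in> S \<Longrightarrow> f i x = g i x" "loc_bounded I S f"
  shows "loc_bounded I S g"
  unfolding loc_bounded_def
proof (intro allI impI)
  fix K assume K: "compact K \<and> K \<subseteq> S"
  then obtain C where "\<forall>i\<in>I. \<forall>x\<in>K. \<bar>f i x\<bar> \<le> C" using assms(2) unfolding loc_bounded_def by blast
  then have "\<forall>i\<in>I. \<forall>x\<in>K. \<bar>g i x\<bar> \<le> C" using assms(1) K by (metis subsetD)
  then show "\<exists>C. \<forall>i\<in>I. \<forall>x\<in>K. \<bar>g i x\<bar> \<le> C" ..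
qed

lemma loc_bounded_add:
  assumes "loc_bounded I S f" "loc_bounded I S g"
  shows "loc_bounded I S (\<lambda>i x. f i x + g i x)"
  unfolding loc_bounded_def
proof (intro allI impI)
  fix K assume K: "compact K \<and> K \<subseteq> S"
  obtain C D where C: "\<forall>i\<in>I. \<forall>x\<in>K. \<bar>f i x\<bar> \<le> C" and D: "\<forall>i\<in>I. \<forall>x\<in>K. \<bar>g i x\<bar> \<le> D"
    using assms K unfolding loc_bounded_def by meson
  show "\<exists>C. \<forall>i\<in>I. \<forall>x\<in>K. \<bar>f i x + g i x\<bar> \<le> C"
    by (intro exI[of _ "C + D"] ballI order.trans[OF abs_triangle_ineq] add_mono) (use C D in auto)
qed

lemma loc_bounded_mult:
  assumes "loc_bounded I S f" "loc_bounded I S g"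
  shows "loc_bounded I S (\<lambda>i x. f i x * g i x)"
  unfolding loc_bounded_def
proof (intro allI impI)
  fix K assume K: "compact K \<and> K \<subseteq> S"
  obtain C D where C: "\<forall>i\<in>I. \<forall>x\<in>K. \<bar>f i x\<bar> \<le> C" and D: "\<forall>i\<in>I. \<forall>x\<in>K. \<bar>g i x\<bar> \<le> D"
    using assms K unfolding loc_bounded_def by meson
  show "\<exists>C. \<forall>i\<in>I. \<forall>x\<in>K. \<bar>f i x * g i x\<bar> \<le> C"
  proof (intro exI[of _ "C * D"] ballI)
    fix i x assume ix: "i \<in> I" "x \<in> K"
    then have "\<bar>f i x\<bar> \<le> C" "\<bar>g i x\<bar> \<le> D" using C D by auto
    then show "\<bar>f i x * g i x\<bar> \<le> C * D"
      unfolding abs_mult by (intro mult_mono) (auto intro: order.trans[OF abs_ge_zero])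
  qed
qed

text \<open>All estimates are uniform in an index \<open>i \<in> I\<close>. The directions in \<open>V\<close> play the role of the spatial
  coordinate directions and \<open>\<tau>\<close> that of time; derivatives along \<open>\<tau>\<close> are counted separately because
  the flow equation trades one of them for two spatial derivatives.\<close>

locale derivative_family =
  fixes I :: "'i set" and S V :: "'a::real_normed_vector set" and \<tau> :: 'a
  assumes open_S: "open S"
begin

text \<open>Local boundedness of all iterated derivatives of order at most \<open>n\<close> with at most \<open>k\<close> of them
  along \<open>\<tau>\<close>. The recursion peels off the innermost derivative, as the Leibniz rule requires.\<close>

primrec derivs_bounded :: "nat \<Rightarrow> nat \<Rightarrow> ('i \<Rightarrow> 'a \<Rightarrow> real) \<Rightarrow> bool" where
  "derivs_bounded 0 k f \<longleftrightarrow> loc_bounded I S f"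
| "derivs_bounded (Suc n) k f \<longleftrightarrow> loc_bounded I S f \<and>
     (\<forall>v\<in>V. derivs_bounded n k (\<lambda>i. dir_deriv v (f i))) \<and>
     (\<forall>j. k = Suc j \<longrightarrow> derivs_bounded n j (\<lambda>i. dir_deriv \<tau> (f i)))"

definition tame :: "nat \<Rightarrow> nat \<Rightarrow> ('i \<Rightarrow> 'a \<Rightarrow> real) \<Rightarrow> bool" where
  "tame n k f \<longleftrightarrow> (\<forall>i\<in>I. smooth_on S (f i)) \<and> derivs_bounded n k f"

lemma derivs_bounded_imp_loc_bounded: "derivs_bounded n k f \<Longrightarrow> loc_bounded I S f"
  by (cases n) auto

lemma derivs_bounded_cong:
  "(\<And>i x. i \<in> I \<Longrightarrow> x \<in> S \<Longrightarrow> f i x = g i x) \<Longrightarrow> derivs_bounded n k f \<Longrightarrow> derivs_bounded n k g"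
proof (induction n arbitrary: k f g)
  case 0
  then show ?case using loc_bounded_cong by (metis derivs_bounded.simps(1))
next
  case (Suc n)
  have d: "dir_deriv v (f i) x = dir_deriv v (g i) x" if "i \<in> I" "x \<in> S" for v i x
    using dir_deriv_cong[OF open_S that(2)] Suc.prems(1)[OF that(1)] by blast
  show ?case
    unfolding derivs_bounded.simps
  proof (intro conjI ballI allI impI)
    show "loc_bounded I S g" using Suc.prems loc_bounded_cong[of I S f g] by auto
    show "derivs_bounded n k (\<lambda>i. dir_deriv v (g i))" if "v \<in> V" for v
      by (rule Suc.IH[of "\<lambda>i. dir_deriv v (f i)"]) (use d Suc.prems that in auto)
    show "derivs_bounded n j (\<lambda>i. dir_deriv \<tau> (g i))" if "k = Suc j" for j
      by (rule Suc.IH[of "\<lambda>i. dir_deriv \<tau> (f i)"]) (use d Suc.prems that in auto)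
  qed
qed

lemma tame_cong:
  assumes "\<And>i x. i \<in> I \<Longrightarrow> x \<in> S \<Longrightarrow> f i x = g i x" "tame n k f"
  shows "tame n k g"
  unfolding tame_def
proof
  show "\<forall>i\<in>I. smooth_on S (g i)"
  proof
    fix i assume i: "i \<in> I"
    show "smooth_on S (g i)"
      by (rule smooth_on_cong[OF open_S, of "f i"]) (use assms i in \<open>auto simp: tame_def\<close>)
  qed
  show "derivs_bounded n k g"
    by (rule derivs_bounded_cong[of f]) (use assms in \<open>auto simp: tame_def\<close>)
qed

lemma derivs_bounded_Suc_n: "derivs_bounded (Suc n) k f \<Longrightarrow> derivs_bounded n k f"
proof (induction n arbitrary: k f)
  case (Suc n)
  have "loc_bounded I S f" "\<And>v. v \<in> V \<Longrightarrow> derivs_bounded n k (\<lambda>i. dir_deriv v (f i))"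
    "\<And>j. k = Suc j \<Longrightarrow> derivs_bounded n j (\<lambda>i. dir_deriv \<tau> (f i))"
    using Suc.prems Suc.IH unfolding derivs_bounded.simps(2)[of "Suc n"] by blast+
  then show ?case by simp
qed simp

lemma derivs_bounded_Suc_k: "derivs_bounded n (Suc j) f \<Longrightarrow> derivs_bounded n j f"
proof (induction n arbitrary: j f)
  case (Suc n)
  then show ?case by (auto simp del: derivs_bounded.simps(1))
qed simp

lemma tame_Suc_n: "tame (Suc n) k f \<Longrightarrow> tame n k f"
  unfolding tame_def using derivs_bounded_Suc_n by blast

lemma tame_Suc_k: "tame n (Suc j) f \<Longrightarrow> tame n j f"
  unfolding tame_def using derivs_bounded_Suc_k by blast

lemma tame_dir_deriv: "tame (Suc n) k f \<Longrightarrow> v \<in> V \<Longrightarrow> tame n k (\<lambda>i. dir_deriv v (f i))"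
  by (auto simp: tame_def smooth_on_dir_deriv)

lemma tame_dir_deriv_time: "tame (Suc n) (Suc j) f \<Longrightarrow> tame n j (\<lambda>i. dir_deriv \<tau> (f i))"
  by (auto simp: tame_def smooth_on_dir_deriv)

lemma tame_SucI:
  assumes "\<And>i. i \<in> I \<Longrightarrow> smooth_on S (f i)" "loc_bounded I S f"
    "\<And>v. v \<in> V \<Longrightarrow> tame n k (\<lambda>i. dir_deriv v (f i))"
    "\<And>j. k = Suc j \<Longrightarrow> tame n j (\<lambda>i. dir_deriv \<tau> (f i))"
  shows "tame (Suc n) k f"
  using assms unfolding tame_def by auto

lemma tame_const: "tame n k (\<lambda>i x. c)"
proof -
  have "derivs_bounded n k (\<lambda>i x. c)" for c
    by (induction n arbitrary: k c) (auto simp: loc_bounded_def)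
  then show ?thesis by (simp add: tame_def smooth_on_const)
qed

lemma tame_add: "tame n k f \<Longrightarrow> tame n k g \<Longrightarrow> tame n k (\<lambda>i x. f i x + g i x)"
proof (induction n arbitrary: k f g)
  case 0
  then show ?case by (auto simp: tame_def intro: loc_bounded_add smooth_on_add open_S)
next
  case (Suc n)
  have sm: "smooth_on S (f i)" "smooth_on S (g i)" if "i \<in> I" for i
    using Suc.prems that by (auto simp: tame_def)
  have d: "dir_deriv v (f i) x + dir_deriv v (g i) x = dir_deriv v (\<lambda>x. f i x + g i x) x" if "i \<in> I" "x \<in> S" for v i x
    using sm[OF that(1)] smooth_on_differentiable that(2) by (intro dir_deriv_add[symmetric]) auto
  show ?case
  proof (rule tame_SucI)
    show "smooth_on S (\<lambda>x. f i x + g i x)" if "i \<in> I" for i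
      using sm[OF that] by (intro smooth_on_add open_S)
    show "loc_bounded I S (\<lambda>i x. f i x + g i x)"
      using Suc.prems by (intro loc_bounded_add) (auto simp: tame_def)
    show "tame n k (\<lambda>i. dir_deriv v (\<lambda>x. f i x + g i x))" if "v \<in> V" for v
      by (rule tame_cong[OF d Suc.IH[OF tame_dir_deriv tame_dir_deriv]]) (use Suc.prems that in auto)
    show "tame n j (\<lambda>i. dir_deriv \<tau> (\<lambda>x. f i x + g i x))" if "k = Suc j" for j
      by (rule tame_cong[OF d Suc.IH[OF tame_dir_deriv_time tame_dir_deriv_time]]) (use Suc.prems that in auto)
  qed
qed

lemma tame_mult: "tame n k f \<Longrightarrow> tame n k g \<Longrightarrow> tame n k (\<lambda>i x. f i x * g i x)"
proof (induction n arbitrary: k f g)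
  case 0
  then show ?case by (auto simp: tame_def intro: loc_bounded_mult smooth_on_mult open_S)
next
  case (Suc n)
  have sm: "smooth_on S (f i)" "smooth_on S (g i)" if "i \<in> I" for i
    using Suc.prems that by (auto simp: tame_def)
  have d: "f i x * dir_deriv v (g i) x + dir_deriv v (f i) x * g i x = dir_deriv v (\<lambda>x. f i x * g i x) x" if "i \<in> I" "x \<in> S" for v i x
    using sm[OF that(1)] smooth_on_differentiable that(2) by (intro dir_deriv_mult[symmetric]) auto
  show ?case
  proof (rule tame_SucI)
    show "smooth_on S (\<lambda>x. f i x * g i x)" if "i \<in> I" for i
      using sm[OF that] by (intro smooth_on_mult open_S)
    show "loc_bounded I S (\<lambda>i x. f i x * g i x)"
      using Suc.prems by (intro loc_bounded_mult) (auto simp: tame_def)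
    show "tame n k (\<lambda>i. dir_deriv v (\<lambda>x. f i x * g i x))" if "v \<in> V" for v
      by (rule tame_cong[OF d tame_add[OF Suc.IH[OF tame_Suc_n tame_dir_deriv] Suc.IH[OF tame_dir_deriv tame_Suc_n]]])
        (use Suc.prems that in auto)
    show "tame n j (\<lambda>i. dir_deriv \<tau> (\<lambda>x. f i x * g i x))" if "k = Suc j" for j
      by (rule tame_cong[OF d tame_add[OF Suc.IH[OF tame_Suc_n tame_dir_deriv_time] Suc.IH[OF tame_dir_deriv_time tame_Suc_n]]])
        (use Suc.prems that tame_Suc_k in auto)
  qed
qed

lemma tame_diff: "tame n k f \<Longrightarrow> tame n k g \<Longrightarrow> tame n k (\<lambda>i x. f i x - g i x)"
  using tame_add[of n k f "\<lambda>i x. - 1 * g i x"] tame_mult[OF tame_const[of n k "- 1"], of g] by simp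

text \<open>The lower bound keeps the reciprocal bounded, and by \<open>(1/f)' = - f' (1/f)\<^sup>2\<close> the induction
  hypothesis and the product rule give the rest.\<close>

lemma tame_inverse:
  assumes "\<And>i x. i \<in> I \<Longrightarrow> x \<in> S \<Longrightarrow> 1 \<le> f i x"
  shows "tame n k f \<Longrightarrow> tame n k (\<lambda>i x. inverse (f i x))"
proof -
  have nz: "f i x \<noteq> 0" if "i \<in> I" "x \<in> S" for i x using assms[OF that] by auto
  have sm: "smooth_on S (\<lambda>x. inverse (f i x))" if "i \<in> I" "tame n k f" for i n k
    using that nz by (intro smooth_on_inverse open_S) (auto simp: tame_def)
  have lb: "loc_bounded I S (\<lambda>i x. inverse (f i x))"
    unfolding loc_bounded_def
  proof (intro allI impI exI[of _ 1] ballI)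
    fix K i x assume "compact K \<and> K \<subseteq> S" "i \<in> I" "x \<in> K"
    then have "1 \<le> f i x" using assms by blast
    then show "\<bar>inverse (f i x)\<bar> \<le> 1" by (simp add: inverse_le_1_iff)
  qed
  show "tame n k f \<Longrightarrow> tame n k (\<lambda>i x. inverse (f i x))"
  proof (induction n arbitrary: k)
    case 0
    then show ?case using sm[OF _ 0] lb by (auto simp: tame_def)
  next
    case (Suc n)
    have d: "- 1 * (dir_deriv v (f i) x * (inverse (f i x) * inverse (f i x))) = dir_deriv v (\<lambda>x. inverse (f i x)) x" if "i \<in> I" "x \<in> S" for v i x
      using nz[OF that] Suc.prems that
      by (intro dir_deriv_inverse[symmetric]) (auto intro: smooth_on_differentiable simp: tame_def)
    show ?case
    proof (rule tame_SucI)
      show "tame n k (\<lambda>i. dir_deriv v (\<lambda>x. inverse (f i x)))" if "v \<in> V" for v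
        by (rule tame_cong[OF d tame_mult[OF tame_const tame_mult[OF tame_dir_deriv
              tame_mult[OF Suc.IH[OF tame_Suc_n] Suc.IH[OF tame_Suc_n]]]]])
          (use Suc.prems that in auto)
      show "tame n j (\<lambda>i. dir_deriv \<tau> (\<lambda>x. inverse (f i x)))" if "k = Suc j" for j
        by (rule tame_cong[OF d tame_mult[OF tame_const tame_mult[OF tame_dir_deriv_time
              tame_mult[OF Suc.IH[OF tame_Suc_n] Suc.IH[OF tame_Suc_n]]]]])
          (use Suc.prems that tame_Suc_k in auto)
    qed (use sm[OF _ Suc.prems] lb in auto)
  qed
qed

definition ctame :: "nat \<Rightarrow> nat \<Rightarrow> ('i \<Rightarrow> 'a \<Rightarrow> complex) \<Rightarrow> bool" where
  "ctame n k F \<longleftrightarrow> tame n k (\<lambda>i x. Re (F i x)) \<and> tame n k (\<lambda>i x. Im (F i x))"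

lemma ctame_const: "ctame n k (\<lambda>i x. c)"
  by (simp add: ctame_def tame_const)

lemma ctame_add: "ctame n k F \<Longrightarrow> ctame n k G \<Longrightarrow> ctame n k (\<lambda>i x. F i x + G i x)"
  by (simp add: ctame_def tame_add)

lemma ctame_mult: "ctame n k F \<Longrightarrow> ctame n k G \<Longrightarrow> ctame n k (\<lambda>i x. F i x * G i x)"
  by (simp add: ctame_def tame_add tame_diff tame_mult)

lemma ctame_of_real: "tame n k f \<Longrightarrow> ctame n k (\<lambda>i x. complex_of_real (f i x))"
  by (simp add: ctame_def tame_const)

lemma ctame_sum: "(\<And>j. j \<in> J \<Longrightarrow> ctame n k (F j)) \<Longrightarrow> ctame n k (\<lambda>i x. \<Sum>j\<in>J. F j i x)"
  by (induction J rule: infinite_finite_induct) (auto intro: ctame_const ctame_add)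

lemma ctame_prod: "(\<And>j. j \<in> J \<Longrightarrow> ctame n k (F j)) \<Longrightarrow> ctame n k (\<lambda>i x. \<Prod>j\<in>J. F j i x)"
  by (induction J rule: infinite_finite_induct) (auto intro: ctame_const ctame_mult)

lemma ctame_det_I_plus_i:
  fixes A :: "'i \<Rightarrow> 'a \<Rightarrow> real^'n^'n"
  assumes "\<And>p q. tame n k (\<lambda>i x. A i x $ p $ q)"
  shows "ctame n k (\<lambda>i x. det (I_plus_i (A i x)))"
proof -
  have entry: "I_plus_i B $ p $ q = (if p = q then 1 else 0) + \<i> * complex_of_real (B $ p $ q)" for B :: "real^'n^'n" and p q
    by (simp add: I_plus_i_def mat_def)
  have "ctame n k (\<lambda>i x. I_plus_i (A i x) $ p $ q)" for p q
    unfolding entry by (intro ctame_add ctame_mult ctame_const ctame_of_real assms)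
  then show ?thesis
    unfolding det_def by (intro ctame_sum ctame_mult ctame_prod ctame_const)
qed

lemma derivs_bounded_iter_deriv:
  "set vs \<subseteq> V \<Longrightarrow> derivs_bounded (n + length vs) k f \<Longrightarrow> derivs_bounded n k (\<lambda>i. iter_deriv vs (f i))"
proof (induction vs arbitrary: f rule: rev_induct)
  case (snoc v vs)
  then show ?case by (auto simp: iter_deriv_append)
qed simp

lemma derivs_bounded_imp_loc_bounded_iter_deriv:
  "set vs \<subseteq> insert \<tau> V \<Longrightarrow> length vs \<le> n \<Longrightarrow> length vs \<le> k \<Longrightarrow> derivs_bounded n k f
    \<Longrightarrow> loc_bounded I S (\<lambda>i. iter_deriv vs (f i))"
proof (induction vs arbitrary: f n k rule: rev_induct)
  case Nil
  then show ?case by (auto intro: derivs_bounded_imp_loc_bounded)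
next
  case (snoc v vs)
  from snoc.prems obtain m j where nk: "n = Suc m" "k = Suc j" by (cases n; cases k) auto
  have "derivs_bounded m k (\<lambda>i. dir_deriv v (f i)) \<or> derivs_bounded m j (\<lambda>i. dir_deriv v (f i))"
    using snoc.prems nk by auto
  then have "derivs_bounded m j (\<lambda>i. dir_deriv v (f i))"
    using derivs_bounded_Suc_k nk by blast
  then show ?case
    using snoc.IH[of m j "\<lambda>i. dir_deriv v (f i)"] snoc.prems nk by (auto simp: iter_deriv_append)
qed

end

section \<open>Differentiating the Lagrangian angle\<close>

lemma det_I_plus_i_square_ge_1:
  fixes A :: "real^'n^'n"
  assumes "transpose A = A"
  shows "1 \<le> Re (det (I_plus_i A)) * Re (det (I_plus_i A)) + Im (det (I_plus_i A)) * Im (det (I_plus_i A))"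
  using one_le_power[OF cmod_det_I_plus_i_ge_1[OF assms], of 2] unfolding cmod_power2 by (simp add: power2_eq_square)

text \<open>Since \<open>\<theta>\<close> is the argument of \<open>P = R + \<i>Q\<close>, this is \<open>\<theta>' = Im (P'/P)\<close>. Along a solution, \<open>\<theta>\<close> is the time
  derivative of a smooth function, so its differentiability may be assumed, and it suffices to
  differentiate the identity \<open>R sin \<theta> = Q cos \<theta>\<close>.\<close>

lemma dir_deriv_lagrangian_angle:
  fixes A :: "'a::real_normed_vector \<Rightarrow> real^'n^'n"
  assumes S: "open S" "x \<in> S" and sym: "\<And>y. y \<in> S \<Longrightarrow> transpose (A y) = A y"
    and \<theta>: "\<And>y. y \<in> S \<Longrightarrow> \<theta> y = lagrangian_angle (A y)" "\<theta> differentiable (at x)"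
    and R: "R = (\<lambda>y. Re (det (I_plus_i (A y))))" "R differentiable (at x)"
    and Q: "Q = (\<lambda>y. Im (det (I_plus_i (A y))))" "Q differentiable (at x)"
  shows "dir_deriv v \<theta> x = (R x * dir_deriv v Q x - Q x * dir_deriv v R x) * inverse (R x * R x + Q x * Q x)"
proof -
  define \<rho> where "\<rho> y = cmod (det (I_plus_i (A y)))" for y
  have pol: "det (I_plus_i (A y)) = complex_of_real (\<rho> y) * exp (\<i> * complex_of_real (\<theta> y))" if "y \<in> S" for y
    using det_I_plus_i_polar[OF sym[OF that]] \<theta>(1)[OF that] by (simp add: \<rho>_def)
  have Rp: "R y = \<rho> y * cos (\<theta> y)" and Qp: "Q y = \<rho> y * sin (\<theta> y)" if "y \<in> S" for y
    using pol[OF that] by (simp_all add: R(1) Q(1) Re_exp Im_exp)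
  let ?R = "frechet_derivative R (at x)" and ?Q = "frechet_derivative Q (at x)" and ?\<theta> = "frechet_derivative \<theta> (at x)"
  have d: "(R has_derivative ?R) (at x)" "(Q has_derivative ?Q) (at x)" "(\<theta> has_derivative ?\<theta>) (at x)"
    using R(2) Q(2) \<theta>(2) by (simp_all add: frechet_derivative_works)
  have D1: "((\<lambda>y. R y * sin (\<theta> y) - Q y * cos (\<theta> y)) has_derivative
      (\<lambda>v. (R x * (cos (\<theta> x) * ?\<theta> v) + ?R v * sin (\<theta> x)) - (Q x * (- sin (\<theta> x) * ?\<theta> v) + ?Q v * cos (\<theta> x)))) (at x)"
    by (rule derivative_eq_intros d refl | simp add: fun_eq_iff)+
  have D2: "((\<lambda>y. R y * sin (\<theta> y) - Q y * cos (\<theta> y)) has_derivative (\<lambda>v. 0)) (at x)"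
    by (rule has_derivative_transform_within_open[OF has_derivative_const S]) (simp add: Rp Qp)
  have "(R x * (cos (\<theta> x) * ?\<theta> v) + ?R v * sin (\<theta> x)) - (Q x * (- sin (\<theta> x) * ?\<theta> v) + ?Q v * cos (\<theta> x)) = 0"
    using fun_cong[OF has_derivative_unique[OF D1 D2], of v] .
  then have "(R x * cos (\<theta> x) + Q x * sin (\<theta> x)) * ?\<theta> v = ?Q v * cos (\<theta> x) - ?R v * sin (\<theta> x)"
    by (simp add: algebra_simps)
  then have "\<rho> x * ((R x * cos (\<theta> x) + Q x * sin (\<theta> x)) * ?\<theta> v) = \<rho> x * (?Q v * cos (\<theta> x) - ?R v * sin (\<theta> x))"
    by (rule arg_cong)
  then have main: "(R x * R x + Q x * Q x) * ?\<theta> v = R x * ?Q v - Q x * ?R v"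
    using Rp[OF S(2)] Qp[OF S(2)] by (simp add: algebra_simps)
  have "R x * R x + Q x * Q x \<ge> 1"
    unfolding R(1) Q(1) by (rule det_I_plus_i_square_ge_1[OF sym[OF S(2)]])
  then have "R x * R x + Q x * Q x \<noteq> 0" by linarith
  then show ?thesis unfolding main[symmetric] by simp
qed

section \<open>A priori bounds for mixed derivatives of solutions\<close>

lemma open_spacetime: "open (spacetime :: ((real^'n) \<times> real) set)"
  by (intro open_Times) auto

lemma
  fixes f :: "(real^'n) \<times> real \<Rightarrow> real"
  assumes "smooth_on spacetime f" "t > 0"
  shows smooth_on_slice: "smooth_on UNIV (\<lambda>y. f (y, t))"
    and iter_deriv_slice: "iter_deriv vs (\<lambda>y. f (y, t)) x = iter_deriv (map (\<lambda>v. (v, 0)) vs) f (x, t)"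
proof -
  have L: "bounded_linear (\<lambda>v :: real^'n. (v, 0 :: real))"
    by (intro bounded_linear_Pair bounded_linear_ident bounded_linear_zero)
  have eq: "(\<lambda>y. f (y, t)) = (\<lambda>y. f ((0, t) + (y, 0)))" by simp
  have sub: "(0, t) + (y, 0) \<in> spacetime" for y :: "real^'n" using assms by simp
  show "smooth_on UNIV (\<lambda>y. f (y, t))"
    unfolding eq by (rule smooth_on_affine[OF open_UNIV L sub assms(1)])
  show "iter_deriv vs (\<lambda>y. f (y, t)) x = iter_deriv (map (\<lambda>v. (v, 0)) vs) f (x, t)"
    unfolding eq using iter_deriv_affine[OF open_UNIV L sub assms(1), of x vs] by simp
qed

lemma hessian_symmetric:
  assumes "Ck_on 2 UNIV f"
  shows "transpose (hessian f x) = hessian f x"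
  unfolding transpose_eq_iff hessian_def
  using dir_deriv_commute[OF open_UNIV assms] by simp

lemma hessian_slice_symmetric:
  assumes "smooth_on spacetime f" "t > 0"
  shows "transpose (hessian (\<lambda>y. f (y, t)) x) = hessian (\<lambda>y. f (y, t)) x"
  using hessian_symmetric smooth_on_Ck smooth_on_slice[OF assms] by blast

lemma time_derivative_eq:
  fixes f :: "(real^'n) \<times> real \<Rightarrow> real"
  assumes "smooth_on spacetime f" "t > 0"
  shows "((\<lambda>s. f (x, s)) has_real_derivative dir_deriv (0, 1) f (x, t)) (at t)"
  using has_real_derivative_line[of f "(x, 0)" t "(0, 1)"] smooth_on_differentiable[OF assms(1), of "(x, t)"] assms(2)
  by simp

lemma dir_deriv_time_flow:
  fixes f :: "(real^'n) \<times> real \<Rightarrow> real"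
  assumes "smooth_on spacetime f" "solves_flow f" "z \<in> spacetime"
  shows "dir_deriv (0, 1) f z = lagrangian_angle (hessian (\<lambda>y. f (y, snd z)) (fst z))"
proof -
  obtain x t where z: "z = (x, t)" and t: "t > 0" using assms(3) by auto
  show ?thesis
    using DERIV_unique[OF time_derivative_eq[OF assms(1) t, of x]] assms(2) t
    unfolding solves_flow_def z by auto
qed

text \<open>Induction on the number of time derivatives. A time derivative of a spatial derivative of order
  at least two is a spatial derivative of \<open>\<partial>\<^sub>a \<theta> (D\<^sup>2f)\<close> for some spatial \<open>a\<close>, and this function is an algebraic
  expression in spatial derivatives of order two and three, which involve one time derivative less.
  The order of the remaining spatial derivatives may be arbitrarily large, hence the inner induction
  with the total order left free.\<close>

lemma flow_family_derivs_bounded: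
  fixes f :: "'i \<Rightarrow> (real^'n) \<times> real \<Rightarrow> real"
  assumes smooth: "\<And>i. i \<in> I \<Longrightarrow> smooth_on spacetime (f i)"
    and flow: "\<And>i. i \<in> I \<Longrightarrow> solves_flow (f i)"
    and spatial: "\<And>ws. set ws \<subseteq> (\<lambda>b. (b, 0)) ` Basis \<Longrightarrow> 2 \<le> length ws \<Longrightarrow>
      loc_bounded I spacetime (\<lambda>i. iter_deriv ws (f i))"
    and vs: "set vs \<subseteq> Basis" "2 \<le> length vs"
  shows "loc_bounded I spacetime (\<lambda>i. iter_deriv vs (f i))"
proof -
  define V where "V = (\<lambda>b :: real^'n. (b, 0 :: real)) ` Basis"
  define \<tau> where "\<tau> = (0 :: real^'n, 1 :: real)"
  let ?S = "spacetime :: ((real^'n) \<times> real) set"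
  interpret derivative_family I ?S V \<tau>
    by unfold_locales (rule open_spacetime)
  define A where "A i z = hessian (\<lambda>y. f i (y, snd z)) (fst z)" for i z
  define g where "g i = dir_deriv \<tau> (f i)" for i
  define R where "R i z = Re (det (I_plus_i (A i z)))" for i z
  define Q where "Q i z = Im (det (I_plus_i (A i z)))" for i z
  \<comment> \<open>On \<open>S\<close> this is the derivative of the Lagrangian angle in direction \<open>a\<close>.\<close>
  define F where "F a i z = (R i z * dir_deriv a (Q i) z - Q i z * dir_deriv a (R i) z)
    * inverse (R i z * R i z + Q i z * Q i z)" for a i z
  have entry: "A i z $ p $ q = iter_deriv [(axis p 1, 0), (axis q 1, 0)] (f i) z"
    if i: "i \<in> I" and zS: "z \<in> ?S" for i z p q
  proof -
    obtain x t where z: "z = (x, t)" and t: "t > 0" using zS by auto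
    show ?thesis
      unfolding A_def hessian_def z using iter_deriv_slice[OF smooth[OF i] t, of "[axis p 1, axis q 1]" x] by simp
  qed
  have sym: "transpose (A i z) = A i z" if "i \<in> I" "z \<in> ?S" for i z
    unfolding A_def using hessian_slice_symmetric[OF smooth[OF that(1)], of "snd z" "fst z"] that(2) by auto
  have spatial': "loc_bounded I ?S (\<lambda>i. iter_deriv ws (f i))" if "set ws \<subseteq> V" "2 \<le> length ws" for ws
    using spatial[of ws] that by (simp add: V_def)
  have V2: "set [(axis p 1, 0), (axis q 1, 0)] \<subseteq> V" for p q
    by (auto simp: V_def Basis_vec_def)
  have RQ1: "1 \<le> R i z * R i z + Q i z * Q i z" if "i \<in> I" "z \<in> ?S" for i z
    unfolding R_def Q_def by (rule det_I_plus_i_square_ge_1[OF sym[OF that]])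
  have tameRQ: "tame n k R" "tame n k Q"
    if "\<And>ws. set ws \<subseteq> V \<Longrightarrow> 2 \<le> length ws \<Longrightarrow> tame n k (\<lambda>i. iter_deriv ws (f i))" for n k
  proof -
    have "tame n k (\<lambda>i z. A i z $ p $ q)" for p q
      by (rule tame_cong[OF entry[symmetric] that[OF V2]]) auto
    then have "ctame n k (\<lambda>i z. det (I_plus_i (A i z)))"
      by (rule ctame_det_I_plus_i)
    then show "tame n k R" "tame n k Q"
      unfolding ctame_def R_def[abs_def] Q_def[abs_def] by auto
  qed
  have smooth_iter: "smooth_on ?S (iter_deriv ws (f i))" if "i \<in> I" for ws i
    by (rule smooth_on_iter_deriv[OF smooth[OF that]])
  have tame0: "tame 0 k (\<lambda>i. iter_deriv ws (f i))" if "set ws \<subseteq> V" "2 \<le> length ws" for ws k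
    using smooth_iter spatial'[OF that] by (simp add: tame_def)
  have smoothRQ: "smooth_on ?S (R i)" "smooth_on ?S (Q i)" if "i \<in> I" for i
    using tameRQ[of 0 0, OF tame0] that by (auto simp: tame_def)
  have dg: "F a i z = dir_deriv a (g i) z" if i: "i \<in> I" and z: "z \<in> ?S" for a i z
    unfolding F_def
  proof (rule dir_deriv_lagrangian_angle[OF open_spacetime z sym[OF i], symmetric])
    show "g i y = lagrangian_angle (A i y)" if "y \<in> ?S" for y
      unfolding g_def \<tau>_def A_def by (rule dir_deriv_time_flow[OF smooth[OF i] flow[OF i] that])
    show "g i differentiable at z"
      unfolding g_def by (rule smooth_on_differentiable[OF smooth_on_dir_deriv[OF smooth[OF i]] z])
    show "R i differentiable at z" "Q i differentiable at z"
      using smoothRQ[OF i] z smooth_on_differentiable by blast+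
  qed (auto simp: R_def[abs_def] Q_def[abs_def])
  have tameF: "tame n k (F a)"
    if RQ: "tame (Suc n) k R" "tame (Suc n) k Q" and dRQ: "tame n k (\<lambda>i. dir_deriv a (R i))" "tame n k (\<lambda>i. dir_deriv a (Q i))" for n k a
    unfolding F_def[abs_def]
    by (intro tame_mult tame_diff tame_inverse tame_add RQ1 dRQ tame_Suc_n[OF RQ(1)] tame_Suc_n[OF RQ(2)])
  have tameFV: "tame n k (F a)"
    if "a \<in> V" "\<And>ws. set ws \<subseteq> V \<Longrightarrow> 2 \<le> length ws \<Longrightarrow> tame (Suc n) k (\<lambda>i. iter_deriv ws (f i))" for n k a
    using tameRQ[OF that(2)] that(1) by (intro tameF) (auto intro: tame_dir_deriv)
  have time_commute: "dir_deriv \<tau> (iter_deriv ws (f i)) z = iter_deriv ws (g i) z" if "i \<in> I" "z \<in> ?S" for i z ws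
    unfolding g_def by (rule dir_deriv_iter_deriv_commute[OF open_spacetime smooth[OF that(1)] that(2)])
  have claim: "tame n k (\<lambda>i. iter_deriv ws (f i))" if "set ws \<subseteq> V" "2 \<le> length ws" for n k ws
    using that
  proof (induction k arbitrary: n ws rule: less_induct)
    case (less k)
    show ?case
      using less.prems
    proof (induction n arbitrary: ws)
      case 0
      then show ?case by (rule tame0)
    next
      case (Suc n)
      show ?case
      proof (rule tame_SucI)
        show "smooth_on ?S (iter_deriv ws (f i))" if "i \<in> I" for i by (rule smooth_iter[OF that])
        show "loc_bounded I ?S (\<lambda>i. iter_deriv ws (f i))" by (rule spatial'[OF Suc.prems])
        show "tame n k (\<lambda>i. dir_deriv v (iter_deriv ws (f i)))" if "v \<in> V" for v
          using Suc.IH[of "v # ws"] Suc.prems that by simp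
        show "tame n j (\<lambda>i. dir_deriv \<tau> (iter_deriv ws (f i)))" if k: "k = Suc j" for j
        proof -
          obtain ws' a where ws: "ws = ws' @ [a]" using Suc.prems(2) by (cases ws rule: rev_cases) auto
          have a: "a \<in> V" and ws': "set ws' \<subseteq> V" using Suc.prems(1) ws by auto
          have "tame (n + length ws') j (F a)"
            using tameFV[OF a] less.IH[of j] k by blast
          then have T: "tame n j (\<lambda>i. iter_deriv ws' (F a i))"
            using derivs_bounded_iter_deriv[OF ws'] smooth_on_iter_deriv unfolding tame_def by blast
          have eq: "iter_deriv ws' (F a i) z = dir_deriv \<tau> (iter_deriv ws (f i)) z" if "i \<in> I" "z \<in> ?S" for i z
            unfolding time_commute[OF that] unfolding ws iter_deriv_append
            using iter_deriv_cong[OF open_spacetime, of "F a i" "dir_deriv a (g i)"] dg[OF that(1)] that(2) by simp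
          show ?thesis by (rule tame_cong[OF eq T])
        qed
      qed
    qed
  qed
  have second: "tame n n (\<lambda>i. dir_deriv a (dir_deriv b (f i)))" if ab: "a \<in> insert \<tau> V" "b \<in> insert \<tau> V" for n a b
  proof -
    have FV: "tame n n (F c)" if "c \<in> V" for c by (rule tameFV[OF that claim])
    consider "b = \<tau>" "a \<in> V" | "b = \<tau>" "a = \<tau>" | "b \<in> V" "a = \<tau>" | "b \<in> V" "a \<in> V"
      using ab by blast
    then show ?thesis
    proof cases
      case 1
      have "tame n n (\<lambda>i. dir_deriv a (g i))" by (rule tame_cong[OF dg FV[OF 1(2)]])
      then show ?thesis by (simp add: g_def 1)
    next
      case 2
      have "tame (Suc n) (Suc n) R" "tame (Suc n) (Suc n) Q" by (rule tameRQ; rule claim; assumption)+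
      then have T: "tame n n (F \<tau>)"
        by (intro tameF tame_dir_deriv_time) (auto intro: tame_Suc_k)
      have "tame n n (\<lambda>i. dir_deriv \<tau> (g i))" by (rule tame_cong[OF dg T])
      then show ?thesis by (simp add: g_def 2)
    next
      case 3
      have T: "tame n n (\<lambda>i. dir_deriv b (g i))" by (rule tame_cong[OF dg FV[OF 3(1)]])
      have eq: "dir_deriv b (g i) z = dir_deriv a (dir_deriv b (f i)) z" if "i \<in> I" "z \<in> ?S" for i z
        using time_commute[OF that, of "[b]"] 3 by simp
      show ?thesis by (rule tame_cong[OF eq T])
    next
      case 4
      then show ?thesis using claim[of "[a, b]" n n] by simp
    qed
  qed
  have Basis: "Basis = insert \<tau> V"
    by (auto simp: Basis_prod_def V_def \<tau>_def)
  obtain us b where us: "vs = us @ [b]" using vs(2) by (cases vs rule: rev_cases) auto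
  obtain ws a where ws: "us = ws @ [a]" using vs(2) us by (cases us rule: rev_cases) auto
  have "a \<in> insert \<tau> V" "b \<in> insert \<tau> V" and sub: "set ws \<subseteq> insert \<tau> V"
    using vs(1) us ws Basis by auto
  from second[OF this(1,2), of "length ws"]
  have "derivs_bounded (length ws) (length ws) (\<lambda>i. dir_deriv a (dir_deriv b (f i)))"
    by (simp add: tame_def)
  from derivs_bounded_imp_loc_bounded_iter_deriv[OF sub order_refl order_refl this]
  show ?thesis by (simp add: us ws iter_deriv_append)
qed

section \<open>Interpolation and smooth limits\<close>

definition loc_unif_Cauchy :: "'a::topological_space set \<Rightarrow> (real \<Rightarrow> 'a \<Rightarrow> real) \<Rightarrow> bool" where
  "loc_unif_Cauchy S f \<longleftrightarrow> (\<forall>K e. compact K \<and> K \<subseteq> S \<and> e > 0 \<longrightarrow>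
     (\<exists>M. \<forall>\<mu>\<ge>M. \<forall>\<nu>\<ge>M. \<forall>x\<in>K. \<bar>f \<mu> x - f \<nu> x\<bar> \<le> e))"

lemma loc_unif_CauchyE:
  assumes "loc_unif_Cauchy S f" "compact K" "K \<subseteq> S" "e > 0"
  obtains M where "\<And>\<mu> \<nu> x. \<mu> \<ge> M \<Longrightarrow> \<nu> \<ge> M \<Longrightarrow> x \<in> K \<Longrightarrow> \<bar>f \<mu> x - f \<nu> x\<bar> \<le> e"
proof -
  have "\<exists>M. \<forall>\<mu>\<ge>M. \<forall>\<nu>\<ge>M. \<forall>x\<in>K. \<bar>f \<mu> x - f \<nu> x\<bar> \<le> e"
    using assms unfolding loc_unif_Cauchy_def by simp
  then obtain M where "\<forall>\<mu>\<ge>M. \<forall>\<nu>\<ge>M. \<forall>x\<in>K. \<bar>f \<mu> x - f \<nu> x\<bar> \<le> e" ..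
  then show thesis by (intro that[of M]) blast
qed

text \<open>The difference quotient of step \<open>h\<close> is at most \<open>2\<epsilon>/h\<close>, and it differs from the derivative by at most \<open>Ch\<close>.\<close>

lemma dir_deriv_interpolation:
  fixes f :: "'a::real_normed_vector \<Rightarrow> real"
  assumes "Ck_on 2 S f" "h > 0" and sub: "\<And>s. s \<in> {0..h} \<Longrightarrow> x + s *\<^sub>R v \<in> S"
    and f: "\<bar>f x\<bar> \<le> \<epsilon>" "\<bar>f (x + h *\<^sub>R v)\<bar> \<le> \<epsilon>"
    and C: "\<And>s. s \<in> {0..h} \<Longrightarrow> \<bar>dir_deriv v (dir_deriv v f) (x + s *\<^sub>R v)\<bar> \<le> C"
  shows "\<bar>dir_deriv v f x\<bar> \<le> 2 * \<epsilon> / h + C * h"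
proof -
  have df: "f differentiable (at y)" "dir_deriv v f differentiable (at y)" if "y \<in> S" for y
    using assms(1) that by (auto simp: numeral_2_eq_2)
  have "\<exists>s. 0 < s \<and> s < h \<and> f (x + h *\<^sub>R v) - f (x + 0 *\<^sub>R v) = (h - 0) * dir_deriv v f (x + s *\<^sub>R v)"
    by (rule MVT2[OF \<open>h > 0\<close>]) (rule has_real_derivative_line, rule df(1), use sub in auto)
  then obtain s where s: "0 < s" "s < h" and 1: "f (x + h *\<^sub>R v) - f x = h * dir_deriv v f (x + s *\<^sub>R v)"
    by auto
  have "\<exists>r. 0 < r \<and> r < s \<and> dir_deriv v f (x + s *\<^sub>R v) - dir_deriv v f (x + 0 *\<^sub>R v) = (s - 0) * dir_deriv v (dir_deriv v f) (x + r *\<^sub>R v)"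
    by (rule MVT2[OF \<open>0 < s\<close>]) (rule has_real_derivative_line, rule df(2), use sub s in auto)
  then obtain r where r: "0 < r" "r < s" and 2: "dir_deriv v f (x + s *\<^sub>R v) - dir_deriv v f x = s * dir_deriv v (dir_deriv v f) (x + r *\<^sub>R v)"
    by auto
  have "\<bar>s * dir_deriv v (dir_deriv v f) (x + r *\<^sub>R v)\<bar> \<le> h * C"
    unfolding abs_mult using s r C[of r] by (intro mult_mono) auto
  moreover have "\<bar>dir_deriv v f (x + s *\<^sub>R v)\<bar> \<le> 2 * \<epsilon> / h"
  proof -
    have "h * \<bar>dir_deriv v f (x + s *\<^sub>R v)\<bar> = \<bar>f (x + h *\<^sub>R v) - f x\<bar>" using \<open>h > 0\<close> by (simp add: 1 abs_mult)
    also have "\<dots> \<le> 2 * \<epsilon>" using f by linarith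
    finally show ?thesis using \<open>h > 0\<close> by (simp add: pos_le_divide_eq mult.commute)
  qed
  ultimately show ?thesis using 2 by (simp add: mult.commute)
qed

text \<open>First \<open>h\<close> is taken so small that the second-derivative term in \<open>dir_deriv_interpolation\<close> is
  below \<open>e/2\<close>; then the parameters are taken so large that the other term is. The segments of
  length \<open>h\<close> may leave \<open>K\<close>, so both estimates are needed on a slightly larger compact set.\<close>

lemma loc_unif_Cauchy_dir_deriv:
  fixes f :: "real \<Rightarrow> 'a::euclidean_space \<Rightarrow> real"
  assumes S: "open S" and smooth: "\<And>\<mu>. \<mu> > 0 \<Longrightarrow> smooth_on S (f \<mu>)"
    and bdd: "loc_bounded {0<..} S (\<lambda>\<mu>. dir_deriv v (dir_deriv v (f \<mu>)))"
    and Cauchy: "loc_unif_Cauchy S f"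
  shows "loc_unif_Cauchy S (\<lambda>\<mu>. dir_deriv v (f \<mu>))"
  unfolding loc_unif_Cauchy_def
proof (intro allI impI)
  fix K and e :: real assume "compact K \<and> K \<subseteq> S \<and> e > 0"
  then have K: "compact K" "K \<subseteq> S" and e: "e > 0" by auto
  obtain d where d: "d > 0" "(\<Union>x\<in>K. cball x d) \<subseteq> S"
    using compact_subset_open_imp_cball_epsilon_subset[OF K(1) S K(2)] by blast
  define K' where "K' = {x + y |x y. x \<in> K \<and> y \<in> cball 0 d}"
  have K'c: "compact K'" unfolding K'_def by (rule compact_sums[OF K(1) compact_cball])
  have K'S: "K' \<subseteq> S"
  proof
    fix z assume "z \<in> K'"
    then obtain x y where "z = x + y" "x \<in> K" "norm y \<le> d" by (auto simp: K'_def)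
    then have "z \<in> (\<Union>x\<in>K. cball x d)" by (intro UN_I[of x]) (auto simp: dist_norm)
    then show "z \<in> S" using d by blast
  qed
  obtain C where C: "\<And>\<mu> x. \<mu> > 0 \<Longrightarrow> x \<in> K' \<Longrightarrow> \<bar>dir_deriv v (dir_deriv v (f \<mu>)) x\<bar> \<le> C"
    using bdd K'c K'S unfolding loc_bounded_def by (metis greaterThan_iff)
  \<comment> \<open>The first term keeps the segment within distance \<open>d\<close>, the second bounds \<open>2 C h\<close> by \<open>e / 2\<close>.\<close>
  define h where "h = min (d / (norm v + 1)) (e / (4 * (\<bar>C\<bar> + 1)))"
  have h: "h > 0" using d e by (simp add: h_def add_nonneg_pos)
  have hv: "h * norm v \<le> d"
  proof -
    have "h * norm v \<le> d / (norm v + 1) * (norm v + 1)"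
      using d by (intro mult_mono) (auto simp: h_def)
    also have "\<dots> = d" using norm_ge_zero[of v] by (simp del: norm_ge_zero add: add_nonneg_eq_0_iff)
    finally show ?thesis .
  qed
  have hC: "2 * C * h \<le> e / 2"
  proof -
    have "2 * C * h \<le> 2 * (\<bar>C\<bar> + 1) * (e / (4 * (\<bar>C\<bar> + 1)))"
      using h abs_ge_self[of C] by (rule_tac mult_mono) (auto simp: h_def)
    also have "\<dots> = e / 2" using abs_ge_zero[of C] by (simp add: field_simps)
    finally show ?thesis .
  qed
  obtain M where M: "\<And>\<mu> \<nu> x. \<mu> \<ge> M \<Longrightarrow> \<nu> \<ge> M \<Longrightarrow> x \<in> K' \<Longrightarrow> \<bar>f \<mu> x - f \<nu> x\<bar> \<le> e * h / 4"
    using loc_unif_CauchyE[OF Cauchy K'c K'S, of "e * h / 4"] e h by auto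
  show "\<exists>M. \<forall>\<mu>\<ge>M. \<forall>\<nu>\<ge>M. \<forall>x\<in>K. \<bar>dir_deriv v (f \<mu>) x - dir_deriv v (f \<nu>) x\<bar> \<le> e"
  proof (intro exI[of _ "max M 1"] allI impI ballI)
    fix \<mu> \<nu> x assume \<mu>\<nu>: "max M 1 \<le> \<mu>" "max M 1 \<le> \<nu>" and x: "x \<in> K"
    define w where "w = (\<lambda>x. f \<mu> x - f \<nu> x)"
    have pos: "\<mu> > 0" "\<nu> > 0" using \<mu>\<nu> by auto
    note sm = smooth[OF pos(1)] smooth[OF pos(2)]
    have seg: "x + s *\<^sub>R v \<in> K'" if "s \<in> {0..h}" for s
    proof -
      have "norm (s *\<^sub>R v) \<le> h * norm v" using that by (auto intro: mult_right_mono)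
      then have "norm (s *\<^sub>R v) \<le> d" using hv by linarith
      then have "s *\<^sub>R v \<in> cball 0 d" by simp
      then show ?thesis unfolding K'_def using x by blast
    qed
    have w1: "dir_deriv v w y = dir_deriv v (f \<mu>) y - dir_deriv v (f \<nu>) y" if "y \<in> S" for y
      unfolding w_def using sm that by (intro dir_deriv_diff smooth_on_differentiable)
    have w2: "dir_deriv v (dir_deriv v w) y = dir_deriv v (dir_deriv v (f \<mu>)) y - dir_deriv v (dir_deriv v (f \<nu>)) y" if "y \<in> S" for y
    proof -
      have "dir_deriv v (dir_deriv v w) y = dir_deriv v (\<lambda>y. dir_deriv v (f \<mu>) y - dir_deriv v (f \<nu>) y) y"
        by (rule dir_deriv_cong[OF S that w1])
      also have "\<dots> = dir_deriv v (dir_deriv v (f \<mu>)) y - dir_deriv v (dir_deriv v (f \<nu>)) y"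
        using sm that by (intro dir_deriv_diff smooth_on_differentiable) (auto intro: smooth_on_dir_deriv)
      finally show ?thesis .
    qed
    have xS: "x \<in> S" using x K by blast
    have "\<bar>dir_deriv v w x\<bar> \<le> 2 * (e * h / 4) / h + 2 * C * h"
    proof (rule dir_deriv_interpolation[of S])
      show "Ck_on 2 S w" unfolding w_def by (intro smooth_on_Ck smooth_on_diff S sm)
      show "h > 0" by (rule h)
      show "x + s *\<^sub>R v \<in> S" if "s \<in> {0..h}" for s using seg[OF that] K'S by blast
      show "\<bar>w x\<bar> \<le> e * h / 4" unfolding w_def using M[of \<mu> \<nu> x] \<mu>\<nu> seg[of 0] h by simp
      show "\<bar>w (x + h *\<^sub>R v)\<bar> \<le> e * h / 4" unfolding w_def using M[of \<mu> \<nu> "x + h *\<^sub>R v"] \<mu>\<nu> seg[of h] h by simp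
      show "\<bar>dir_deriv v (dir_deriv v w) (x + s *\<^sub>R v)\<bar> \<le> 2 * C" if "s \<in> {0..h}" for s
      proof -
        have "x + s *\<^sub>R v \<in> S" using seg[OF that] K'S by blast
        then show ?thesis
          using w2 C[OF pos(1) seg[OF that]] C[OF pos(2) seg[OF that]] by simp
      qed
    qed
    also have "\<dots> \<le> e / 2 + e / 2" using hC h by simp
    finally show "\<bar>dir_deriv v (f \<mu>) x - dir_deriv v (f \<nu>) x\<bar> \<le> e" using w1[OF xS] by simp
  qed
qed

text \<open>The limits \<open>g vs\<close> of the partial derivatives exist locally uniformly. By the theorem on
  differentiation of sequences, the total derivative of \<open>g vs\<close> has the components \<open>g (b # vs)\<close>, so all of
  them are smooth and \<open>g vs\<close> is the iterated derivative of \<open>g []\<close>.\<close>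

lemma smooth_limit:
  fixes F :: "real \<Rightarrow> 'a::euclidean_space \<Rightarrow> real"
  assumes S: "open S" and smooth: "\<And>\<mu>. \<mu> > 0 \<Longrightarrow> smooth_on S (F \<mu>)"
    and Cauchy: "\<And>vs. set vs \<subseteq> Basis \<Longrightarrow> loc_unif_Cauchy S (\<lambda>\<mu>. iter_deriv vs (F \<mu>))"
  obtains U where "smooth_on S U" "converges_Cinf_loc S F U at_top"
proof -
  define X where "X vs n x = iter_deriv vs (F (real (Suc n))) x" for vs n x
  define g where "g vs x = lim (\<lambda>n. X vs n x)" for vs x
  have to_top: "filterlim (\<lambda>n. real (Suc n)) at_top sequentially"
    by (rule filterlim_compose[OF filterlim_real_sequentially filterlim_Suc])
  have pt: "(\<lambda>n. X vs n x) \<longlonglongrightarrow> g vs x" if vs: "set vs \<subseteq> Basis" and x: "x \<in> S" for vs x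
  proof -
    have "Cauchy (\<lambda>n. X vs n x)"
      unfolding Cauchy_def
    proof (intro allI impI)
      fix e :: real assume "e > 0"
      have "compact {x}" "{x} \<subseteq> S" using x by auto
      from loc_unif_CauchyE[OF Cauchy[OF vs] this half_gt_zero[OF \<open>e > 0\<close>]]
      obtain M where M: "\<And>\<mu> \<nu> y. \<mu> \<ge> M \<Longrightarrow> \<nu> \<ge> M \<Longrightarrow> y \<in> {x} \<Longrightarrow> \<bar>iter_deriv vs (F \<mu>) y - iter_deriv vs (F \<nu>) y\<bar> \<le> e / 2"
        by blast
      show "\<exists>N. \<forall>m\<ge>N. \<forall>n\<ge>N. dist (X vs m x) (X vs n x) < e"
      proof (intro exI[of _ "nat \<lceil>M\<rceil>"] allI impI)
        fix m n assume "m \<ge> nat \<lceil>M\<rceil>" "n \<ge> nat \<lceil>M\<rceil>"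
        then have "real (Suc m) \<ge> M" "real (Suc n) \<ge> M" by linarith+
        from M[OF this singletonI] show "dist (X vs m x) (X vs n x) < e"
          using \<open>e > 0\<close> by (simp add: dist_real_def X_def)
      qed
    qed
    then show ?thesis unfolding g_def by (simp add: Cauchy_convergent_iff convergent_LIMSEQ_iff)
  qed
  have ul: "uniform_limit K (\<lambda>\<mu>. iter_deriv vs (F \<mu>)) (g vs) at_top"
    if vs: "set vs \<subseteq> Basis" and K: "compact K" "K \<subseteq> S" for vs K
    unfolding uniform_limit_iff
  proof (intro allI impI)
    fix e :: real assume "e > 0"
    then obtain M where M: "\<And>\<mu> \<nu> x. \<mu> \<ge> M \<Longrightarrow> \<nu> \<ge> M \<Longrightarrow> x \<in> K \<Longrightarrow> \<bar>iter_deriv vs (F \<mu>) x - iter_deriv vs (F \<nu>) x\<bar> \<le> e / 2"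
      using loc_unif_CauchyE[OF Cauchy[OF vs] K, of "e / 2"] by auto
    have "dist (iter_deriv vs (F \<mu>) x) (g vs x) < e" if \<mu>: "\<mu> \<ge> M" and x: "x \<in> K" for \<mu> x
    proof -
      have "(\<lambda>n. \<bar>iter_deriv vs (F \<mu>) x - X vs n x\<bar>) \<longlonglongrightarrow> \<bar>iter_deriv vs (F \<mu>) x - g vs x\<bar>"
        using pt[OF vs, of x] x K(2) by (intro tendsto_intros) auto
      moreover have "\<forall>\<^sub>F n in sequentially. real (Suc n) \<ge> M"
        using to_top unfolding filterlim_at_top by blast
      then have "\<forall>\<^sub>F n in sequentially. \<bar>iter_deriv vs (F \<mu>) x - X vs n x\<bar> \<le> e / 2"
        by eventually_elim (use M[OF \<mu> _ x] in \<open>simp add: X_def\<close>)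
      ultimately have "\<bar>iter_deriv vs (F \<mu>) x - g vs x\<bar> \<le> e / 2"
        by (rule tendsto_upperbound) simp
      then show ?thesis using \<open>e > 0\<close> by (simp add: dist_real_def)
    qed
    then show "\<forall>\<^sub>F \<mu> in at_top. \<forall>x\<in>K. dist (iter_deriv vs (F \<mu>) x) (g vs x) < e"
      by (intro eventually_at_top_linorderI[of M]) blast
  qed
  have hd: "(g vs has_derivative (\<lambda>v. \<Sum>b\<in>Basis. (v \<bullet> b) * g (b # vs) x)) (at x)"
    if vs: "set vs \<subseteq> Basis" and x: "x \<in> S" for vs x
  proof -
    obtain r where r: "r > 0" "cball x r \<subseteq> S" using S x open_contains_cball by blast
    have ball: "ball x r \<subseteq> S" using r ball_subset_cball by blast
    have sm: "smooth_on S (X vs n)" for n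
      unfolding X_def[abs_def] by (intro smooth_on_iter_deriv smooth) simp
    have "\<exists>G. \<forall>y\<in>ball x r. (\<lambda>n. X vs n y) \<longlonglongrightarrow> G y \<and>
        (G has_derivative (\<lambda>v. \<Sum>b\<in>Basis. (v \<bullet> b) * g (b # vs) y)) (at y within ball x r)"
    proof (rule has_derivative_sequence)
      show "convex (ball x r)" by simp
      show "x \<in> ball x r" using r by simp
      show "(X vs n has_derivative frechet_derivative (X vs n) (at y)) (at y within ball x r)" if "y \<in> ball x r" for n y
      proof -
        have "y \<in> S" using ball that by blast
        then have "(X vs n has_derivative frechet_derivative (X vs n) (at y)) (at y)"
          using smooth_on_differentiable[OF sm] frechet_derivative_works by blast
        then show ?thesis by (rule has_derivative_at_withinI)
      qed
      show "(\<lambda>n. X vs n x) \<longlonglongrightarrow> g vs x" by (rule pt[OF vs x])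
      fix e :: real assume "e > 0"
      define e' where "e' = e / real DIM('a)"
      have e': "e' > 0" using \<open>e > 0\<close> by (simp add: e'_def)
      have "\<forall>\<^sub>F n in sequentially. \<forall>y\<in>cball x r. dist (X (b # vs) n y) (g (b # vs) y) < e'" if b: "b \<in> Basis" for b
      proof -
        have "uniform_limit (cball x r) (\<lambda>\<mu>. iter_deriv (b # vs) (F \<mu>)) (g (b # vs)) at_top"
          by (rule ul) (use b vs r in auto)
        then have "\<forall>\<^sub>F \<mu> in at_top. \<forall>y\<in>cball x r. dist (iter_deriv (b # vs) (F \<mu>) y) (g (b # vs) y) < e'"
          using e' unfolding uniform_limit_iff by blast
        from eventually_compose_filterlim[OF this to_top] show ?thesis by (simp add: X_def)
      qed
      then have "\<forall>\<^sub>F n in sequentially. \<forall>b\<in>Basis. \<forall>y\<in>cball x r. dist (X (b # vs) n y) (g (b # vs) y) < e'"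
        by (intro eventually_ball_finite) auto
      then show "\<forall>\<^sub>F n in sequentially. \<forall>y\<in>ball x r. \<forall>h.
          norm (frechet_derivative (X vs n) (at y) h - (\<Sum>b\<in>Basis. (h \<bullet> b) * g (b # vs) y)) \<le> e * norm h"
      proof eventually_elim
        case (elim n)
        show ?case
        proof (intro ballI allI)
          fix y h assume y: "y \<in> ball x r"
          have "frechet_derivative (X vs n) (at y) h = (\<Sum>b\<in>Basis. (h \<bullet> b) * X (b # vs) n y)"
            using dir_deriv_sum_Basis[OF smooth_on_differentiable[OF sm], of y n h] y ball by (auto simp: X_def[abs_def])
          then have "norm (frechet_derivative (X vs n) (at y) h - (\<Sum>b\<in>Basis. (h \<bullet> b) * g (b # vs) y))
            = \<bar>\<Sum>b\<in>Basis. (h \<bullet> b) * (X (b # vs) n y - g (b # vs) y)\<bar>"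
            by (simp add: sum_subtractf right_diff_distrib)
          also have "\<dots> \<le> (\<Sum>b\<in>(Basis::'a set). norm h * e')"
          proof (intro order.trans[OF sum_abs] sum_mono)
            fix b :: 'a assume b: "b \<in> Basis"
            have "dist (X (b # vs) n y) (g (b # vs) y) < e'"
              using elim b y ball_subset_cball by blast
            then have "\<bar>X (b # vs) n y - g (b # vs) y\<bar> \<le> e'" by (simp add: dist_real_def)
            then show "\<bar>(h \<bullet> b) * (X (b # vs) n y - g (b # vs) y)\<bar> \<le> norm h * e'"
              unfolding abs_mult using Basis_le_norm[OF b, of h] by (intro mult_mono) auto
          qed
          also have "\<dots> = e * norm h" by (simp add: e'_def)
          finally show "norm (frechet_derivative (X vs n) (at y) h - (\<Sum>b\<in>Basis. (h \<bullet> b) * g (b # vs) y)) \<le> e * norm h" .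
        qed
      qed
    qed
    then obtain G where G: "\<And>y. y \<in> ball x r \<Longrightarrow> (\<lambda>n. X vs n y) \<longlonglongrightarrow> G y"
      "\<And>y. y \<in> ball x r \<Longrightarrow> (G has_derivative (\<lambda>v. \<Sum>b\<in>Basis. (v \<bullet> b) * g (b # vs) y)) (at y within ball x r)"
      by blast
    have "(G has_derivative (\<lambda>v. \<Sum>b\<in>Basis. (v \<bullet> b) * g (b # vs) x)) (at x)"
      using G(2)[of x] r at_within_open[of x "ball x r"] by simp
    then show ?thesis
    proof (rule has_derivative_transform_within_open)
      show "open (ball x r)" "x \<in> ball x r" using r by auto
      show "G y = g vs y" if "y \<in> ball x r" for y
        using LIMSEQ_unique[OF G(1)[OF that] pt[OF vs]] ball that by blast
    qed
  qed
  have Ck: "Ck_on k S (g vs)" if "set vs \<subseteq> Basis" for k vs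
    using that
  proof (induction k arbitrary: vs)
    case 0
    then show ?case
      using hd by (auto intro!: continuous_at_imp_continuous_on has_derivative_continuous)
  next
    case (Suc k)
    have "Ck_on k S (dir_deriv v (g vs))" for v
    proof (rule Ck_on_cong[OF S])
      show "Ck_on k S (\<lambda>x. \<Sum>b\<in>Basis. (v \<bullet> b) * g (b # vs) x)"
        using Suc by (intro Ck_on_sum S Ck_on_mult Ck_on_const) auto
      show "(\<Sum>b\<in>Basis. (v \<bullet> b) * g (b # vs) y) = dir_deriv v (g vs) y" if "y \<in> S" for y
        by (rule dir_deriv_eqI[OF hd[OF Suc.prems that], symmetric])
    qed
    then show ?case using hd[OF Suc.prems] by (auto simp: differentiable_def)
  qed
  define U where "U = g []"
  have iter: "iter_deriv vs U x = g vs x" if "set vs \<subseteq> Basis" "x \<in> S" for vs x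
    using that
  proof (induction vs arbitrary: x)
    case Nil
    then show ?case by (simp add: U_def)
  next
    case (Cons b vs)
    have "iter_deriv (b # vs) U x = dir_deriv b (g vs) x"
      unfolding iter_deriv.simps using Cons by (intro dir_deriv_cong[OF S]) auto
    also have "\<dots> = (\<Sum>c\<in>Basis. (b \<bullet> c) * g (c # vs) x)"
      by (rule dir_deriv_eqI[OF hd]) (use Cons in auto)
    also have "\<dots> = (\<Sum>c\<in>Basis. if c = b then g (c # vs) x else 0)"
      using Cons.prems by (intro sum.cong) (auto simp: inner_Basis)
    also have "\<dots> = g (b # vs) x" using Cons.prems by simp
    finally show ?case .
  qed
  have "smooth_on S U"
    unfolding smooth_on_def U_def using Ck by simp
  moreover have "converges_Cinf_loc S F U at_top"
    unfolding converges_Cinf_loc_def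
  proof (intro allI impI)
    fix K :: "'a set" and vs :: "'a list" assume *: "compact K \<and> K \<subseteq> S \<and> set vs \<subseteq> Basis"
    then have "uniform_limit K (\<lambda>\<mu>. iter_deriv vs (F \<mu>)) (g vs) at_top" by (intro ul) auto
    then show "uniform_limit K (\<lambda>\<mu>. iter_deriv vs (F \<mu>)) (iter_deriv vs U) at_top"
      by (rule uniform_limit_cong'[THEN iffD1, rotated 2]) (use * iter in auto)
  qed
  ultimately show thesis by (rule that)
qed

section \<open>The comparison principle\<close>

text \<open>The speed of a solution is a Lagrangian angle, hence a sum of \<open>n\<close> arctangents.\<close>

lemma flow_time_Lipschitz:
  fixes u :: "(real^'n) \<times> real \<Rightarrow> real"
  assumes cont: "continuous_on (UNIV \<times> {0..}) u" and smooth: "smooth_on spacetime u" and flow: "solves_flow u"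
    and t: "t \<ge> 0"
  shows "\<bar>u (x, t) - u (x, 0)\<bar> \<le> CARD('n) * pi / 2 * t"
proof (cases "t = 0")
  case False
  then have t: "t > 0" using t by simp
  have D: "((\<lambda>s. u (x, s)) has_real_derivative lagrangian_angle (hessian (\<lambda>y. u (y, s)) x)) (at s)" if "s > 0" for s
    using flow that unfolding solves_flow_def by blast
  have "\<exists>l z. 0 < z \<and> z < t \<and> ((\<lambda>s. u (x, s)) has_real_derivative l) (at z) \<and> u (x, t) - u (x, 0) = (t - 0) * l"
  proof (rule MVT[OF t])
    show "continuous_on {0..t} (\<lambda>s. u (x, s))"
      by (rule continuous_on_compose2[OF cont]) (auto intro!: continuous_intros)
    show "(\<lambda>s. u (x, s)) differentiable (at s)" if "0 < s" for s
      using D[OF that] real_differentiable_def by blast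
  qed
  then obtain l z where z: "0 < z" "((\<lambda>s. u (x, s)) has_real_derivative l) (at z)" and eq: "u (x, t) - u (x, 0) = t * l"
    by auto
  have l: "l = lagrangian_angle (hessian (\<lambda>y. u (y, z)) x)"
    by (rule DERIV_unique[OF z(2) D[OF z(1)]])
  have "\<bar>l\<bar> \<le> CARD('n) * pi / 2"
    unfolding l by (rule lagrangian_angle_bound[OF hessian_slice_symmetric[OF smooth z(1)]])
  then have "\<bar>t * l\<bar> \<le> t * (CARD('n) * pi / 2)"
    using t unfolding abs_mult by (intro mult_mono) auto
  then show ?thesis unfolding eq by (simp add: mult.commute)
qed simp

lemma sum_Basis_vec:
  "(\<Sum>b\<in>(Basis :: (real^'n) set). F b) = (\<Sum>i\<in>UNIV. F (axis i 1))"
proof -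
  have B: "(Basis :: (real^'n) set) = range (\<lambda>i. axis i 1)" by (auto simp: Basis_vec_def)
  have inj: "inj (\<lambda>i :: 'n. axis i (1 :: real))" by (simp add: inj_on_def axis_eq_axis)
  show ?thesis unfolding B by (simp only: sum.reindex[OF inj] o_def)
qed

lemma hessian_quadratic_form:
  fixes f :: "real^'n \<Rightarrow> real"
  assumes "Ck_on 2 UNIV f"
  shows "dir_deriv v (dir_deriv v f) x = v \<bullet> (hessian f x *v v)"
proof -
  have df: "f differentiable (at y)" "dir_deriv w f differentiable (at y)" for y w
    using assms by (auto simp: numeral_2_eq_2)
  have "dir_deriv v (dir_deriv v f) x = (\<Sum>b\<in>Basis. (v \<bullet> b) * dir_deriv b (dir_deriv v f) x)"
    by (rule dir_deriv_sum_Basis[OF df(2)])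
  also have "\<dots> = (\<Sum>b\<in>Basis. (v \<bullet> b) * dir_deriv v (dir_deriv b f) x)"
    using dir_deriv_commute[OF open_UNIV assms] by simp
  also have "\<dots> = (\<Sum>b\<in>Basis. (v \<bullet> b) * (\<Sum>c\<in>Basis. (v \<bullet> c) * dir_deriv c (dir_deriv b f) x))"
    by (intro sum.cong refl arg_cong2[of _ _ _ _ "(*)"] dir_deriv_sum_Basis df)
  also have "\<dots> = (\<Sum>j\<in>UNIV. v $ j * (\<Sum>i\<in>UNIV. v $ i * hessian f x $ i $ j))"
    by (simp add: sum_Basis_vec inner_axis hessian_def)
  also have "\<dots> = (\<Sum>j\<in>UNIV. v $ j * (\<Sum>i\<in>UNIV. v $ i * hessian f x $ j $ i))"
    using hessian_symmetric[OF assms, of x] unfolding transpose_eq_iff by simp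
  also have "\<dots> = v \<bullet> (hessian f x *v v)"
    by (simp add: inner_vec_def matrix_vector_mult_def mult.commute)
  finally show ?thesis .
qed

text \<open>The second derivative test on the line through \<open>x\<close> in direction \<open>v\<close>: if the second derivative were
  positive, the function would increase strictly to the right of its maximum.\<close>

lemma hessian_le_at_maximum:
  fixes f g :: "real^'n \<Rightarrow> real" and a :: real
  assumes f: "Ck_on 2 UNIV f" and g: "Ck_on 2 UNIV g"
    and max: "\<And>y. f y - g y - a * (y \<bullet> y) \<le> f x - g x - a * (x \<bullet> x)"
  shows "v \<bullet> (hessian f x *v v) \<le> v \<bullet> (hessian g x *v v) + 2 * a * (v \<bullet> v)"
proof (rule ccontr)
  assume neg: "\<not> ?thesis"
  have df: "f differentiable (at y)" "dir_deriv w f differentiable (at y)"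
    "g differentiable (at y)" "dir_deriv w g differentiable (at y)" for y w
    using f g by (auto simp: numeral_2_eq_2)
  define \<phi> where "\<phi> s = f (x + s *\<^sub>R v) - g (x + s *\<^sub>R v) - a * (x \<bullet> x + 2 * s * (x \<bullet> v) + s\<^sup>2 * (v \<bullet> v))" for s
  define \<psi> where "\<psi> s = dir_deriv v f (x + s *\<^sub>R v) - dir_deriv v g (x + s *\<^sub>R v) - a * (2 * (x \<bullet> v) + 2 * s * (v \<bullet> v))" for s
  have D\<phi>: "(\<phi> has_real_derivative \<psi> s) (at s)" for s
    unfolding \<phi>_def[abs_def] \<psi>_def
    by (rule derivative_eq_intros has_real_derivative_line df refl | simp)+
  have D\<psi>: "(\<psi> has_real_derivative dir_deriv v (dir_deriv v f) (x + s *\<^sub>R v) - dir_deriv v (dir_deriv v g) (x + s *\<^sub>R v) - a * (2 * (v \<bullet> v))) (at s)" for s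
    unfolding \<psi>_def[abs_def]
    by (rule derivative_eq_intros has_real_derivative_line df refl | simp)+
  have max': "\<phi> s \<le> \<phi> 0" for s
    using max[of "x + s *\<^sub>R v"]
    by (simp add: \<phi>_def inner_add_left inner_add_right inner_commute[of v x] power2_eq_square algebra_simps)
  have \<psi>0: "\<psi> 0 = 0"
    by (rule DERIV_local_max[OF D\<phi>, of 1]) (use max' in auto)
  have "dir_deriv v (dir_deriv v f) (x + 0 *\<^sub>R v) - dir_deriv v (dir_deriv v g) (x + 0 *\<^sub>R v) - a * (2 * (v \<bullet> v)) > 0"
    using neg unfolding scaleR_zero_left add_0_right hessian_quadratic_form[OF f] hessian_quadratic_form[OF g] by simp
  from DERIV_pos_inc_right[OF D\<psi> this] obtain d where d: "d > 0" "\<And>h. h > 0 \<Longrightarrow> h < d \<Longrightarrow> \<psi> 0 < \<psi> (0 + h)"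
    by blast
  have "\<exists>z. 0 < z \<and> z < d / 2 \<and> \<phi> (d / 2) - \<phi> 0 = (d / 2 - 0) * \<psi> z"
    by (rule MVT2) (use d D\<phi> in auto)
  then obtain z where "0 < z" "z < d / 2" "\<phi> (d / 2) - \<phi> 0 = d / 2 * \<psi> z" by auto
  moreover from this have "\<psi> z > 0" using d(2)[of z] \<psi>0 by simp
  ultimately have "\<phi> (d / 2) > \<phi> 0" using d(1) by (smt (verit) mult_pos_pos half_gt_zero)
  with max'[of "d / 2"] show False by simp
qed

text \<open>If the estimate fails at time \<open>t\<close>, then \<open>\<phi> = u - v - 2a\<bar>x\<bar>\<^sup>2 - (4n + 1)at - \<delta>\<close> has a positive maximum on
  \<open>\<real>\<^sup>n \<times> [0, t]\<close>: outside a large ball it is nonpositive, because solutions have bounded speed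
  and \<open>2a > a\<close>. The maximum is not attained at time \<open>0\<close>. Where it is attained, \<open>D\<^sup>2u \<le> D\<^sup>2v + 4aI\<close>, so \<open>\<partial>\<^sub>t(u - v) \<le> 4na\<close>, whereas
  \<open>\<partial>\<^sub>t\<phi> \<ge> 0\<close> demands at least \<open>(4n + 1)a\<close>.\<close>

lemma flow_comparison:
  fixes u v :: "(real^'n) \<times> real \<Rightarrow> real" and a \<delta> :: real
  assumes u: "continuous_on (UNIV \<times> {0..}) u" "smooth_on spacetime u" "solves_flow u"
    and v: "continuous_on (UNIV \<times> {0..}) v" "smooth_on spacetime v" "solves_flow v"
    and a: "a > 0" and init: "\<And>x. u (x, 0) - v (x, 0) \<le> a * (x \<bullet> x) + \<delta>"
    and t: "t \<ge> 0"
  shows "u (x, t) - v (x, t) \<le> 2 * a * (x \<bullet> x) + \<delta> + (4 * CARD('n) + 1) * a * t"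
proof (rule ccontr)
  assume neg: "\<not> ?thesis"
  define N where "N = real CARD('n)"
  have N: "N \<ge> 0" by (simp add: N_def)
  define \<phi> where "\<phi> z = u z - v z - 2 * a * (fst z \<bullet> fst z) - (4 * N + 1) * a * snd z - \<delta>" for z
  have pos: "\<phi> (x, t) > 0" using neg by (simp add: \<phi>_def N_def algebra_simps)
  \<comment> \<open>The last term makes \<open>a R \<ge> n \<pi> t\<close>, and \<open>R \<ge> 1\<close> turns this into \<open>a R\<^sup>2 \<ge> n \<pi> t\<close>.\<close>
  define R where "R = norm x + 1 + N * pi * t / a"
  have Nt: "N * pi * t / a \<ge> 0" using N t a by simp
  have R1: "R \<ge> 1" using Nt norm_ge_zero[of x] unfolding R_def by linarith
  have far: "\<phi> (y, s) \<le> 0" if y: "norm y \<ge> R" and s: "0 \<le> s" "s \<le> t" for y s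
  proof -
    have "u (y, s) - v (y, s) \<le> a * (y \<bullet> y) + \<delta> + N * pi * s"
    proof -
      have "\<bar>u (y, s) - u (y, 0)\<bar> \<le> N * pi * s / 2" "\<bar>v (y, s) - v (y, 0)\<bar> \<le> N * pi * s / 2"
        using flow_time_Lipschitz[OF u s(1), of y] flow_time_Lipschitz[OF v s(1), of y] by (simp_all add: N_def)
      then show ?thesis using init[of y] by linarith
    qed
    moreover have "N * pi * s \<le> a * (y \<bullet> y)"
    proof -
      have "N * pi * s \<le> N * pi * t" using s N by (intro mult_left_mono) auto
      also have "\<dots> = a * (N * pi * t / a)" using a by simp
      also have "\<dots> \<le> a * R" using a norm_ge_zero[of x] by (intro mult_left_mono) (auto simp: R_def)
      also have "\<dots> \<le> a * (y \<bullet> y)"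
      proof -
        have "R * 1 \<le> norm y * norm y" using y R1 by (intro mult_mono) auto
        then show ?thesis using a by (intro mult_left_mono) (auto simp: dot_square_norm power2_eq_square)
      qed
      finally show ?thesis .
    qed
    moreover have "(4 * N + 1) * a * s \<ge> 0" using N a s by simp
    ultimately show ?thesis by (simp add: \<phi>_def)
  qed
  have "continuous_on (cball 0 R \<times> {0..t}) \<phi>"
    unfolding \<phi>_def
    by (intro continuous_intros continuous_on_subset[OF u(1)] continuous_on_subset[OF v(1)]) auto
  moreover have "compact (cball 0 R \<times> {0..t} :: ((real^'n) \<times> real) set)"
    by (intro compact_Times) auto
  moreover have xK: "(x, t) \<in> cball 0 R \<times> {0..t}"
    using t Nt by (simp add: R_def)
  ultimately obtain z0 where z0: "z0 \<in> cball 0 R \<times> {0..t}" "\<And>z. z \<in> cball 0 R \<times> {0..t} \<Longrightarrow> \<phi> z \<le> \<phi> z0"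
    using continuous_attains_sup[of "cball 0 R \<times> {0..t}" \<phi>] by (metis empty_iff)
  obtain x0 t0 where z: "z0 = (x0, t0)" by (cases z0)
  have t0: "0 \<le> t0" "t0 \<le> t" using z0(1) z by auto
  have pos0: "\<phi> (x0, t0) > 0" using z0(2)[OF xK] pos z by simp
  have "t0 \<noteq> 0"
  proof
    assume "t0 = 0"
    then have "\<phi> (x0, t0) \<le> - a * (x0 \<bullet> x0)" using init[of x0] by (simp add: \<phi>_def)
    also have "\<dots> \<le> 0" using a by (simp add: mult_nonneg_nonneg)
    finally show False using pos0 by simp
  qed
  then have t0pos: "t0 > 0" using t0 by simp
  have maxx: "\<phi> (y, t0) \<le> \<phi> (x0, t0)" for y
  proof (cases "norm y \<le> R")
    case True then show ?thesis using z0(2)[of "(y, t0)"] t0 z by simp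
  next
    case False then show ?thesis using far[of y t0] t0 pos0 by simp
  qed
  let ?A = "hessian (\<lambda>y. u (y, t0)) x0" and ?B = "hessian (\<lambda>y. v (y, t0)) x0"
  have "w \<bullet> (?A *v w) \<le> w \<bullet> (?B *v w) + 2 * (2 * a) * (w \<bullet> w)" for w
  proof (rule hessian_le_at_maximum)
    show "Ck_on 2 UNIV (\<lambda>y. u (y, t0))" "Ck_on 2 UNIV (\<lambda>y. v (y, t0))"
      using smooth_on_slice[OF u(2) t0pos] smooth_on_slice[OF v(2) t0pos] smooth_on_Ck by blast+
    show "u (y, t0) - v (y, t0) - 2 * a * (y \<bullet> y) \<le> u (x0, t0) - v (x0, t0) - 2 * a * (x0 \<bullet> x0)" for y
      using maxx[of y] by (simp add: \<phi>_def)
  qed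
  then have "lagrangian_angle ?A \<le> lagrangian_angle ?B + N * (2 * (2 * a))"
    unfolding N_def
    by (intro lagrangian_angle_le_shift hessian_slice_symmetric u v t0pos) (use a in auto)
  moreover have "lagrangian_angle ?A - lagrangian_angle ?B - (4 * N + 1) * a \<ge> 0"
  proof (rule ccontr)
    assume "\<not> ?thesis"
    then have l: "lagrangian_angle ?A - lagrangian_angle ?B - (4 * N + 1) * a < 0" by simp
    have "((\<lambda>s. u (x0, s)) has_real_derivative lagrangian_angle ?A) (at t0)"
      "((\<lambda>s. v (x0, s)) has_real_derivative lagrangian_angle ?B) (at t0)"
      using u(3) v(3) t0pos unfolding solves_flow_def by blast+
    then have "((\<lambda>s. \<phi> (x0, s)) has_real_derivative lagrangian_angle ?A - lagrangian_angle ?B - (4 * N + 1) * a) (at t0)"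
      unfolding \<phi>_def by (auto intro!: derivative_eq_intros)
    from DERIV_neg_dec_left[OF this l] obtain d where d: "d > 0" "\<And>h. h > 0 \<Longrightarrow> h < d \<Longrightarrow> \<phi> (x0, t0) < \<phi> (x0, t0 - h)"
      by blast
    define h where "h = min d t0 / 2"
    have h: "h > 0" "h < d" "h \<le> t0" using d(1) t0pos by (auto simp: h_def)
    have "\<phi> (x0, t0 - h) \<le> \<phi> (x0, t0)"
      using z0 z t0 h by auto
    with d(2)[OF h(1,2)] show False by simp
  qed
  ultimately show False using a by (simp add: algebra_simps)
qed

section \<open>Parabolic rescaling\<close>

definition rescale :: "((real^'n) \<times> real \<Rightarrow> real) \<Rightarrow> real \<Rightarrow> (real^'n) \<times> real \<Rightarrow> real" where
  "rescale u \<mu> = (\<lambda>(x, t). u (\<mu> *\<^sub>R x, \<mu>\<^sup>2 * t) / \<mu>\<^sup>2)"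

lemma continuous_on_rescale:
  assumes "continuous_on (UNIV \<times> {0..}) u" "\<mu> > 0"
  shows "continuous_on (UNIV \<times> {0..}) (rescale u \<mu>)"
proof -
  have "continuous_on (UNIV \<times> {0..}) (\<lambda>z. u (\<mu> *\<^sub>R fst z, \<mu>\<^sup>2 * snd z))"
    by (rule continuous_on_compose2[OF assms(1)]) (auto intro!: continuous_intros)
  then show ?thesis unfolding rescale_def split_def using assms(2) by (intro continuous_intros) auto
qed

lemma smooth_on_rescale:
  fixes u :: "(real^'n) \<times> real \<Rightarrow> real"
  assumes "smooth_on spacetime u" "\<mu> > 0"
  shows "smooth_on spacetime (rescale u \<mu>)"
proof -
  have "bounded_linear (\<lambda>z :: (real^'n) \<times> real. (\<mu> *\<^sub>R fst z, \<mu>\<^sup>2 * snd z))"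
    by (intro bounded_linear_intros)
  then have "smooth_on spacetime (\<lambda>z. u (0 + (\<mu> *\<^sub>R fst z, \<mu>\<^sup>2 * snd z)))"
    by (rule smooth_on_affine[OF open_spacetime _ _ assms(1)]) (use assms(2) in auto)
  then have "smooth_on spacetime (\<lambda>z. (1 / \<mu>\<^sup>2) * u (0 + (\<mu> *\<^sub>R fst z, \<mu>\<^sup>2 * snd z)))"
    by (intro smooth_on_mult open_spacetime smooth_on_const)
  then show ?thesis unfolding rescale_def split_def by simp
qed

lemma iter_deriv_rescale_slice:
  fixes u :: "(real^'n) \<times> real \<Rightarrow> real"
  assumes "smooth_on spacetime u" "\<mu> > 0" "t > 0"
  shows "iter_deriv vs (\<lambda>y. rescale u \<mu> (y, t)) x
    = \<mu> ^ length vs / \<mu>\<^sup>2 * iter_deriv vs (\<lambda>y. u (y, \<mu>\<^sup>2 * t)) (\<mu> *\<^sub>R x)"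
proof -
  have sm: "smooth_on UNIV (\<lambda>y. u (y, \<mu>\<^sup>2 * t))"
    using assms by (intro smooth_on_slice) auto
  have L: "bounded_linear (\<lambda>y :: real^'n. \<mu> *\<^sub>R y)" by (rule bounded_linear_scaleR_right)
  have "(\<lambda>y. rescale u \<mu> (y, t)) = (\<lambda>y. (1 / \<mu>\<^sup>2) * u (\<mu> *\<^sub>R y, \<mu>\<^sup>2 * t))"
    by (simp add: rescale_def)
  moreover have "smooth_on UNIV (\<lambda>y. u (\<mu> *\<^sub>R y, \<mu>\<^sup>2 * t))"
    using smooth_on_affine[OF open_UNIV L _ sm, of 0] by simp
  ultimately have "iter_deriv vs (\<lambda>y. rescale u \<mu> (y, t)) x = (1 / \<mu>\<^sup>2) * iter_deriv vs (\<lambda>y. u (\<mu> *\<^sub>R y, \<mu>\<^sup>2 * t)) x"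
    by (simp only: iter_deriv_cmult[OF open_UNIV _ UNIV_I])
  also have "iter_deriv vs (\<lambda>y. u (\<mu> *\<^sub>R y, \<mu>\<^sup>2 * t)) x = iter_deriv (map ((*\<^sub>R) \<mu>) vs) (\<lambda>y. u (y, \<mu>\<^sup>2 * t)) (\<mu> *\<^sub>R x)"
    using iter_deriv_affine[OF open_UNIV L _ sm UNIV_I, of 0 vs x] by simp
  also have "\<dots> = \<mu> ^ length vs * iter_deriv vs (\<lambda>y. u (y, \<mu>\<^sup>2 * t)) (\<mu> *\<^sub>R x)"
    by (rule iter_deriv_scaled_directions[OF open_UNIV sm UNIV_I])
  finally show ?thesis by simp
qed

lemma hessian_rescale:
  fixes u :: "(real^'n) \<times> real \<Rightarrow> real"
  assumes "smooth_on spacetime u" "\<mu> > 0" "t > 0"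
  shows "hessian (\<lambda>y. rescale u \<mu> (y, t)) x = hessian (\<lambda>y. u (y, \<mu>\<^sup>2 * t)) (\<mu> *\<^sub>R x)"
  unfolding hessian_def iter_deriv_rescale_slice[OF assms] using assms(2) by (simp add: power2_eq_square del: iter_deriv.simps)

lemma solves_flow_rescale:
  fixes u :: "(real^'n) \<times> real \<Rightarrow> real"
  assumes "smooth_on spacetime u" "solves_flow u" "\<mu> > 0"
  shows "solves_flow (rescale u \<mu>)"
  unfolding solves_flow_def
proof (intro allI impI)
  fix x :: "real^'n" and t :: real assume t: "t > 0"
  have "((\<lambda>s. u (\<mu> *\<^sub>R x, s)) has_real_derivative lagrangian_angle (hessian (\<lambda>y. u (y, \<mu>\<^sup>2 * t)) (\<mu> *\<^sub>R x))) (at (\<mu>\<^sup>2 * t))"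
    using assms t unfolding solves_flow_def by simp
  moreover have "((\<lambda>s. \<mu>\<^sup>2 * s) has_real_derivative \<mu>\<^sup>2) (at t)"
    by (auto intro!: derivative_eq_intros)
  ultimately have "((\<lambda>s. u (\<mu> *\<^sub>R x, \<mu>\<^sup>2 * s)) has_real_derivative lagrangian_angle (hessian (\<lambda>y. u (y, \<mu>\<^sup>2 * t)) (\<mu> *\<^sub>R x)) * \<mu>\<^sup>2) (at t)"
    by (rule DERIV_chain2)
  from DERIV_cdivide[OF this, of "\<mu>\<^sup>2"]
  show "((\<lambda>s. rescale u \<mu> (x, s)) has_real_derivative lagrangian_angle (hessian (\<lambda>y. rescale u \<mu> (y, t)) x)) (at t)"
    unfolding hessian_rescale[OF assms(1,3) t] using assms(3) by (simp add: rescale_def)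
qed

text \<open>Rescaling multiplies the square of an \<open>l\<close>-th spatial derivative by \<open>\<mu>\<^bsup>2l-4\<^esup>\<close>, and the bound at time
  \<open>\<mu>\<^sup>2t\<close> carries the inverse factor. On a compact set \<open>t\<close> is bounded away from \<open>0\<close>.\<close>

lemma rescale_spatial_derivs_bounded:
  fixes u :: "(real^'n) \<times> real \<Rightarrow> real"
  assumes smooth: "smooth_on spacetime u"
    and bound: "\<forall>l\<ge>2. \<exists>c_l>0. \<forall>t>0. \<forall>x. deriv_norm_sq l (\<lambda>y. u (y, t)) x \<le> c_l * t powi (2 - int l)"
    and ws: "set ws \<subseteq> (\<lambda>b. (b, 0)) ` Basis" "2 \<le> length ws"
  shows "loc_bounded {0<..} spacetime (\<lambda>\<mu>. iter_deriv ws (rescale u \<mu>))"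
  unfolding loc_bounded_def
proof (intro allI impI)
  fix K :: "((real^'n) \<times> real) set" assume K: "compact K \<and> K \<subseteq> spacetime"
  define vs where "vs = map fst ws"
  have ws_eq: "ws = map (\<lambda>v. (v, 0)) vs"
    unfolding vs_def map_map using ws(1) by (intro map_idI[symmetric]) auto
  have vs: "set vs \<subseteq> Basis" unfolding vs_def using ws(1) by auto
  obtain k where k: "length vs = k + 2" using ws(2) le_Suc_ex[of 2 "length ws"] by (auto simp: vs_def)
  obtain c where c: "c > 0" "\<And>t x. t > 0 \<Longrightarrow> deriv_norm_sq (k + 2) (\<lambda>y. u (y, t)) x \<le> c * inverse (t ^ k)"
    using bound[rule_format, of "k + 2"] by (auto simp: power_int_minus)
  have est: "(iter_deriv ws (rescale u \<mu>) (x, t))\<^sup>2 \<le> c * inverse (t ^ k)" if \<mu>: "\<mu> > 0" and t: "t > 0" for \<mu> x t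
  proof -
    have "iter_deriv ws (rescale u \<mu>) (x, t) = iter_deriv vs (\<lambda>y. rescale u \<mu> (y, t)) x"
      unfolding ws_eq by (rule iter_deriv_slice[OF smooth_on_rescale[OF smooth \<mu>] t, symmetric])
    also have "\<dots> = \<mu> ^ k * iter_deriv vs (\<lambda>y. u (y, \<mu>\<^sup>2 * t)) (\<mu> *\<^sub>R x)"
      unfolding iter_deriv_rescale_slice[OF smooth \<mu> t] k power_add using \<mu> by simp
    finally have "(iter_deriv ws (rescale u \<mu>) (x, t))\<^sup>2 = (\<mu>\<^sup>2) ^ k * (iter_deriv vs (\<lambda>y. u (y, \<mu>\<^sup>2 * t)) (\<mu> *\<^sub>R x))\<^sup>2"
      by (simp add: power_mult_distrib power_mult[symmetric] mult.commute)
    also have "(iter_deriv vs (\<lambda>y. u (y, \<mu>\<^sup>2 * t)) (\<mu> *\<^sub>R x))\<^sup>2 \<le> deriv_norm_sq (k + 2) (\<lambda>y. u (y, \<mu>\<^sup>2 * t)) (\<mu> *\<^sub>R x)"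
      unfolding deriv_norm_sq_def
      using vs k finite_lists_length_eq[OF finite_Basis, of "k + 2"]
      by (intro member_le_sum[of vs _ "\<lambda>vs. (iter_deriv vs (\<lambda>y. u (y, \<mu>\<^sup>2 * t)) (\<mu> *\<^sub>R x))\<^sup>2"]) auto
    also have "\<dots> \<le> c * inverse ((\<mu>\<^sup>2 * t) ^ k)" using \<mu> t by (intro c) auto
    finally have "(iter_deriv ws (rescale u \<mu>) (x, t))\<^sup>2 \<le> (\<mu>\<^sup>2) ^ k * (c * inverse ((\<mu>\<^sup>2 * t) ^ k))"
      using \<mu> by simp
    also have "\<dots> = c * inverse (t ^ k)" using \<mu> by (simp add: power_mult_distrib)
    finally show ?thesis .
  qed
  show "\<exists>C. \<forall>\<mu>\<in>{0<..}. \<forall>z\<in>K. \<bar>iter_deriv ws (rescale u \<mu>) z\<bar> \<le> C"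
  proof (cases "K = {}")
    case False
    have "continuous_on K snd" by (rule continuous_on_snd[OF continuous_on_id])
    then have "\<exists>z0\<in>K. \<forall>z\<in>K. snd z0 \<le> snd z"
      using K False by (intro continuous_attains_inf) auto
    then obtain z0 where z0: "z0 \<in> K" "\<And>z. z \<in> K \<Longrightarrow> snd z0 \<le> snd z" by blast
    have pos: "snd z0 > 0" using z0(1) K by auto
    have "\<bar>iter_deriv ws (rescale u \<mu>) z\<bar> \<le> sqrt (c * inverse (snd z0 ^ k))" if "\<mu> > 0" "z \<in> K" for \<mu> z
    proof -
      have "(iter_deriv ws (rescale u \<mu>) z)\<^sup>2 \<le> c * inverse (snd z ^ k)"
        using est[of \<mu> "snd z" "fst z"] that K by auto
      also have "\<dots> \<le> c * inverse (snd z0 ^ k)"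
        using c(1) pos z0(2)[OF that(2)] by (intro mult_left_mono le_imp_inverse_le power_mono) auto
      finally show ?thesis by (metis real_sqrt_abs real_sqrt_le_iff)
    qed
    then show ?thesis by (intro exI[of _ "sqrt (c * inverse (snd z0 ^ k))"]) simp
  qed auto
qed

section \<open>Convergence of the rescaled initial data\<close>

lemma Lipschitz_of_partial_bounds:
  fixes f :: "'a::euclidean_space \<Rightarrow> real"
  assumes "convex S" "\<And>x. x \<in> S \<Longrightarrow> f differentiable (at x)"
    and "\<And>x b. x \<in> S \<Longrightarrow> b \<in> Basis \<Longrightarrow> \<bar>dir_deriv b f x\<bar> \<le> M"
    and "y \<in> S" "z \<in> S"
  shows "\<bar>f y - f z\<bar> \<le> real DIM('a) * M * norm (y - z)"
proof -
  have "norm (f y - f z) \<le> real DIM('a) * M * norm (y - z)"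
  proof (rule differentiable_bound[OF assms(1)])
    fix x assume x: "x \<in> S"
    show "(f has_derivative frechet_derivative f (at x)) (at x within S)"
      using assms(2)[OF x] by (auto simp: frechet_derivative_works intro: has_derivative_at_withinI)
    show "onorm (frechet_derivative f (at x)) \<le> real DIM('a) * M"
    proof (rule onorm_le)
      fix v
      have "norm (dir_deriv v f x) = \<bar>\<Sum>b\<in>Basis. (v \<bullet> b) * dir_deriv b f x\<bar>"
        by (simp add: dir_deriv_sum_Basis[OF assms(2)[OF x], of v])
      also have "\<dots> \<le> (\<Sum>b\<in>(Basis::'a set). norm v * M)"
        unfolding abs_mult[symmetric]
        by (intro order.trans[OF sum_abs] sum_mono) (auto simp: abs_mult intro!: mult_mono Basis_le_norm assms(3)[OF x])
      finally show "norm (dir_deriv v f x) \<le> real DIM('a) * M * norm v" by (simp add: mult.commute mult.left_commute)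
    qed
  qed (use assms in auto)
  then show ?thesis by simp
qed

text \<open>Integrate twice: a bounded Hessian makes the first derivatives grow at most linearly.\<close>

lemma bounded_hessian_growth:
  fixes f :: "'a::euclidean_space \<Rightarrow> real"
  assumes f: "Ck_on 2 UNIV f" and c: "\<And>x. deriv_norm_sq 2 f x \<le> c"
  obtains C where "C \<ge> 0" "\<And>R y z. norm y \<le> R \<Longrightarrow> norm z \<le> R \<Longrightarrow> \<bar>f y - f z\<bar> \<le> C * (1 + R) * norm (y - z)"
proof -
  define N where "N = real DIM('a)"
  define G where "G = (\<Sum>b\<in>(Basis::'a set). \<bar>dir_deriv b f 0\<bar>)"
  have df: "f differentiable (at y)" "dir_deriv w f differentiable (at y)" for y w
    using f by (auto simp: numeral_2_eq_2)
  have second: "\<bar>dir_deriv a (dir_deriv b f) x\<bar> \<le> sqrt c" if "a \<in> Basis" "b \<in> Basis" for a b x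
  proof -
    have "(iter_deriv [a, b] f x)\<^sup>2 \<le> deriv_norm_sq 2 f x"
      unfolding deriv_norm_sq_def
      using that finite_lists_length_eq[OF finite_Basis, of 2]
      by (intro member_le_sum[of "[a, b]" _ "\<lambda>vs. (iter_deriv vs f x)\<^sup>2"]) auto
    then have "(dir_deriv a (dir_deriv b f) x)\<^sup>2 \<le> c" using c[of x] by simp
    then show ?thesis by (metis real_sqrt_abs real_sqrt_le_iff)
  qed
  have c0: "c \<ge> 0"
    using c[of 0] by (intro order.trans[OF _ c[of 0]]) (simp add: deriv_norm_sq_def sum_nonneg)
  have first: "\<bar>dir_deriv b f x\<bar> \<le> G + N * sqrt c * R" if b: "b \<in> Basis" and "norm x \<le> R" for b x R
  proof -
    have "\<bar>dir_deriv b f x - dir_deriv b f 0\<bar> \<le> N * sqrt c * norm (x - 0)"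
      unfolding N_def by (rule Lipschitz_of_partial_bounds[of UNIV]) (use df second b in auto)
    moreover have "N * sqrt c * norm x \<le> N * sqrt c * R"
      using that c0 by (intro mult_left_mono) (auto simp: N_def)
    moreover have "\<bar>dir_deriv b f 0\<bar> \<le> G"
      unfolding G_def using b by (intro member_le_sum) auto
    ultimately show ?thesis by simp
  qed
  have G: "G \<ge> 0" unfolding G_def by (simp add: sum_nonneg)
  have Nc: "N * sqrt c \<ge> 0" using c0 by (simp add: N_def)
  show thesis
  proof (rule that[of "N * (G + N * sqrt c)"])
    show "N * (G + N * sqrt c) \<ge> 0" using G Nc by (simp add: N_def)
    fix R :: real and y z :: 'a assume yz: "norm y \<le> R" "norm z \<le> R"
    then have R: "R \<ge> 0" using norm_ge_zero order.trans by blast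
    have "\<bar>f y - f z\<bar> \<le> N * (G + N * sqrt c * R) * norm (y - z)"
      unfolding N_def
      by (rule Lipschitz_of_partial_bounds[of "cball 0 R"]) (use df first yz in \<open>auto simp: N_def\<close>)
    also have "\<dots> \<le> N * ((G + N * sqrt c) * (1 + R)) * norm (y - z)"
    proof (intro mult_right_mono mult_left_mono)
      have "G + N * sqrt c * R \<le> G + N * sqrt c * R + G * R + N * sqrt c" using mult_nonneg_nonneg[OF G R] Nc by linarith
      also have "\<dots> = (G + N * sqrt c) * (1 + R)" by (simp add: algebra_simps)
      finally show "G + N * sqrt c * R \<le> (G + N * sqrt c) * (1 + R)" .
    qed (auto simp: N_def)
    finally show "\<bar>f y - f z\<bar> \<le> N * (G + N * sqrt c) * (1 + R) * norm (y - z)" by (simp add: mult.assoc)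
  qed
qed

text \<open>For \<open>\<mu> \<ge> 1\<close> the functions \<open>g \<mu> x = f (\<mu>x)/\<mu>\<^sup>2\<close> are equi-Lipschitz on the unit ball, so they converge
  uniformly on the unit sphere. The identity \<open>g \<mu> x = \<bar>x\<bar>\<^sup>2 g (\<mu>\<bar>x\<bar>) (x/\<bar>x\<bar>)\<close> carries this to all \<open>x\<close> for which
  \<open>\<mu>\<bar>x\<bar>\<close> is large, with an error proportional to \<open>\<bar>x\<bar>\<^sup>2\<close>. The remaining \<open>x\<close> are of size \<open>O(1/\<mu>)\<close>, where
  quadratic growth of \<open>f\<close> makes \<open>g \<mu> x\<close> itself small.\<close>

lemma rescaled_data_Cauchy:
  fixes f :: "'a::euclidean_space \<Rightarrow> real"
  assumes C: "C \<ge> 0" "\<And>R y z. norm y \<le> R \<Longrightarrow> norm z \<le> R \<Longrightarrow> \<bar>f y - f z\<bar> \<le> C * (1 + R) * norm (y - z)"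
    and lim: "\<And>x. ((\<lambda>\<mu>. f (\<mu> *\<^sub>R x) / \<mu>\<^sup>2) \<longlongrightarrow> F x) at_top"
    and pos: "\<epsilon> > 0" "\<delta> > 0"
  obtains M where "M \<ge> 1" "\<And>\<mu> \<nu> x. \<mu> \<ge> M \<Longrightarrow> \<nu> \<ge> M \<Longrightarrow>
    \<bar>f (\<mu> *\<^sub>R x) / \<mu>\<^sup>2 - f (\<nu> *\<^sub>R x) / \<nu>\<^sup>2\<bar> \<le> \<epsilon> * (x \<bullet> x) + \<delta>"
proof -
  define g where "g \<mu> x = f (\<mu> *\<^sub>R x) / \<mu>\<^sup>2" for \<mu> x
  have Lip: "\<bar>g \<mu> x - g \<mu> z\<bar> \<le> 2 * C * norm (x - z)" if "\<mu> \<ge> 1" "norm x \<le> 1" "norm z \<le> 1" for \<mu> x z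
  proof -
    have "\<bar>f (\<mu> *\<^sub>R x) - f (\<mu> *\<^sub>R z)\<bar> \<le> C * (1 + \<mu>) * norm (\<mu> *\<^sub>R x - \<mu> *\<^sub>R z)"
      using that by (intro C(2)) (auto simp: mult_le_cancel_left2)
    also have "norm (\<mu> *\<^sub>R x - \<mu> *\<^sub>R z) = \<mu> * norm (x - z)"
      using that by (simp add: scaleR_diff_right[symmetric])
    also have "C * (1 + \<mu>) * (\<mu> * norm (x - z)) \<le> C * (2 * \<mu>) * (\<mu> * norm (x - z))"
      using that C(1) by (intro mult_right_mono mult_left_mono) auto
    finally have "\<bar>f (\<mu> *\<^sub>R x) - f (\<mu> *\<^sub>R z)\<bar> \<le> (2 * C * norm (x - z)) * \<mu>\<^sup>2"
      by (simp add: power2_eq_square mult_ac)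
    then have "\<bar>f (\<mu> *\<^sub>R x) - f (\<mu> *\<^sub>R z)\<bar> / \<mu>\<^sup>2 \<le> 2 * C * norm (x - z)"
      using that by (simp add: divide_le_eq)
    then show ?thesis by (simp add: g_def diff_divide_distrib[symmetric])
  qed
  \<comment> \<open>The mesh of a finite net of the sphere; moving to the net costs \<open>\<epsilon> / 4\<close> for each parameter.\<close>
  define \<eta> where "\<eta> = \<epsilon> / (8 * C + 1)"
  have \<eta>: "\<eta> > 0" using pos C(1) by (simp add: \<eta>_def)
  have C\<eta>: "2 * C * \<eta> \<le> \<epsilon> / 4" using pos C(1) by (simp add: \<eta>_def field_simps)
  have "compact (sphere (0::'a) 1)" by simp
  then obtain X where X: "finite X" "X \<subseteq> sphere (0::'a) 1" "sphere 0 1 \<subseteq> (\<Union>x\<in>X. ball x \<eta>)"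
    using compactE_image[of "sphere (0::'a) 1" "sphere 0 1" "\<lambda>x. ball x \<eta>"] \<eta> by (metis (no_types, lifting) UN_I centre_in_ball open_ball subsetI)
  have "\<forall>\<^sub>F \<mu> in at_top. \<forall>x\<in>X. \<bar>g \<mu> x - F x\<bar> < \<epsilon> / 4"
    using X(1)
  proof (rule eventually_ball_finite, intro ballI)
    fix x
    show "\<forall>\<^sub>F \<mu> in at_top. \<bar>g \<mu> x - F x\<bar> < \<epsilon> / 4"
      using tendstoD[OF lim[of x], of "\<epsilon> / 4"] pos by (simp add: g_def dist_real_def)
  qed
  then obtain M1 where M1: "\<And>\<mu> x. \<mu> \<ge> M1 \<Longrightarrow> x \<in> X \<Longrightarrow> \<bar>g \<mu> x - F x\<bar> < \<epsilon> / 4"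
    unfolding eventually_at_top_linorder by blast
  define M0 where "M0 = max M1 1"
  have sphere: "\<bar>g \<mu> x - g \<nu> x\<bar> \<le> \<epsilon>" if \<mu>: "\<mu> \<ge> M0" and \<nu>: "\<nu> \<ge> M0" and x: "norm x = 1" for \<mu> \<nu> x
  proof -
    obtain z where z: "z \<in> X" "norm (x - z) \<le> \<eta>"
      using X(3) x by (force simp: dist_norm norm_minus_commute)
    have z1: "norm z = 1" using X(2) z by auto
    have "2 * C * norm (x - z) \<le> 2 * C * \<eta>" using z C(1) by (intro mult_left_mono) auto
    then have "\<bar>g \<mu> x - g \<mu> z\<bar> \<le> \<epsilon> / 4" "\<bar>g \<nu> x - g \<nu> z\<bar> \<le> \<epsilon> / 4"
      using Lip[of \<mu> x z] Lip[of \<nu> x z] \<mu> \<nu> x z1 C\<eta> by (auto simp: M0_def)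
    moreover have "\<bar>g \<mu> z - F z\<bar> < \<epsilon> / 4" "\<bar>g \<nu> z - F z\<bar> < \<epsilon> / 4"
      using M1 z \<mu> \<nu> by (auto simp: M0_def)
    ultimately show ?thesis by linarith
  qed
  define B where "B = \<bar>f 0\<bar> + 2 * C"
  have B: "B \<ge> 0" using C(1) by (simp add: B_def)
  have growth: "\<bar>f y\<bar> \<le> B * (1 + (norm y)\<^sup>2)" for y
  proof -
    have "\<bar>f y - f 0\<bar> \<le> C * (1 + norm y) * norm y" using C(2)[of y "norm y" 0] by simp
    also have "\<dots> \<le> C * (2 * (1 + (norm y)\<^sup>2))"
    proof -
      have "0 \<le> (norm y - 1)\<^sup>2" by simp
      then have "2 * norm y \<le> 1 + (norm y)\<^sup>2" by (simp add: power2_eq_square algebra_simps)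
      then have "norm y + (norm y)\<^sup>2 \<le> 2 + 2 * (norm y)\<^sup>2"
        using zero_le_power2[of "norm y"] by linarith
      moreover have "(1 + norm y) * norm y = norm y + (norm y)\<^sup>2" by (simp add: power2_eq_square algebra_simps)
      ultimately have "(1 + norm y) * norm y \<le> 2 * (1 + (norm y)\<^sup>2)" by simp
      then show ?thesis using C(1) unfolding mult.assoc by (rule mult_left_mono)
    qed
    finally have "\<bar>f y - f 0\<bar> \<le> 2 * C * (1 + (norm y)\<^sup>2)" by (simp add: mult_ac)
    then have "\<bar>f y\<bar> \<le> \<bar>f 0\<bar> + 2 * C * (1 + (norm y)\<^sup>2)" by linarith
    also have "\<dots> \<le> B * (1 + (norm y)\<^sup>2)"
      unfolding B_def by (simp add: algebra_simps)
    finally show ?thesis .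
  qed
  \<comment> \<open>As \<open>M \<ge> 1\<close>, the second term gives \<open>B (1 + M0\<^sup>2) / m\<^sup>2 \<le> \<delta> / 2\<close> for all \<open>m \<ge> M\<close>.\<close>
  define M where "M = max M0 (2 * B * (1 + M0\<^sup>2) / \<delta>)"
  have "2 * B * (1 + M0\<^sup>2) / \<delta> \<le> M" by (simp add: M_def)
  then have "2 * B * (1 + M0\<^sup>2) \<le> \<delta> * M"
    unfolding pos_divide_le_eq[OF pos(2)] by (simp only: mult.commute)
  moreover have "M \<ge> M0" "M \<ge> 1" by (auto simp: M_def M0_def)
  ultimately have M: "M \<ge> M0" "M \<ge> 1" "2 * B * (1 + M0\<^sup>2) \<le> \<delta> * M" by auto
  have small: "\<bar>g \<kappa> x\<bar> \<le> \<delta> / 2" if m: "\<kappa> \<ge> m" "m \<ge> M" and x: "m * norm x \<le> M0" for \<kappa> m x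
  proof -
    have m1: "m \<ge> 1" using m M by simp
    have \<kappa>1: "\<kappa> \<ge> 1" using m m1 by simp
    have "\<bar>g \<kappa> x\<bar> \<le> B * (1 + (norm (\<kappa> *\<^sub>R x))\<^sup>2) / \<kappa>\<^sup>2"
      unfolding g_def abs_divide using growth[of "\<kappa> *\<^sub>R x"] by (simp add: divide_right_mono)
    also have "\<dots> = B * (1 / \<kappa>\<^sup>2 + (norm x)\<^sup>2)"
      using \<kappa>1 by (simp add: power_mult_distrib field_simps)
    also have "\<dots> \<le> B * (1 / m\<^sup>2 + M0\<^sup>2 / m\<^sup>2)"
    proof (intro mult_left_mono add_mono B)
      show "1 / \<kappa>\<^sup>2 \<le> 1 / m\<^sup>2" using m m1 by (intro divide_left_mono power_mono) auto
      have "norm x \<le> M0 / m" using x m1 by (simp add: pos_le_divide_eq mult.commute)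
      then have "(norm x)\<^sup>2 \<le> (M0 / m)\<^sup>2" by (intro power_mono) auto
      then show "(norm x)\<^sup>2 \<le> M0\<^sup>2 / m\<^sup>2" by (simp add: power_divide)
    qed
    also have "\<dots> = (2 * B * (1 + M0\<^sup>2)) / (2 * m\<^sup>2)" using m1 by (simp add: field_simps)
    also have "\<dots> \<le> \<delta> * m\<^sup>2 / (2 * m\<^sup>2)"
    proof (rule divide_right_mono)
      have "2 * B * (1 + M0\<^sup>2) \<le> \<delta> * M" by (rule M(3))
      also have "\<dots> \<le> \<delta> * m\<^sup>2"
        using m m1 pos self_le_power[of m 2] by (intro mult_left_mono) auto
      finally show "2 * B * (1 + M0\<^sup>2) \<le> \<delta> * m\<^sup>2" .
    qed simp
    also have "\<dots> = \<delta> / 2" using m1 by simp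
    finally show ?thesis .
  qed
  show thesis
  proof (rule that[OF M(2)])
    fix \<mu> \<nu> x assume \<mu>\<nu>: "\<mu> \<ge> M" "\<nu> \<ge> M"
    define m where "m = min \<mu> \<nu>"
    have m: "m \<ge> M" "\<mu> \<ge> m" "\<nu> \<ge> m" using \<mu>\<nu> by (auto simp: m_def)
    have "\<bar>g \<mu> x - g \<nu> x\<bar> \<le> \<epsilon> * (x \<bullet> x) + \<delta>"
    proof (cases "m * norm x \<le> M0")
      case True
      have "\<bar>g \<mu> x\<bar> \<le> \<delta> / 2" "\<bar>g \<nu> x\<bar> \<le> \<delta> / 2"
        using small[OF m(2,1) True] small[OF m(3,1) True] .
      moreover have "\<epsilon> * (x \<bullet> x) \<ge> 0" using pos by simp
      ultimately show ?thesis by linarith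
    next
      case False
      have r: "norm x > 0"
        using False M by (cases "norm x = 0") (auto simp: M0_def)
      define y where "y = (1 / norm x) *\<^sub>R x"
      have y: "norm y = 1" "x = norm x *\<^sub>R y" using r by (auto simp: y_def)
      have hom: "g \<kappa> x = (norm x)\<^sup>2 * g (\<kappa> * norm x) y" for \<kappa>
      proof -
        have "(\<kappa> * norm x) *\<^sub>R y = \<kappa> *\<^sub>R x" using r by (simp add: y_def)
        then show ?thesis using r by (simp add: g_def power_mult_distrib)
      qed
      have "m * norm x \<le> \<mu> * norm x" "m * norm x \<le> \<nu> * norm x" using m by (auto intro: mult_right_mono)
      then have "\<bar>g (\<mu> * norm x) y - g (\<nu> * norm x) y\<bar> \<le> \<epsilon>"
        using False by (intro sphere y) auto
      then have "(norm x)\<^sup>2 * \<bar>g (\<mu> * norm x) y - g (\<nu> * norm x) y\<bar> \<le> (norm x)\<^sup>2 * \<epsilon>"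
        by (intro mult_left_mono) auto
      then have "\<bar>g \<mu> x - g \<nu> x\<bar> \<le> \<epsilon> * (x \<bullet> x)"
        unfolding hom[of \<mu>] hom[of \<nu>] right_diff_distrib[symmetric] abs_mult
        by (simp add: dot_square_norm mult.commute)
      then show ?thesis using pos by simp
    qed
    then show "\<bar>f (\<mu> *\<^sub>R x) / \<mu>\<^sup>2 - f (\<nu> *\<^sub>R x) / \<nu>\<^sup>2\<bar> \<le> \<epsilon> * (x \<bullet> x) + \<delta>"
      by (simp add: g_def)
  qed
qed

section \<open>Convergence of the rescaled solutions\<close>

lemma rescale_loc_unif_Cauchy:
  fixes u :: "(real^'n) \<times> real \<Rightarrow> real"
  assumes u: "continuous_on (UNIV \<times> {0..}) u" "smooth_on spacetime u" "solves_flow u"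
    and C: "C \<ge> 0" "\<And>R y z. norm y \<le> R \<Longrightarrow> norm z \<le> R \<Longrightarrow> \<bar>u (y, 0) - u (z, 0)\<bar> \<le> C * (1 + R) * norm (y - z)"
    and lim: "\<And>x. ((\<lambda>\<mu>. u (\<mu> *\<^sub>R x, 0) / \<mu>\<^sup>2) \<longlongrightarrow> U0 x) at_top"
  shows "loc_unif_Cauchy spacetime (rescale u)"
  unfolding loc_unif_Cauchy_def
proof (intro allI impI)
  fix K :: "((real^'n) \<times> real) set" and e :: real
  assume asm: "compact K \<and> K \<subseteq> spacetime \<and> e > 0"
  then obtain B where B: "B > 0" "\<And>z. z \<in> K \<Longrightarrow> norm z \<le> B"
    using compact_imp_bounded bounded_pos by metis
  define N where "N = real CARD('n)"
  \<comment> \<open>On \<open>K\<close> the comparison estimate is at most \<open>a q + \<delta>\<close>.\<close>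
  define q where "q = 2 * B\<^sup>2 + (1 + 4 * N) * B"
  define a where "a = e / (2 * q)"
  have q: "q > 0" unfolding q_def N_def using B(1) by (intro add_pos_pos mult_pos_pos) auto
  have a: "a > 0" using asm q by (simp add: a_def)
  obtain M where M: "M \<ge> 1" "\<And>\<mu> \<nu> x. \<mu> \<ge> M \<Longrightarrow> \<nu> \<ge> M \<Longrightarrow>
      \<bar>u (\<mu> *\<^sub>R x, 0) / \<mu>\<^sup>2 - u (\<nu> *\<^sub>R x, 0) / \<nu>\<^sup>2\<bar> \<le> a * (x \<bullet> x) + e / 2"
    using rescaled_data_Cauchy[of C "\<lambda>x. u (x, 0)" U0 a "e / 2", OF C lim a] asm by auto
  have le: "rescale u \<mu> (x, t) - rescale u \<nu> (x, t) \<le> e" if "\<mu> \<ge> M" "\<nu> \<ge> M" "(x, t) \<in> K" for \<mu> \<nu> x t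
  proof -
    have pos: "\<mu> > 0" "\<nu> > 0" using that M(1) by auto
    have t: "t \<ge> 0" using that(3) asm by auto
    have tB: "t \<le> B" using B(2)[OF that(3)] norm_snd_le[of t x] t by simp
    have "norm x \<le> B" using B(2)[OF that(3)] norm_fst_le[of x t] by simp
    then have xB: "x \<bullet> x \<le> B\<^sup>2" unfolding dot_square_norm by (intro power_mono) auto
    have "rescale u \<mu> (x, t) - rescale u \<nu> (x, t) \<le> 2 * a * (x \<bullet> x) + e / 2 + (4 * CARD('n) + 1) * a * t"
    proof (rule flow_comparison[OF _ _ _ _ _ _ a _ t])
      show "rescale u \<mu> (y, 0) - rescale u \<nu> (y, 0) \<le> a * (y \<bullet> y) + e / 2" for y
        using M(2)[OF that(1,2), of y] by (simp add: rescale_def abs_le_iff)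
    qed (intro continuous_on_rescale smooth_on_rescale solves_flow_rescale u pos)+
    then have "rescale u \<mu> (x, t) - rescale u \<nu> (x, t) \<le> 2 * a * (x \<bullet> x) + e / 2 + (1 + 4 * N) * a * t"
      by (simp add: N_def)
    also have "\<dots> \<le> 2 * a * B\<^sup>2 + e / 2 + (1 + 4 * N) * a * B"
      using a xB tB by (intro add_mono mult_left_mono) (auto simp: N_def)
    also have "\<dots> = a * q + e / 2" by (simp add: q_def algebra_simps)
    also have "\<dots> = e" using q by (simp add: a_def)
    finally show ?thesis .
  qed
  show "\<exists>M. \<forall>\<mu>\<ge>M. \<forall>\<nu>\<ge>M. \<forall>z\<in>K. \<bar>rescale u \<mu> z - rescale u \<nu> z\<bar> \<le> e"
  proof (intro exI[of _ M] allI impI ballI)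
    fix \<mu> \<nu> z assume *: "M \<le> \<mu>" "M \<le> \<nu>" "z \<in> K"
    obtain x t where "z = (x, t)" by (cases z)
    then show "\<bar>rescale u \<mu> z - rescale u \<nu> z\<bar> \<le> e"
      using le[of \<mu> \<nu> x t] le[of \<nu> \<mu> x t] * by (simp add: abs_le_iff)
  qed
qed

text \<open>Both sides of the equation converge: the time derivative by assumption, and the Lagrangian angle
  because it is Lipschitz in the entries of the Hessian.\<close>

lemma solves_flow_limit:
  fixes F :: "real \<Rightarrow> (real^'n) \<times> real \<Rightarrow> real"
  assumes F: "\<And>\<mu>. \<mu> > 0 \<Longrightarrow> smooth_on spacetime (F \<mu>)" "\<And>\<mu>. \<mu> > 0 \<Longrightarrow> solves_flow (F \<mu>)"
    and U: "smooth_on spacetime U"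
    and lim: "\<And>vs z. set vs \<subseteq> Basis \<Longrightarrow> z \<in> spacetime \<Longrightarrow>
      ((\<lambda>\<mu>. iter_deriv vs (F \<mu>) z) \<longlongrightarrow> iter_deriv vs U z) at_top"
  shows "solves_flow U"
  unfolding solves_flow_def
proof (intro allI impI)
  fix x :: "real^'n" and t :: real assume t: "t > 0"
  let ?A = "\<lambda>\<mu>. hessian (\<lambda>y. F \<mu> (y, t)) x" and ?B = "hessian (\<lambda>y. U (y, t)) x"
  have pos: "\<forall>\<^sub>F \<mu> in at_top. \<mu> > (0::real)" by (rule eventually_gt_at_top)
  have z: "(x, t) \<in> spacetime" using t by simp
  have entry: "hessian (\<lambda>y. f (y, t)) x $ i $ j = iter_deriv [(axis i 1, 0), (axis j 1, 0)] f (x, t)"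
    if "smooth_on spacetime f" for f i j
    unfolding hessian_def using iter_deriv_slice[OF that t, of "[axis i 1, axis j 1]" x] by simp
  have "((\<lambda>\<mu>. \<bar>?A \<mu> $ i $ j - ?B $ i $ j\<bar>) \<longlongrightarrow> 0) at_top" for i j
  proof -
    have "((\<lambda>\<mu>. iter_deriv [(axis i 1, 0), (axis j 1, 0)] (F \<mu>) (x, t)) \<longlongrightarrow> ?B $ i $ j) at_top"
      unfolding entry[OF U] by (rule lim[OF _ z]) (auto simp: Basis_prod_def Basis_vec_def)
    moreover have "\<forall>\<^sub>F \<mu> in at_top. iter_deriv [(axis i 1, 0), (axis j 1, 0)] (F \<mu>) (x, t) = ?A \<mu> $ i $ j"
      using pos by eventually_elim (rule entry[OF F(1), symmetric])
    ultimately have "((\<lambda>\<mu>. ?A \<mu> $ i $ j) \<longlongrightarrow> ?B $ i $ j) at_top"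
      by (rule Lim_transform_eventually)
    then show ?thesis using LIM_zero tendsto_rabs_zero by blast
  qed
  then have "((\<lambda>\<mu>. real (CARD('n) ^ 3) * (\<Sum>i\<in>UNIV. \<Sum>j\<in>UNIV. \<bar>?A \<mu> $ i $ j - ?B $ i $ j\<bar>)) \<longlongrightarrow> real (CARD('n) ^ 3) * (\<Sum>i\<in>(UNIV::'n set). \<Sum>j\<in>(UNIV::'n set). 0)) at_top"
    by (intro tendsto_intros)
  then have small: "((\<lambda>\<mu>. real (CARD('n) ^ 3) * (\<Sum>i\<in>UNIV. \<Sum>j\<in>UNIV. \<bar>?A \<mu> $ i $ j - ?B $ i $ j\<bar>)) \<longlongrightarrow> 0) at_top"
    by simp
  have "\<forall>\<^sub>F \<mu> in at_top. norm (lagrangian_angle (?A \<mu>) - lagrangian_angle ?B)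
      \<le> real (CARD('n) ^ 3) * (\<Sum>i\<in>UNIV. \<Sum>j\<in>UNIV. \<bar>?A \<mu> $ i $ j - ?B $ i $ j\<bar>)"
    using pos
  proof eventually_elim
    case (elim \<mu>)
    have "\<bar>?A \<mu> $ i $ j - ?B $ i $ j\<bar> \<le> (\<Sum>i\<in>UNIV. \<Sum>j\<in>UNIV. \<bar>?A \<mu> $ i $ j - ?B $ i $ j\<bar>)" for i j
    proof -
      have "\<bar>?A \<mu> $ i $ j - ?B $ i $ j\<bar> \<le> (\<Sum>j\<in>UNIV. \<bar>?A \<mu> $ i $ j - ?B $ i $ j\<bar>)"
        by (intro member_le_sum) auto
      also have "\<dots> \<le> (\<Sum>i\<in>UNIV. \<Sum>j\<in>UNIV. \<bar>?A \<mu> $ i $ j - ?B $ i $ j\<bar>)"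
        by (intro member_le_sum[of i UNIV "\<lambda>i. \<Sum>j\<in>UNIV. \<bar>?A \<mu> $ i $ j - ?B $ i $ j\<bar>"]) (auto intro: sum_nonneg)
      finally show ?thesis .
    qed
    from lagrangian_angle_Lipschitz[OF hessian_slice_symmetric[OF F(1)[OF elim] t] hessian_slice_symmetric[OF U t] this]
    show ?case by simp
  qed
  from Lim_null_comparison[OF this small]
  have "((\<lambda>\<mu>. lagrangian_angle (?A \<mu>)) \<longlongrightarrow> lagrangian_angle ?B) at_top"
    by (rule LIM_zero_cancel)
  moreover have "\<forall>\<^sub>F \<mu> in at_top. lagrangian_angle (?A \<mu>) = iter_deriv [(0, 1)] (F \<mu>) (x, t)"
    using pos by eventually_elim (use dir_deriv_time_flow[OF F z] in simp)
  ultimately have "((\<lambda>\<mu>. iter_deriv [(0, 1)] (F \<mu>) (x, t)) \<longlongrightarrow> lagrangian_angle ?B) at_top"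
    by (rule Lim_transform_eventually)
  moreover have "((\<lambda>\<mu>. iter_deriv [(0, 1)] (F \<mu>) (x, t)) \<longlongrightarrow> iter_deriv [(0, 1)] U (x, t)) at_top"
    by (rule lim[OF _ z]) (auto simp: Basis_prod_def)
  ultimately have "lagrangian_angle ?B = dir_deriv (0, 1) U (x, t)"
    using tendsto_unique[OF trivial_limit_at_top_linorder] by fastforce
  then show "((\<lambda>s. U (x, s)) has_real_derivative lagrangian_angle ?B) (at t)"
    using time_derivative_eq[OF U t, of x] by simp
qed

text \<open>The value at \<open>(x, t)\<close> for the parameter \<open>\<mu>\<close> is \<open>t\<close> times the value at \<open>(x/\<surd>t, 1)\<close> for the parameter
  \<open>\<mu>\<surd>t\<close>, which tends to infinity with \<open>\<mu>\<close>.\<close>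

lemma self_expanding_limit:
  fixes u U :: "(real^'n) \<times> real \<Rightarrow> real"
  assumes lim: "\<And>z. z \<in> spacetime \<Longrightarrow> ((\<lambda>\<mu>. rescale u \<mu> z) \<longlongrightarrow> U z) at_top"
  shows "self_expanding U"
  unfolding self_expanding_def
proof (intro allI impI)
  fix x :: "real^'n" and t :: real assume t: "t > 0"
  have "filterlim (\<lambda>\<mu>. sqrt t * \<mu>) at_top at_top"
    using t by (intro filterlim_tendsto_pos_mult_at_top[OF tendsto_const]) (auto simp: filterlim_ident)
  from filterlim_compose[OF lim this, of "(x /\<^sub>R sqrt t, 1)"]
  have "((\<lambda>\<mu>. t * rescale u (sqrt t * \<mu>) (x /\<^sub>R sqrt t, 1)) \<longlongrightarrow> t * U (x /\<^sub>R sqrt t, 1)) at_top"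
    by (intro tendsto_mult_left) simp
  moreover have "t * rescale u (sqrt t * \<mu>) (x /\<^sub>R sqrt t, 1) = rescale u \<mu> (x, t)" for \<mu>
  proof -
    have "(sqrt t * \<mu>) *\<^sub>R (x /\<^sub>R sqrt t) = \<mu> *\<^sub>R x" using t by simp
    then show ?thesis using t unfolding rescale_def by (simp add: power_mult_distrib mult.commute del: scaleR_scaleR)
  qed
  ultimately have "((\<lambda>\<mu>. rescale u \<mu> (x, t)) \<longlongrightarrow> t * U (x /\<^sub>R sqrt t, 1)) at_top"
    by simp
  moreover have "((\<lambda>\<mu>. rescale u \<mu> (x, t)) \<longlongrightarrow> U (x, t)) at_top"
    using t by (intro lim) simp
  ultimately show "U (x, t) = t * U (x /\<^sub>R sqrt t, 1)"
    using tendsto_unique[OF trivial_limit_at_top_linorder] by blast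
qed

lemma converges_C0_loc_initial:
  fixes U :: "(real^'n) \<times> real \<Rightarrow> real"
  assumes "\<And>x t. t > 0 \<Longrightarrow> \<bar>U (x, t) - U0 x\<bar> \<le> c * t"
  shows "converges_C0_loc (\<lambda>t x. U (x, t)) U0 (at_right 0)"
  unfolding converges_C0_loc_def uniform_limit_iff
proof (intro allI impI)
  fix K :: "(real^'n) set" and e :: real assume e: "e > 0"
  have "((\<lambda>t. c * t) \<longlongrightarrow> c * 0) (at_right 0)" by (intro tendsto_intros)
  then have "\<forall>\<^sub>F t in at_right 0. c * t < e" using e by (auto dest: order_tendstoD(2))
  moreover have "\<forall>\<^sub>F t in at_right (0::real). t > 0" by (simp add: eventually_at_right_less)
  ultimately show "\<forall>\<^sub>F t in at_right 0. \<forall>x\<in>K. dist (U (x, t)) (U0 x) < e"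
  proof eventually_elim
    case (elim t)
    then show ?case using assms[of t] by (auto simp: dist_real_def intro: le_less_trans)
  qed
qed

theorem theorem1p3:
  fixes u0 U0 :: "real^'n \<Rightarrow> real"
    and u :: "(real^'n) \<times> real \<Rightarrow> real"
    and c :: real
  assumes "Ck_on 2 UNIV u0"
    and "two_convex u0"
    and "c > 0"
    and "\<forall>x. deriv_norm_sq 2 u0 x \<le> c"
    and "\<forall>x. ((\<lambda>\<mu>. u0 (\<mu> *\<^sub>R x) / \<mu>\<^sup>2) \<longlongrightarrow> U0 x) at_top"
    and "continuous_on (UNIV \<times> {0..}) u"
    and "smooth_on spacetime u"
    and "solves_flow u"
    and "\<forall>x. u (x, 0) = u0 x"
    and "\<forall>t>0. two_convex (\<lambda>x. u (x, t))"
    and "\<forall>l\<ge>2. \<exists>c_l>0. \<forall>t>0. \<forall>x.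
           deriv_norm_sq l (\<lambda>y. u (y, t)) x \<le> c_l * t powi (2 - int l)"
  shows "\<exists>U :: (real^'n) \<times> real \<Rightarrow> real.
           converges_Cinf_loc spacetime (\<lambda>\<mu> (x, t). u (\<mu> *\<^sub>R x, \<mu>\<^sup>2 * t) / \<mu>\<^sup>2) U at_top \<and>
           smooth_on spacetime U \<and> solves_flow U \<and> self_expanding U \<and>
           converges_C0_loc (\<lambda>t x. U (x, t)) U0 (at_right 0)"
proof -
  note u = assms(6,7,8)
  have u0: "(\<lambda>x. u (x, 0)) = u0" using assms(9) by auto
  note F = smooth_on_rescale[OF u(2)] solves_flow_rescale[OF u(2,3)]
  obtain C where C: "C \<ge> 0" "\<And>R y z. norm y \<le> R \<Longrightarrow> norm z \<le> R \<Longrightarrow> \<bar>u0 y - u0 z\<bar> \<le> C * (1 + R) * norm (y - z)"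
    using bounded_hessian_growth[OF assms(1)] assms(4) by blast
  have Cauchy0: "loc_unif_Cauchy spacetime (rescale u)"
    by (rule rescale_loc_unif_Cauchy[OF u, of C U0]) (use C assms(5,9) in auto)
  have Cauchy: "loc_unif_Cauchy spacetime (\<lambda>\<mu>. iter_deriv vs (rescale u \<mu>))" if "set vs \<subseteq> Basis" for vs
    using that
  proof (induction vs)
    case (Cons v vs)
    have "loc_bounded {0<..} spacetime (\<lambda>\<mu>. iter_deriv (v # v # vs) (rescale u \<mu>))"
    proof (rule flow_family_derivs_bounded)
      show "loc_bounded {0<..} spacetime (\<lambda>\<mu>. iter_deriv ws (rescale u \<mu>))"
        if "set ws \<subseteq> (\<lambda>b. (b, 0)) ` Basis" "2 \<le> length ws" for ws
        by (rule rescale_spatial_derivs_bounded[OF u(2) assms(11) that])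
    qed (use F Cons.prems in auto)
    then have "loc_unif_Cauchy spacetime (\<lambda>\<mu>. dir_deriv v (iter_deriv vs (rescale u \<mu>)))"
      using Cons by (intro loc_unif_Cauchy_dir_deriv open_spacetime smooth_on_iter_deriv F) auto
    then show ?case by simp
  qed (use Cauchy0 in simp)
  obtain U where U: "smooth_on spacetime U" "converges_Cinf_loc spacetime (rescale u) U at_top"
    using smooth_limit[OF open_spacetime F(1) Cauchy] by blast
  have lim: "((\<lambda>\<mu>. iter_deriv vs (rescale u \<mu>) z) \<longlongrightarrow> iter_deriv vs U z) at_top"
    if "set vs \<subseteq> Basis" "z \<in> spacetime" for vs z
    using U(2)[unfolded converges_Cinf_loc_def, rule_format, of "{z}" vs] that
    by (auto intro: tendsto_uniform_limitI)
  have lim0: "((\<lambda>\<mu>. rescale u \<mu> z) \<longlongrightarrow> U z) at_top" if "z \<in> spacetime" for z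
    using lim[of "[]" z] that by simp
  have init: "\<bar>U (x, t) - U0 x\<bar> \<le> CARD('n) * pi / 2 * t" if t: "t > 0" for x t
  proof -
    have "((\<lambda>\<mu>. \<bar>rescale u \<mu> (x, t) - rescale u \<mu> (x, 0)\<bar>) \<longlongrightarrow> \<bar>U (x, t) - U0 x\<bar>) at_top"
      using lim0[of "(x, t)"] t assms(5,9) by (intro tendsto_intros) (auto simp: rescale_def)
    moreover have "\<forall>\<^sub>F \<mu> in at_top. \<bar>rescale u \<mu> (x, t) - rescale u \<mu> (x, 0)\<bar> \<le> CARD('n) * pi / 2 * t"
      using eventually_gt_at_top[of 0]
      by eventually_elim (intro flow_time_Lipschitz continuous_on_rescale F u; use t in simp)
    ultimately show ?thesis by (rule tendsto_upperbound) simp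
  qed
  show ?thesis
  proof (intro exI[of _ U] conjI)
    show "converges_Cinf_loc spacetime (\<lambda>\<mu> (x, t). u (\<mu> *\<^sub>R x, \<mu>\<^sup>2 * t) / \<mu>\<^sup>2) U at_top"
      using U(2) by (simp only: rescale_def[abs_def])
    show "smooth_on spacetime U" by (rule U(1))
    show "solves_flow U" by (rule solves_flow_limit[OF F U(1) lim])
    show "self_expanding U" by (rule self_expanding_limit[OF lim0])
    show "converges_C0_loc (\<lambda>t x. U (x, t)) U0 (at_right 0)"
      by (rule converges_C0_loc_initial[OF init])
  qed
qed

end
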